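(* Work in a monster model of ACVF. Let $G$ be any geometric sort. Then for every $n$, every element of $\operatorname{Sym}^n G$ is interdefinable with a finite tuple from the geometric sorts.
   Context: ACVF is the theory of non-trivially valued algebraically closed valued fields; $K$ is the valued field, $\mathcal{O}$ the valuation ring, $\mathfrak{M}$ its maximal ideal, $k$ the residue field. A lattice in $K^n$ is an $\mathcal{O}$-submodule isomorphic to $\mathcal{O}^n$; $\operatorname{res}\Lambda=\Lambda/\mathfrak{M}\Lambda$. $R_{n,\ell}$ is the interpretable set of pairs $(\Lambda,V)$ with $\Lambda$ a lattice in $K^n$ and $V$ an $\ell$-dimensional $k$-subspace of $\operatorname{res}\Lambda$. The geometric sorts are $K$ and the $R_{n,\ell}$. $\operatorname{Sym}^n X$ denotes $X^n$ modulo the action of the symmetric group on $n$ letters permuting coordinates. *)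

theory Defs
  imports
    Jordan_Normal_Form.Matrix
    "HOL-Computational_Algebra.Polynomial"
    "HOL-Combinatorics.Permutations"
begin

unbundle cardinal_syntax

section \<open>First-order formulas over a valued field\<close>

text \<open>A valued field is a field \<open>K = UNIV :: 'a set\<close> with a valuation ring \<open>\<O> \<subseteq> K\<close>.
  The language is that of rings with a unary predicate for \<open>\<O>\<close>; the value group and the
  residue field are then interpretable sorts, so that this choice of language does not
  affect definability.\<close>

datatype tm = Var nat | Zero | One | Add tm tm | Mult tm tm | Uminus tm

datatype fm = Eq tm tm | InO tm | Neg fm | Conj fm fm | Ex nat fm

primrec tval :: "(nat \<Rightarrow> 'a::field) \<Rightarrow> tm \<Rightarrow> 'a" where
  "tval e (Var i) = e i"
| "tval e Zero = 0"
| "tval e One = 1"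
| "tval e (Add s t) = tval e s + tval e t"
| "tval e (Mult s t) = tval e s * tval e t"
| "tval e (Uminus t) = - tval e t"

primrec sat :: "'a::field set \<Rightarrow> (nat \<Rightarrow> 'a) \<Rightarrow> fm \<Rightarrow> bool" where
  "sat \<O> e (Eq s t) \<longleftrightarrow> tval e s = tval e t"
| "sat \<O> e (InO t) \<longleftrightarrow> tval e t \<in> \<O>"
| "sat \<O> e (Neg \<phi>) \<longleftrightarrow> \<not> sat \<O> e \<phi>"
| "sat \<O> e (Conj \<phi> \<psi>) \<longleftrightarrow> sat \<O> e \<phi> \<and> sat \<O> e \<psi>"
| "sat \<O> e (Ex i \<phi>) \<longleftrightarrow> (\<exists>x. sat \<O> (e(i := x)) \<phi>)"

primrec tvars :: "tm \<Rightarrow> nat set" where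
  "tvars (Var i) = {i}"
| "tvars Zero = {}"
| "tvars One = {}"
| "tvars (Add s t) = tvars s \<union> tvars t"
| "tvars (Mult s t) = tvars s \<union> tvars t"
| "tvars (Uminus t) = tvars t"

primrec fvars :: "fm \<Rightarrow> nat set" where
  "fvars (Eq s t) = tvars s \<union> tvars t"
| "fvars (InO t) = tvars t"
| "fvars (Neg \<phi>) = fvars \<phi>"
| "fvars (Conj \<phi> \<psi>) = fvars \<phi> \<union> fvars \<psi>"
| "fvars (Ex i \<phi>) = fvars \<phi> - {i}"

text \<open>\<open>D \<subseteq> K\<^sup>m\<close> (tuples are lists of length \<open>m\<close>) is definable with parameters from \<open>A\<close>:
  the variables below \<open>m\<close> are the object variables, the other free variables are
  interpreted by \<open>e\<close> as parameters.  For \<open>A = {}\<close> there are no other free variables.\<close>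

definition definable :: "'a::field set \<Rightarrow> 'a set \<Rightarrow> nat \<Rightarrow> 'a list set \<Rightarrow> bool" where
  "definable \<O> A m D \<longleftrightarrow>
    (\<exists>\<phi> e. (\<forall>i\<in>fvars \<phi>. i < m \<or> e i \<in> A) \<and>
      D = {xs. length xs = m \<and> sat \<O> (\<lambda>i. if i < m then xs ! i else e i) \<phi>})"

section \<open>Monster models of ACVF\<close>

definition valuation_ring :: "'a::field set \<Rightarrow> bool" where
  "valuation_ring \<O> \<longleftrightarrow>
    0 \<in> \<O> \<and> 1 \<in> \<O> \<and>
    (\<forall>x\<in>\<O>. \<forall>y\<in>\<O>. x + y \<in> \<O> \<and> x * y \<in> \<O> \<and> - x \<in> \<O>) \<and>
    (\<forall>x. x \<in> \<O> \<or> inverse x \<in> \<O>)"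

definition ACVF :: "'a::alg_closed_field set \<Rightarrow> bool" where
  "ACVF \<O> \<longleftrightarrow> valuation_ring \<O> \<and> \<O> \<noteq> UNIV"

text \<open>It suffices to realise types in one variable.\<close>

definition saturated :: "'k rel \<Rightarrow> 'a::field set \<Rightarrow> bool" where
  "saturated \<kappa> \<O> \<longleftrightarrow>
    (\<forall>A \<D>. |A| <o \<kappa> \<longrightarrow> (\<forall>D\<in>\<D>. definable \<O> A 1 D) \<longrightarrow>
      (\<forall>\<F>\<subseteq>\<D>. finite \<F> \<longrightarrow> \<Inter>\<F> \<noteq> {}) \<longrightarrow> \<Inter>\<D> \<noteq> {})"

definition elementary_map :: "'a::field set \<Rightarrow> 'a set \<Rightarrow> ('a \<Rightarrow> 'a) \<Rightarrow> bool" where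
  "elementary_map \<O> A f \<longleftrightarrow>
    (\<forall>\<phi> e. (\<forall>i\<in>fvars \<phi>. e i \<in> A) \<longrightarrow> (sat \<O> (f \<circ> e) \<phi> \<longleftrightarrow> sat \<O> e \<phi>))"

definition valued_automorphism :: "'a::field set \<Rightarrow> ('a \<Rightarrow> 'a) \<Rightarrow> bool" where
  "valued_automorphism \<O> \<sigma> \<longleftrightarrow>
    bij \<sigma> \<and> (\<forall>x y. \<sigma> (x + y) = \<sigma> x + \<sigma> y \<and> \<sigma> (x * y) = \<sigma> x * \<sigma> y) \<and>
    (\<forall>x. \<sigma> x \<in> \<O> \<longleftrightarrow> x \<in> \<O>)"

definition strongly_homogeneous :: "'k rel \<Rightarrow> 'a::field set \<Rightarrow> bool" where
  "strongly_homogeneous \<kappa> \<O> \<longleftrightarrow>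
    (\<forall>A f. |A| <o \<kappa> \<longrightarrow> elementary_map \<O> A f \<longrightarrow>
      (\<exists>\<sigma>. valued_automorphism \<O> \<sigma> \<and> (\<forall>x\<in>A. \<sigma> x = f x)))"

text \<open>The usual ``\<open>\<kappa>\<close> sufficiently large'' is read as: larger than the (countable) language.\<close>

definition monster_model :: "'k rel \<Rightarrow> 'a::alg_closed_field set \<Rightarrow> bool" where
  "monster_model \<kappa> \<O> \<longleftrightarrow>
    ACVF \<O> \<and> Card_order \<kappa> \<and> natLeq <o \<kappa> \<and> saturated \<kappa> \<O> \<and> strongly_homogeneous \<kappa> \<O>"

section \<open>Interpretable sets and interdefinability\<close>

text \<open>An interpretable set is presented by its elements together with, for each element \<open>x\<close>,
  the set of tuples in \<open>K\<^sup>m\<close> representing \<open>x\<close>; i.e. it is identified with the quotient of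
  the set of all representing tuples by the relation of representing the same element.\<close>

record ('a, 'b) interp =
  arity :: nat
  points :: "'b set"
  codes :: "'b \<Rightarrow> 'a list set"

text \<open>A relation between interpretable sets is \<open>\<emptyset>\<close>-definable iff its pullback to
  representing tuples is.\<close>

definition definable_rel ::
    "'a::field set \<Rightarrow> ('a, 'b) interp \<Rightarrow> ('a, 'c) interp \<Rightarrow> ('b \<times> 'c) set \<Rightarrow> bool" where
  "definable_rel \<O> S T R \<longleftrightarrow> R \<subseteq> points S \<times> points T \<and>
    definable \<O> {} (arity S + arity T) {a @ b |a b x y. (x, y) \<in> R \<and> a \<in> codes S x \<and> b \<in> codes T y}"

text \<open>\<open>y \<in> dcl x\<close>: the singleton of \<open>y\<close> is definable over \<open>x\<close>.\<close>

definition in_dcl ::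
    "'a::field set \<Rightarrow> ('a, 'b) interp \<Rightarrow> 'b \<Rightarrow> ('a, 'c) interp \<Rightarrow> 'c \<Rightarrow> bool" where
  "in_dcl \<O> S x T y \<longleftrightarrow> (\<exists>R. definable_rel \<O> S T R \<and> {y'. (x, y') \<in> R} = {y})"

definition interdefinable ::
    "'a::field set \<Rightarrow> ('a, 'b) interp \<Rightarrow> 'b \<Rightarrow> ('a, 'c) interp \<Rightarrow> 'c \<Rightarrow> bool" where
  "interdefinable \<O> S x T y \<longleftrightarrow> in_dcl \<O> S x T y \<and> in_dcl \<O> T y S x"

definition prod_interp :: "('a, 'b) interp list \<Rightarrow> ('a, 'b list) interp" where
  "prod_interp Ss = \<lparr>
    arity = sum_list (map arity Ss),
    points = {xs. list_all2 (\<lambda>x S. x \<in> points S) xs Ss},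
    codes = (\<lambda>xs. {concat cs |cs. list_all2 (\<in>) cs (map2 codes Ss xs)})\<rparr>"

definition perm_orbit :: "'b list \<Rightarrow> 'b list set" where
  "perm_orbit xs = {permute_list \<sigma> xs |\<sigma>. \<sigma> permutes {..<length xs}}"

definition Sym :: "nat \<Rightarrow> 'b set \<Rightarrow> 'b list set set" where
  "Sym n X = {perm_orbit xs |xs. length xs = n \<and> set xs \<subseteq> X}"

definition Sym_interp :: "nat \<Rightarrow> ('a, 'b) interp \<Rightarrow> ('a, 'b list set) interp" where
  "Sym_interp n S = \<lparr>
    arity = n * arity S,
    points = Sym n (points S),
    codes = (\<lambda>q. \<Union>xs\<in>q. codes (prod_interp (replicate n S)) xs)\<rparr>"

section \<open>Lattices and the geometric sorts\<close>

definition max_ideal :: "'a::field set \<Rightarrow> 'a set" where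
  "max_ideal \<O> = {x\<in>\<O>. \<not> (\<exists>y\<in>\<O>. x * y = 1)}"

definition std_lattice :: "'a::field set \<Rightarrow> nat \<Rightarrow> 'a vec set" where
  "std_lattice \<O> n = {v\<in>carrier_vec n. \<forall>i<n. v $ i \<in> \<O>}"

definition submodule :: "'a::field set \<Rightarrow> nat \<Rightarrow> 'a vec set \<Rightarrow> bool" where
  "submodule \<O> n N \<longleftrightarrow> N \<subseteq> carrier_vec n \<and> 0\<^sub>v n \<in> N \<and>
    (\<forall>v\<in>N. \<forall>w\<in>N. v + w \<in> N) \<and> (\<forall>a\<in>\<O>. \<forall>v\<in>N. a \<cdot>\<^sub>v v \<in> N)"

definition is_lattice :: "'a::field set \<Rightarrow> nat \<Rightarrow> 'a vec set \<Rightarrow> bool" where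
  "is_lattice \<O> n \<Lambda> \<longleftrightarrow> submodule \<O> n \<Lambda> \<and>
    (\<exists>f. bij_betw f (std_lattice \<O> n) \<Lambda> \<and>
      (\<forall>v\<in>std_lattice \<O> n. \<forall>w\<in>std_lattice \<O> n. f (v + w) = f v + f w) \<and>
      (\<forall>a\<in>\<O>. \<forall>v\<in>std_lattice \<O> n. f (a \<cdot>\<^sub>v v) = a \<cdot>\<^sub>v f v))"

text \<open>\<open>\<MM>\<Lambda>\<close>, the submodule generated by all products.\<close>

definition max_mult :: "'a::field set \<Rightarrow> nat \<Rightarrow> 'a vec set \<Rightarrow> 'a vec set" where
  "max_mult \<O> n \<Lambda> =
    \<Inter>{N. submodule \<O> n N \<and> (\<forall>a\<in>max_ideal \<O>. \<forall>v\<in>\<Lambda>. a \<cdot>\<^sub>v v \<in> N)}"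

definition res_class :: "'a::field set \<Rightarrow> nat \<Rightarrow> 'a vec set \<Rightarrow> 'a vec \<Rightarrow> 'a vec set" where
  "res_class \<O> n \<Lambda> v = {v + w |w. w \<in> max_mult \<O> n \<Lambda>}"

definition res :: "'a::field set \<Rightarrow> nat \<Rightarrow> 'a vec set \<Rightarrow> 'a vec set set" where
  "res \<O> n \<Lambda> = res_class \<O> n \<Lambda> ` \<Lambda>"

text \<open>Vector space notions over \<open>k = \<O>/\<MM>\<close> in \<open>res \<Lambda>\<close> are written out on representatives:
  the class of \<open>a\<close> acts on the class of \<open>v\<close> by \<open>a \<cdot>\<^sub>v v\<close>, and \<open>a\<close> is zero in \<open>k\<close> iff \<open>a \<in> \<MM>\<close>.\<close>

definition res_subspace :: "'a::field set \<Rightarrow> nat \<Rightarrow> 'a vec set \<Rightarrow> 'a vec set set \<Rightarrow> bool" where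
  "res_subspace \<O> n \<Lambda> V \<longleftrightarrow> V \<subseteq> res \<O> n \<Lambda> \<and> res_class \<O> n \<Lambda> (0\<^sub>v n) \<in> V \<and>
    (\<forall>v\<in>\<Lambda>. \<forall>w\<in>\<Lambda>. res_class \<O> n \<Lambda> v \<in> V \<longrightarrow> res_class \<O> n \<Lambda> w \<in> V \<longrightarrow>
      res_class \<O> n \<Lambda> (v + w) \<in> V) \<and>
    (\<forall>a\<in>\<O>. \<forall>v\<in>\<Lambda>. res_class \<O> n \<Lambda> v \<in> V \<longrightarrow> res_class \<O> n \<Lambda> (a \<cdot>\<^sub>v v) \<in> V)"

text \<open>The classes of the columns of \<open>U\<close> form a \<open>k\<close>-basis of \<open>V\<close>; \<open>U *\<^sub>v c\<close> is the linear
  combination of the columns with coefficients \<open>c\<close>.\<close>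

definition res_basis ::
    "'a::field set \<Rightarrow> nat \<Rightarrow> nat \<Rightarrow> 'a vec set \<Rightarrow> 'a vec set set \<Rightarrow> 'a mat \<Rightarrow> bool" where
  "res_basis \<O> n l \<Lambda> V U \<longleftrightarrow> U \<in> carrier_mat n l \<and> set (cols U) \<subseteq> \<Lambda> \<and>
    (\<forall>c\<in>std_lattice \<O> l. res_class \<O> n \<Lambda> (U *\<^sub>v c) = res_class \<O> n \<Lambda> (0\<^sub>v n) \<longrightarrow>
      (\<forall>i<l. c $ i \<in> max_ideal \<O>)) \<and>
    V = {res_class \<O> n \<Lambda> (U *\<^sub>v c) |c. c \<in> std_lattice \<O> l}"

definition R_set :: "'a::field set \<Rightarrow> nat \<Rightarrow> nat \<Rightarrow> ('a vec set \<times> 'a vec set set) set" where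
  "R_set \<O> n l = {(\<Lambda>, V). is_lattice \<O> n \<Lambda> \<and> res_subspace \<O> n \<Lambda> V \<and>
    (\<exists>U. res_basis \<O> n l \<Lambda> V U)}"

definition lattice_basis :: "'a::field set \<Rightarrow> nat \<Rightarrow> 'a vec set \<Rightarrow> 'a mat \<Rightarrow> bool" where
  "lattice_basis \<O> n \<Lambda> B \<longleftrightarrow> B \<in> carrier_mat n n \<and> bij_betw ((*\<^sub>v) B) (std_lattice \<O> n) \<Lambda>"

datatype sort_name = SortK | SortR nat nat

datatype 'a geom = InK 'a | InR "'a vec set" "'a vec set set"

text \<open>\<open>x \<in> K\<close> is represented by itself, \<open>(\<Lambda>, V)\<close> by the entries of the pairs \<open>(B, U)\<close> where the
  columns of \<open>B\<close> are an \<open>\<O>\<close>-basis of \<open>\<Lambda>\<close> and those of \<open>U\<close> lift a \<open>k\<close>-basis of \<open>V\<close>.\<close>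

fun geom_sort :: "'a::field set \<Rightarrow> sort_name \<Rightarrow> ('a, 'a geom) interp" where
  "geom_sort \<O> SortK = \<lparr>
    arity = 1,
    points = range InK,
    codes = (\<lambda>g. {[x] |x. g = InK x})\<rparr>"
| "geom_sort \<O> (SortR n l) = \<lparr>
    arity = n * n + n * l,
    points = {InR \<Lambda> V |\<Lambda> V. (\<Lambda>, V) \<in> R_set \<O> n l},
    codes = (\<lambda>g. {concat (mat_to_list B) @ concat (mat_to_list U) |B U \<Lambda> V.
      g = InR \<Lambda> V \<and> lattice_basis \<O> n \<Lambda> B \<and> res_basis \<O> n l \<Lambda> V U})\<rparr>"

end

theory Submission
  imports Defs "HOL-Library.Nat_Bijection" "Jordan_Normal_Form.Determinant"
begin

text \<open>By compactness and strong homogeneity, two elements of interpretable sets are interdefinable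
  as soon as they are fixed by the same automorphisms, so it suffices to find a tuple of geometric
  elements with the same stabiliser as the given multiset.  For elements of \<open>K\<close> the coefficients of
  \<open>\<Prod>(X - x\<^sub>i)\<close> do.

  A pair \<open>(\<Lambda>, V)\<close> is determined by the map sending \<open>h \<in> K\<^sup>n\<close> to its \<open>\<Lambda>\<close>-norm together with a bit that
  records whether the reduction of \<open>h\<close> lies in \<open>V\<close>; we view the values in \<open>\<Gamma> \<times> \<int>\<close>, ordered
  lexicographically, i.e. \<open>V\<close> is treated as an infinitesimal perturbation of \<open>\<Lambda>\<close>.  Such norms extend
  multiplicatively to pure tensors.  As the value group is torsion free, some pure tensor
  \<open>g \<in> (K\<^sup>n)\<^sup>\<otimes>\<^sup>d\<close> of bounded degree takes different values at all the distinct pairs under consideration.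
  Given a multiset of pairs, consider for every \<open>k\<close> the intersection, over all ways to choose \<open>k\<close> of
  them, of the unit balls in \<open>(K\<^sup>n)\<^sup>\<otimes>\<^sup>k\<^sup>d\<close> of the product norms.  Whether a multiple of \<open>g\<^sup>\<otimes>\<^sup>k\<close> lies
  in it tells the sum of the \<open>k\<close> largest values of \<open>g\<close>, so these balls determine the multiset.
  Each of them consists of a lattice and a subspace of its reduction, hence is an element of a
  geometric sort.\<close>

section \<open>Definable predicates\<close>

text \<open>The separating tensor \<open>g\<close> depends on choices, so it cannot enter the code;
  it only serves to show that the balls determine the multiset. What is coded is the whole family of
  balls of radius \<open>(1, w)\<close>, for \<open>k\<close>, \<open>d\<close> and \<open>w\<close>
  in finite ranges, which is canonically attached to the multiset. To see that an automorphism
  fixing the code fixes the multiset \<open>X\<close>, one \<open>g\<close> has to separate the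
  pairs of \<open>X\<close> and of its image simultaneously, and its degree has to be bounded by the
  size of \<open>X\<close> alone, as the code is chosen before the automorphism. This is the origin
  of \<open>sep_bound (2 * N)\<close>.

  Separation is essential because the balls only reveal values of \<open>g\<close>: where two pairs
  shared a value, it would not tell which of them occurs.

  The bit keeps the balls within the geometric sorts. The bits in a product of \<open>k * d\<close>
  factors add up to at most \<open>k * d\<close>, so the ball with \<open>w = k * d\<close> is a
  lattice, and the balls for smaller \<open>w\<close> lie between this lattice and its multiple by
  the maximal ideal, hence are preimages of subspaces of its reduction.\<close>

primrec tren :: "(nat \<Rightarrow> nat) \<Rightarrow> tm \<Rightarrow> tm" where
  "tren r (Var i) = Var (r i)"
| "tren r Zero = Zero"
| "tren r One = One"
| "tren r (Add s t) = Add (tren r s) (tren r t)"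
| "tren r (Mult s t) = Mult (tren r s) (tren r t)"
| "tren r (Uminus t) = Uminus (tren r t)"

text \<open>Bound variables are renamed too: the sum over the free variables bounds every renamed
  one, so its successor \<open>k\<close> is fresh and nothing is captured.\<close>

primrec ren :: "(nat \<Rightarrow> nat) \<Rightarrow> fm \<Rightarrow> fm" where
  "ren r (Eq s t) = Eq (tren r s) (tren r t)"
| "ren r (InO t) = InO (tren r t)"
| "ren r (Neg \<phi>) = Neg (ren r \<phi>)"
| "ren r (Conj \<phi> \<psi>) = Conj (ren r \<phi>) (ren r \<psi>)"
| "ren r (Ex i \<phi>) = (let k = Suc (\<Sum>j\<in>fvars \<phi>. r j) in Ex k (ren (r(i := k)) \<phi>))"

lemma finite_tvars [simp]: "finite (tvars t)"
  by (induction t) auto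

lemma finite_fvars [simp]: "finite (fvars \<phi>)"
  by (induction \<phi>) auto

lemma tval_cong: "(\<And>i. i \<in> tvars t \<Longrightarrow> e i = e' i) \<Longrightarrow> tval e t = tval e' t"
  by (induction t) auto

lemma sat_cong: "(\<And>i. i \<in> fvars \<phi> \<Longrightarrow> e i = e' i) \<Longrightarrow> sat \<O> e \<phi> \<longleftrightarrow> sat \<O> e' \<phi>"
proof (induction \<phi> arbitrary: e e')
  case (Eq s t)
  then show ?case using tval_cong[of s e e'] tval_cong[of t e e'] by auto
next
  case (InO t)
  then show ?case using tval_cong[of t e e'] by auto
next
  case (Neg \<phi>)
  have "sat \<O> e \<phi> \<longleftrightarrow> sat \<O> e' \<phi>"
    by (rule Neg.IH) (use Neg.prems in simp)
  then show ?case by simp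
next
  case (Conj \<phi>1 \<phi>2)
  have "sat \<O> e \<phi>1 \<longleftrightarrow> sat \<O> e' \<phi>1" "sat \<O> e \<phi>2 \<longleftrightarrow> sat \<O> e' \<phi>2"
    by (rule Conj.IH; use Conj.prems in simp)+
  then show ?case by simp
next
  case (Ex k \<phi>)
  have "sat \<O> (e(k := x)) \<phi> \<longleftrightarrow> sat \<O> (e'(k := x)) \<phi>" for x
    by (rule Ex.IH) (use Ex.prems in auto)
  then show ?case by auto
qed

lemma tval_tren: "tval e (tren r t) = tval (e \<circ> r) t"
  by (induction t) auto

lemma sat_ren: "sat \<O> e (ren r \<phi>) \<longleftrightarrow> sat \<O> (e \<circ> r) \<phi>"
proof (induction \<phi> arbitrary: e r)
  case (Ex i \<phi>)
  define k where "k = Suc (\<Sum>j\<in>fvars \<phi>. r j)"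
  have k: "r j \<noteq> k" if "j \<in> fvars \<phi>" for j
  proof -
    have "r j \<le> (\<Sum>j\<in>fvars \<phi>. r j)" using that by (intro member_le_sum) auto
    then show ?thesis by (simp add: k_def)
  qed
  have "sat \<O> (e(k := x)) (ren (r(i := k)) \<phi>) \<longleftrightarrow> sat \<O> ((e \<circ> r)(i := x)) \<phi>" for x
    unfolding Ex.IH by (rule sat_cong) (use k in auto)
  then show ?case by (simp add: k_def[symmetric] Let_def comp_def)
qed (simp_all add: tval_tren)

lemma fm_ex_finite:
  assumes "finite X"
  shows "\<exists>\<psi>. fvars \<psi> = fvars \<phi> - X \<and>
    (\<forall>e. sat \<O> e \<psi> \<longleftrightarrow> (\<exists>e'. (\<forall>i. i \<notin> X \<longrightarrow> e' i = e i) \<and> sat \<O> e' \<phi>))"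
  using assms
proof (induction X)
  case empty
  have "(\<exists>e'. (\<forall>i. e' i = e i) \<and> sat \<O> e' \<phi>) \<longleftrightarrow> sat \<O> e \<phi>" for e
    by (metis ext)
  then show ?case by (intro exI[of _ \<phi>]) auto
next
  case (insert x X)
  then obtain \<psi> where \<psi>: "fvars \<psi> = fvars \<phi> - X"
    "\<And>e. sat \<O> e \<psi> \<longleftrightarrow> (\<exists>e'. (\<forall>i. i \<notin> X \<longrightarrow> e' i = e i) \<and> sat \<O> e' \<phi>)"
    by blast
  have "sat \<O> e (Ex x \<psi>) \<longleftrightarrow> (\<exists>e'. (\<forall>i. i \<notin> insert x X \<longrightarrow> e' i = e i) \<and> sat \<O> e' \<phi>)" for e
  proof
    assume "sat \<O> e (Ex x \<psi>)"
    then obtain y e' where "\<forall>i. i \<notin> X \<longrightarrow> e' i = (e(x := y)) i" "sat \<O> e' \<phi>"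
      unfolding sat.simps \<psi>(2) by blast
    then show "\<exists>e'. (\<forall>i. i \<notin> insert x X \<longrightarrow> e' i = e i) \<and> sat \<O> e' \<phi>"
      by (intro exI[of _ e']) auto
  next
    assume "\<exists>e'. (\<forall>i. i \<notin> insert x X \<longrightarrow> e' i = e i) \<and> sat \<O> e' \<phi>"
    then obtain e' where e': "\<forall>i. i \<notin> insert x X \<longrightarrow> e' i = e i" "sat \<O> e' \<phi>" by blast
    have "sat \<O> (e(x := e' x)) \<psi>"
      unfolding \<psi>(2) using e' insert.hyps by (intro exI[of _ e']) auto
    then show "sat \<O> e (Ex x \<psi>)" by auto
  qed
  then show ?case using \<psi>(1) by (intro exI[of _ "Ex x \<psi>"]) auto
qed

definition flat :: "(nat \<Rightarrow> nat \<Rightarrow> 'a) \<Rightarrow> nat \<Rightarrow> 'a" where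
  "flat E v = E (fst (prod_decode v)) (snd (prod_decode v))"

text \<open>Assignments are organised in blocks: \<open>E b\<close> holds a tuple, of which only finitely many
  entries matter, so that quantifying over all of \<open>E b\<close> is still first order.\<close>

definition fdef :: "'a::field set \<Rightarrow> ((nat \<Rightarrow> nat \<Rightarrow> 'a) \<Rightarrow> bool) \<Rightarrow> bool" where
  "fdef \<O> P \<longleftrightarrow> (\<exists>\<phi>. \<forall>E. P E \<longleftrightarrow> sat \<O> (flat E) \<phi>)"

definition tdef :: "((nat \<Rightarrow> nat \<Rightarrow> 'a::field) \<Rightarrow> 'a) \<Rightarrow> bool" where
  "tdef f \<longleftrightarrow> (\<exists>t. \<forall>E. f E = tval (flat E) t)"

named_theorems fdef_intros

lemma tdef_var [fdef_intros]: "tdef (\<lambda>E. E b i)"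
  unfolding tdef_def by (intro exI[of _ "Var (prod_encode (b, i))"]) (simp add: flat_def)

lemma tdef_0 [fdef_intros]: "tdef (\<lambda>E. 0)"
  unfolding tdef_def by (intro exI[of _ Zero]) simp

lemma tdef_1 [fdef_intros]: "tdef (\<lambda>E. 1)"
  unfolding tdef_def by (intro exI[of _ One]) simp

lemma tdef_add [fdef_intros]: "tdef f \<Longrightarrow> tdef g \<Longrightarrow> tdef (\<lambda>E. f E + g E)"
  unfolding tdef_def by (metis tval.simps(4))

lemma tdef_mult [fdef_intros]: "tdef f \<Longrightarrow> tdef g \<Longrightarrow> tdef (\<lambda>E. f E * g E)"
  unfolding tdef_def by (metis tval.simps(5))

lemma tdef_sum [fdef_intros]:
  assumes "\<And>i. i < n \<Longrightarrow> tdef (f i)"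
  shows "tdef (\<lambda>E. \<Sum>i<(n::nat). f i E)"
  using assms
proof (induction n)
  case (Suc n)
  then have "tdef (\<lambda>E. (\<Sum>i<n. f i E) + f n E)" by (intro tdef_add) simp_all
  then show ?case by simp
qed (simp add: tdef_0)

lemma fdef_eq [fdef_intros]: "tdef f \<Longrightarrow> tdef g \<Longrightarrow> fdef \<O> (\<lambda>E. f E = g E)"
  unfolding tdef_def fdef_def by (metis sat.simps(1))

lemma fdef_in [fdef_intros]: "tdef f \<Longrightarrow> fdef \<O> (\<lambda>E. f E \<in> \<O>)"
  unfolding tdef_def fdef_def by (metis sat.simps(2))

lemma fdef_not [fdef_intros]: "fdef \<O> P \<Longrightarrow> fdef \<O> (\<lambda>E. \<not> P E)"
  unfolding fdef_def by (metis sat.simps(3))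

lemma fdef_conj [fdef_intros]: "fdef \<O> P \<Longrightarrow> fdef \<O> Q \<Longrightarrow> fdef \<O> (\<lambda>E. P E \<and> Q E)"
  unfolding fdef_def by (metis sat.simps(4))

lemma fdef_disj [fdef_intros]: "fdef \<O> P \<Longrightarrow> fdef \<O> Q \<Longrightarrow> fdef \<O> (\<lambda>E. P E \<or> Q E)"
  using fdef_not[OF fdef_conj[OF fdef_not[of \<O> P] fdef_not[of \<O> Q]]] by simp

lemma fdef_imp [fdef_intros]: "fdef \<O> P \<Longrightarrow> fdef \<O> Q \<Longrightarrow> fdef \<O> (\<lambda>E. P E \<longrightarrow> Q E)"
  unfolding imp_conv_disj by (intro fdef_disj fdef_not)

lemma fdef_iff [fdef_intros]: "fdef \<O> P \<Longrightarrow> fdef \<O> Q \<Longrightarrow> fdef \<O> (\<lambda>E. P E \<longleftrightarrow> Q E)"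
  unfolding iff_conv_conj_imp by (intro fdef_conj fdef_imp)

lemma fdef_const [fdef_intros]: "fdef \<O> (\<lambda>E. c)"
proof -
  have "fdef \<O> (\<lambda>E. (0::'a) = 0)" "fdef \<O> (\<lambda>E. (0::'a) \<noteq> 0)"
    by (intro fdef_intros)+
  then show ?thesis by (cases c) simp_all
qed

lemma fdef_Ball:
  assumes "finite I" "\<And>i. i \<in> I \<Longrightarrow> fdef \<O> (P i)"
  shows "fdef \<O> (\<lambda>E. \<forall>i\<in>I. P i E)"
  using assms by (induction I) (simp_all add: fdef_const fdef_conj)

lemma fdef_Bex:
  assumes "finite I" "\<And>i. i \<in> I \<Longrightarrow> fdef \<O> (P i)"
  shows "fdef \<O> (\<lambda>E. \<exists>i\<in>I. P i E)"
  using assms by (induction I) (simp_all add: fdef_const fdef_disj)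

lemma fdef_all_less [fdef_intros]:
  assumes "\<And>i. i < n \<Longrightarrow> fdef \<O> (P i)"
  shows "fdef \<O> (\<lambda>E. \<forall>i<(n::nat). P i E)"
  using fdef_Ball[of "{..<n}" \<O> P] assms by (simp add: Ball_def)

text \<open>Reindexing blocks is a renaming of variables, hence \<open>sat_ren\<close>. Later this
  cuts tuples out of longer ones.\<close>

lemma fdef_subst:
  assumes "fdef \<O> P"
  shows "fdef \<O> (\<lambda>E. P (\<lambda>b i. E (r b i) (s b i)))"
proof -
  obtain \<phi> where \<phi>: "\<And>E. P E \<longleftrightarrow> sat \<O> (flat E) \<phi>" using assms unfolding fdef_def by blast
  define \<rho> where "\<rho> = (\<lambda>v. case prod_decode v of (b, i) \<Rightarrow> prod_encode (r b i, s b i))"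
  have "flat E \<circ> \<rho> = flat (\<lambda>b i. E (r b i) (s b i))" for E :: "nat \<Rightarrow> nat \<Rightarrow> 'a"
    by (simp add: fun_eq_iff flat_def \<rho>_def split: prod.splits)
  then show ?thesis unfolding fdef_def by (intro exI[of _ "ren \<rho> \<phi>"]) (simp add: sat_ren \<phi>)
qed

lemma flat_inverse: "flat (\<lambda>b i. e (prod_encode (b, i))) = e"
  by (auto simp: flat_def)

text \<open>A block has infinitely many variables, but a formula mentions only finitely many of
  them, and only those have to be quantified. The bound block is number 0 and the others are shifted
  up, as with de Bruijn indices.\<close>

lemma fdef_ex_block:
  assumes "fdef \<O> (\<lambda>E. P (E 0) (\<lambda>b. E (Suc b)))"
  shows "fdef \<O> (\<lambda>E. \<exists>y. P y E)"
proof -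
  obtain \<phi> where \<phi>: "\<And>E. P (E 0) (\<lambda>b. E (Suc b)) \<longleftrightarrow> sat \<O> (flat E) \<phi>"
    using assms unfolding fdef_def by blast
  \<comment> \<open>All block numbers in \<phi> are below \<open>c\<close>, so block
    \<open>c\<close> can take over the role of block 0 once the other blocks are shifted back
    down.\<close>
  define c where "c = Suc (\<Sum>v\<in>fvars \<phi>. fst (prod_decode v))"
  have c: "fst (prod_decode v) < c" if "v \<in> fvars \<phi>" for v
  proof -
    have "fst (prod_decode v) \<le> (\<Sum>v\<in>fvars \<phi>. fst (prod_decode v))"
      using that by (intro member_le_sum) auto
    then show ?thesis by (simp add: c_def)
  qed
  define \<rho> where "\<rho> = (\<lambda>v. case prod_decode v of (b, i) \<Rightarrow>
    prod_encode (case b of 0 \<Rightarrow> c | Suc b' \<Rightarrow> b', i))"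
  define X where "X = fvars (ren \<rho> \<phi>) \<inter> {v. fst (prod_decode v) = c}"
  have "finite X" by (simp add: X_def)
  then obtain \<psi> where \<psi>:
    "\<And>e. sat \<O> e \<psi> \<longleftrightarrow> (\<exists>e'. (\<forall>i. i \<notin> X \<longrightarrow> e' i = e i) \<and> sat \<O> e' (ren \<rho> \<phi>))"
    using fm_ex_finite[of X "ren \<rho> \<phi>" \<O>] by blast
  have "(\<exists>y. P y E) \<longleftrightarrow> sat \<O> (flat E) \<psi>" for E
  proof -
    have eq: "sat \<O> (flat (E(c := y))) (ren \<rho> \<phi>) \<longleftrightarrow> P y E" for y
    proof -
      have "sat \<O> (flat (E(c := y))) (ren \<rho> \<phi>) \<longleftrightarrow> sat \<O> (flat (case_nat y E)) \<phi>"
        unfolding sat_ren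
      proof (rule sat_cong)
        fix v assume "v \<in> fvars \<phi>"
        with c show "(flat (E(c := y)) \<circ> \<rho>) v = flat (case_nat y E) v"
          by (fastforce simp: flat_def \<rho>_def split: prod.splits nat.splits)
      qed
      also have "\<dots> \<longleftrightarrow> P y E" using \<phi>[of "case_nat y E"] by simp
      finally show ?thesis .
    qed
    show ?thesis
    proof
      assume "\<exists>y. P y E"
      then obtain y where y: "sat \<O> (flat (E(c := y))) (ren \<rho> \<phi>)" using eq by blast
      define e' where "e' = (\<lambda>v. if v \<in> X then flat (E(c := y)) v else flat E v)"
      have "sat \<O> e' (ren \<rho> \<phi>)"
        using y by (rule iffD1[OF sat_cong, rotated]) (auto simp: e'_def X_def flat_def)
      then show "sat \<O> (flat E) \<psi>"
        unfolding \<psi> by (intro exI[of _ e']) (auto simp: e'_def)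
    next
      assume "sat \<O> (flat E) \<psi>"
      then obtain e' where e': "\<forall>i. i \<notin> X \<longrightarrow> e' i = flat E i" "sat \<O> e' (ren \<rho> \<phi>)"
        unfolding \<psi> by blast
      define y where "y = (\<lambda>i. e' (prod_encode (c, i)))"
      have "sat \<O> (flat (E(c := y))) (ren \<rho> \<phi>)"
        using e'(2)
      proof (rule iffD1[OF sat_cong, rotated])
        fix v assume "v \<in> fvars (ren \<rho> \<phi>)"
        show "e' v = flat (E(c := y)) v"
        proof (cases "fst (prod_decode v) = c")
          case True
          then have "prod_encode (c, snd (prod_decode v)) = v"
            by (metis prod.collapse prod_decode_inverse)
          then show ?thesis using True by (auto simp: flat_def y_def)
        next
          case False
          then have "v \<notin> X" by (auto simp: X_def)
          then show ?thesis using e'(1) False by (auto simp: flat_def)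
        qed
      qed
      then show "\<exists>y. P y E" using eq by blast
    qed
  qed
  then show ?thesis unfolding fdef_def by blast
qed

lemma fdef_all_block:
  assumes "fdef \<O> (\<lambda>E. P (E 0) (\<lambda>b. E (Suc b)))"
  shows "fdef \<O> (\<lambda>E. \<forall>y. P y E)"
  using fdef_not[OF fdef_ex_block[of \<O> "\<lambda>y E. \<not> P y E"]] fdef_not[OF assms] by simp

text \<open>The formula behind \<open>Q\<close> may mention variables from \<open>m\<close> on,
  which would count as parameters, although by \<open>cong\<close> its truth does not depend on
  them. Quantifying them away leaves a formula without parameters.\<close>

lemma definable_fdefI:
  assumes "fdef \<O> (\<lambda>E. Q (E 0))"
    and cong: "\<And>f g. (\<And>i. i < m \<Longrightarrow> f i = g i) \<Longrightarrow> Q f \<longleftrightarrow> Q g"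
  shows "definable \<O> {} m {xs. length xs = m \<and> Q ((!) xs)}"
proof -
  obtain \<phi> where \<phi>: "\<And>E. Q (E 0) \<longleftrightarrow> sat \<O> (flat E) \<phi>" using assms(1) unfolding fdef_def by blast
  \<comment> \<open>\<open>Q\<close> looks at block 0 only, so all blocks may be filled with the
    same tuple and block numbers forgotten.\<close>
  define \<rho> where "\<rho> = (\<lambda>v. snd (prod_decode v))"
  have "e \<circ> \<rho> = flat (\<lambda>_. e)" for e :: "nat \<Rightarrow> 'a" by (auto simp: flat_def \<rho>_def)
  then have Q: "sat \<O> e (ren \<rho> \<phi>) \<longleftrightarrow> Q e" for e using \<phi>[of "\<lambda>_. e"] by (simp add: sat_ren)
  define X where "X = fvars (ren \<rho> \<phi>) - {..<m}"
  have "finite X" by (simp add: X_def)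
  then obtain \<psi> where \<psi>: "fvars \<psi> = fvars (ren \<rho> \<phi>) - X"
    "\<And>e. sat \<O> e \<psi> \<longleftrightarrow> (\<exists>e'. (\<forall>i. i \<notin> X \<longrightarrow> e' i = e i) \<and> sat \<O> e' (ren \<rho> \<phi>))"
    using fm_ex_finite[of X "ren \<rho> \<phi>" \<O>] by blast
  have sat: "sat \<O> e \<psi> \<longleftrightarrow> Q e" for e
  proof
    assume "sat \<O> e \<psi>"
    then obtain e' where "\<forall>i. i \<notin> X \<longrightarrow> e' i = e i" "Q e'" unfolding \<psi>(2) Q by blast
    moreover have "i \<notin> X" if "i < m" for i using that by (auto simp: X_def)
    ultimately show "Q e" using cong[of e e'] by simp
  next
    assume "Q e"
    then show "sat \<O> e \<psi>" unfolding \<psi>(2) Q by blast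
  qed
  show ?thesis unfolding definable_def
  proof (intro exI conjI ballI)
    fix i assume "i \<in> fvars \<psi>"
    then show "i < m \<or> (\<lambda>_. 0) i \<in> {}" by (auto simp: \<psi>(1) X_def)
  next
    show "{xs. length xs = m \<and> Q ((!) xs)} =
      {xs. length xs = m \<and> sat \<O> (\<lambda>i. if i < m then xs ! i else (\<lambda>_. 0) i) \<psi>}"
      unfolding sat
      by (intro Collect_cong conj_cong refl cong) auto
  qed
qed

lemma fdef_definable:
  assumes "definable \<O> {} m D"
  shows "fdef \<O> (\<lambda>E. map (E 0) [0..<m] \<in> D)"
proof -
  obtain \<phi> e where \<phi>': "\<forall>i\<in>fvars \<phi>. i < m \<or> e i \<in> {}"
    "D = {xs. length xs = m \<and> sat \<O> (\<lambda>i. if i < m then xs ! i else e i) \<phi>}"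
    using assms unfolding definable_def by (elim exE conjE) (rule that)
  have \<phi>: "i < m" if "i \<in> fvars \<phi>" for i using that \<phi>'(1) by simp
  have "map (E 0) [0..<m] \<in> D \<longleftrightarrow> sat \<O> (flat E) (ren (\<lambda>i. prod_encode (0, i)) \<phi>)" for E
  proof -
    have "sat \<O> (\<lambda>i. if i < m then map (E 0) [0..<m] ! i else e i) \<phi> \<longleftrightarrow>
        sat \<O> (flat E \<circ> (\<lambda>i. prod_encode (0, i))) \<phi>"
      by (rule sat_cong) (use \<phi> in \<open>simp add: flat_def\<close>)
    then show ?thesis unfolding \<phi>'(2) sat_ren by simp
  qed
  then show ?thesis unfolding fdef_def by blast
qed

section \<open>Definable closure via automorphisms\<close>

lemma fdef_mem:
  assumes "definable \<O> {} m D"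
  shows "fdef \<O> (\<lambda>E. map (\<lambda>i. E (r i) (s i)) [0..<m] \<in> D)"
  using fdef_subst[OF fdef_definable[OF assms], of "\<lambda>b. r" "\<lambda>b. s"] by simp

lemma definable_listI:
  fixes D :: "'a::field list set"
  assumes "fdef \<O> (\<lambda>E. map (E 0) [0..<m] \<in> D)" and "\<And>xs. xs \<in> D \<Longrightarrow> length xs = m"
  shows "definable \<O> {} m D"
proof -
  have "definable \<O> {} m {xs. length xs = m \<and> map ((!) xs) [0..<m] \<in> D}"
    using assms(1) by (rule definable_fdefI) (rule arg_cong[where f = "\<lambda>x. x \<in> D"], simp)
  moreover have "{xs. length xs = m \<and> map ((!) xs) [0..<m] \<in> D} = D"
  proof (rule Set.set_eqI)
    fix xs :: "'a list"
    have "length xs = m \<Longrightarrow> map ((!) xs) [0..<m] = xs" by (metis map_nth)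
    then show "xs \<in> {xs. length xs = m \<and> map ((!) xs) [0..<m] \<in> D} \<longleftrightarrow> xs \<in> D"
      unfolding mem_Collect_eq using assms(2)[of xs] by metis
  qed
  ultimately show ?thesis by simp
qed

lemma definable_params:
  assumes "definable \<O> {} (m + length zs) D"
  shows "definable \<O> (set zs) m {xs. length xs = m \<and> xs @ zs \<in> D}"
proof -
  obtain \<phi> e where \<phi>: "\<forall>i\<in>fvars \<phi>. i < m + length zs \<or> e i \<in> {}"
    "D = {xs. length xs = m + length zs \<and> sat \<O> (\<lambda>i. if i < m + length zs then xs ! i else e i) \<phi>}"
    using assms unfolding definable_def by (elim exE conjE) (rule that)
  show ?thesis unfolding definable_def
  proof (intro exI conjI ballI)
    fix i assume "i \<in> fvars \<phi>"
    then have "i < m + length zs" using \<phi>(1) by simp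
    then show "i < m \<or> (\<lambda>i. zs ! (i - m)) i \<in> set zs"
      by (metis add_diff_inverse_nat nat_add_left_cancel_less nth_mem)
  next
    have "sat \<O> (\<lambda>i. if i < m + length zs then (xs @ zs) ! i else e i) \<phi> \<longleftrightarrow>
      sat \<O> (\<lambda>i. if i < m then xs ! i else zs ! (i - m)) \<phi>" if "length xs = m" for xs
      by (rule sat_cong) (use \<phi>(1) that in \<open>simp add: nth_append\<close>)
    then show "{xs. length xs = m \<and> xs @ zs \<in> D} =
      {xs. length xs = m \<and> sat \<O> (\<lambda>i. if i < m then xs ! i else zs ! (i - m)) \<phi>}"
      unfolding \<phi>(2) by (intro Collect_cong conj_cong refl) simp
  qed
qed

section \<open>Realising types of tuples\<close>

lemma finite_card_less:
  assumes "Card_order \<kappa>" "natLeq <o \<kappa>" "finite A"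
  shows "|A| <o \<kappa>"
  using assms finite_iff_ordLess_natLeq ordLess_transitive by blast

text \<open>Induction on \<open>m\<close>: the entry next to the parameters is realised first and
  then joins them. Its type consists of the projections of all finite intersections from
  \<open>\<D>\<close>, not just of single members, because projection does not commute with
  intersection.\<close>

lemma saturated_tuple:
  fixes \<O> :: "'a::field set"
  assumes mon: "Card_order \<kappa>" "natLeq <o \<kappa>" "saturated \<kappa> \<O>"
    and "\<And>D. D \<in> \<D> \<Longrightarrow> definable \<O> {} (m + length zs) D"
    and "\<And>\<F>. finite \<F> \<Longrightarrow> \<F> \<subseteq> \<D> \<Longrightarrow> \<exists>xs. length xs = m \<and> (\<forall>D\<in>\<F>. xs @ zs \<in> D)"
  shows "\<exists>xs. length xs = m \<and> (\<forall>D\<in>\<D>. xs @ zs \<in> D)"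
  using assms(4,5)
proof (induction m arbitrary: zs)
  case 0
  have "zs \<in> D" if "D \<in> \<D>" for D
    using "0.prems"(2)[of "{D}"] that by simp
  then show ?case by simp
next
  case (Suc m)
  define G where "G \<F> = {ys. length ys = Suc (length zs) \<and> (\<exists>xs. length xs = m \<and> (\<forall>D\<in>\<F>. xs @ ys \<in> D))}"
    for \<F> :: "'a list set set"
  define H where "H \<F> = {xs. length xs = 1 \<and> xs @ zs \<in> G \<F>}" for \<F> :: "'a list set set"
  have H: "definable \<O> (set zs) 1 (H \<F>)" if \<F>: "finite \<F>" "\<F> \<subseteq> \<D>" for \<F>
    unfolding H_def
  proof (rule definable_params, rule definable_listI)
    have "fdef \<O> (\<lambda>E. \<exists>y. \<forall>D\<in>\<F>. map (\<lambda>i. if i < m then y i else E 0 (i - m)) [0..<Suc m + length zs] \<in> D)"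
    proof (rule fdef_ex_block, rule fdef_Ball[OF \<F>(1)])
      fix D assume "D \<in> \<F>"
      with \<F>(2) have D: "definable \<O> {} (Suc m + length zs) D" by (intro Suc.prems(1)) auto
      have eq: "(\<lambda>i. E (if i < m then 0 else 1) (if i < m then i else i - m)) =
        (\<lambda>i. if i < m then E 0 i else E (Suc 0) (i - m))" for E :: "nat \<Rightarrow> nat \<Rightarrow> 'a" by auto
      show "fdef \<O> (\<lambda>E. map (\<lambda>i. if i < m then E 0 i else E (Suc 0) (i - m)) [0..<Suc m + length zs] \<in> D)"
        using fdef_mem[OF D, of "\<lambda>i. if i < m then 0 else 1" "\<lambda>i. if i < m then i else i - m"]
        unfolding eq .
    qed
    moreover have "map (E 0) [0..<1 + length zs] \<in> G \<F> \<longleftrightarrow>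
      (\<exists>y. \<forall>D\<in>\<F>. map (\<lambda>i. if i < m then y i else E 0 (i - m)) [0..<Suc m + length zs] \<in> D)" (is "?l \<longleftrightarrow> ?r")
      for E :: "nat \<Rightarrow> nat \<Rightarrow> 'a"
    proof -
      have eq: "map y [0..<m] @ map (E 0) [0..<Suc (length zs)] =
        map (\<lambda>i. if i < m then y i else E 0 (i - m)) [0..<Suc m + length zs]" for y :: "nat \<Rightarrow> 'a"
        by (rule nth_equalityI) (simp_all add: nth_append del: upt_Suc)
      show ?thesis
      proof
        assume ?l
        then obtain xs where xs: "length xs = m" "\<forall>D\<in>\<F>. xs @ map (E 0) [0..<Suc (length zs)] \<in> D"
          by (auto simp: G_def simp del: upt_Suc)
        have map_xs: "map ((!) xs) [0..<m] = xs" using xs(1) by (metis map_nth)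
        show ?r by (rule exI[of _ "(!) xs"], unfold eq[symmetric] map_xs) (rule xs(2))
      next
        assume ?r
        then show ?l unfolding G_def eq[symmetric]
          by (auto intro: exI[of _ "map _ [0..<m]"] simp del: upt_Suc)
      qed
    qed
    ultimately show "fdef \<O> (\<lambda>E. map (E 0) [0..<1 + length zs] \<in> G \<F>)" by simp
  qed (simp add: G_def)
  have "|set zs| <o \<kappa>" using mon(1,2) by (rule finite_card_less) simp
  moreover have "\<forall>D\<in>H ` {\<F>. finite \<F> \<and> \<F> \<subseteq> \<D>}. definable \<O> (set zs) 1 D" using H by blast
  moreover have "\<Inter>\<G> \<noteq> {}" if \<G>: "\<G> \<subseteq> H ` {\<F>. finite \<F> \<and> \<F> \<subseteq> \<D>}" "finite \<G>" for \<G>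
  proof -
    obtain \<C> where \<C>: "\<C> \<subseteq> {\<F>. finite \<F> \<and> \<F> \<subseteq> \<D>}" "finite \<C>" "\<G> = H ` \<C>"
      using finite_subset_image[OF \<G>(2,1)] by auto
    \<comment> \<open>Finitely many finite subfamilies have a finite union, and a tuple lying in all
      its members gives a common point of their projections.\<close>
    have "finite (\<Union>\<C>)" "\<Union>\<C> \<subseteq> \<D>" using \<C> by auto
    from Suc.prems(2)[OF this] obtain xs where xs: "length xs = Suc m" "\<forall>D\<in>\<Union>\<C>. xs @ zs \<in> D" by blast
    have "take m xs @ [xs ! m] = xs" using xs(1) by (metis lessI take_Suc_conv_app_nth take_all order_refl)
    then have "xs = take m xs @ [xs ! m]" by simp
    then obtain ys y where ys: "xs = ys @ [y]" "length ys = m" using xs(1) by (metis length_append_singleton nat.inject)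
    have "[y] \<in> H \<F>" if "\<F> \<in> \<C>" for \<F>
      unfolding H_def G_def using xs(2) ys that by auto
    then show ?thesis using \<C>(3) by auto
  qed
  ultimately have "\<Inter>(H ` {\<F>. finite \<F> \<and> \<F> \<subseteq> \<D>}) \<noteq> {}"
    using mon(3) unfolding saturated_def by blast
  then obtain us where us: "\<And>\<F>. finite \<F> \<Longrightarrow> \<F> \<subseteq> \<D> \<Longrightarrow> us \<in> H \<F>" by auto
  from us[of "{}"] obtain u where "us = [u]" by (auto simp: H_def length_Suc_conv)
  then have u: "\<exists>xs. length xs = m \<and> (\<forall>D\<in>\<F>. xs @ u # zs \<in> D)" if "finite \<F>" "\<F> \<subseteq> \<D>" for \<F>
    using us[OF that] by (auto simp: H_def G_def)
  have "\<exists>xs. length xs = m \<and> (\<forall>D\<in>\<D>. xs @ u # zs \<in> D)"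
    by (rule Suc.IH) (use Suc.prems(1) u in auto)
  then obtain xs where "length xs = m" "\<forall>D\<in>\<D>. xs @ u # zs \<in> D" by blast
  then show ?case by (intro exI[of _ "xs @ [u]"]) simp
qed

lemma valued_automorphism_simps:
  fixes \<sigma> :: "'a::field \<Rightarrow> 'a"
  assumes "valued_automorphism \<O> \<sigma>"
  shows "\<sigma> (x + y) = \<sigma> x + \<sigma> y" "\<sigma> (x * y) = \<sigma> x * \<sigma> y" "\<sigma> 0 = 0" "\<sigma> 1 = 1" "\<sigma> (- x) = - \<sigma> x"
    "\<sigma> x \<in> \<O> \<longleftrightarrow> x \<in> \<O>" "bij \<sigma>"
proof -
  have add: "\<sigma> (x + y) = \<sigma> x + \<sigma> y" and mult: "\<sigma> (x * y) = \<sigma> x * \<sigma> y" for x y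
    using assms by (auto simp: valued_automorphism_def)
  then show "\<sigma> (x + y) = \<sigma> x + \<sigma> y" "\<sigma> (x * y) = \<sigma> x * \<sigma> y" by blast+
  show bij: "bij \<sigma>" using assms by (simp add: valued_automorphism_def)
  show 0: "\<sigma> 0 = 0" using add[of 0 0] by (metis add_0 add_cancel_right_right)
  have "\<sigma> 1 \<noteq> 0" using bij 0 by (metis bij_pointE zero_neq_one)
  then show "\<sigma> 1 = 1" using mult[of 1 1] by simp
  show "\<sigma> (- x) = - \<sigma> x" using add[of x "- x"] 0 by (simp add: minus_unique)
  show "\<sigma> x \<in> \<O> \<longleftrightarrow> x \<in> \<O>" using assms by (auto simp: valued_automorphism_def)
qed

section \<open>Interpretations as quotients, and definable closure\<close>

definition same_code :: "('a, 'b) interp \<Rightarrow> 'a list \<Rightarrow> 'a list \<Rightarrow> bool" where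
  "same_code S a b \<longleftrightarrow> (\<exists>x\<in>points S. a \<in> codes S x \<and> b \<in> codes S x)"

text \<open>These conditions make the record a genuine quotient of a \<emptyset>-definable set by a
  \<emptyset>-definable equivalence relation: \<open>same_code\<close> is a partial equivalence
  relation whose domain is the set of all codes.\<close>

definition proper_interp :: "'a::field set \<Rightarrow> ('a, 'b) interp \<Rightarrow> bool" where
  "proper_interp \<O> S \<longleftrightarrow>
    fdef \<O> (\<lambda>E. same_code S (map (E 0) [0..<arity S]) (map (E 1) [0..<arity S])) \<and>
    (\<forall>x\<in>points S. codes S x \<noteq> {} \<and> (\<forall>c\<in>codes S x. length c = arity S)) \<and>
    (\<forall>x\<in>points S. \<forall>y\<in>points S. codes S x \<inter> codes S y \<noteq> {} \<longrightarrow> x = y)"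

lemma proper_interpD:
  assumes "proper_interp \<O> S" "x \<in> points S"
  shows "codes S x \<noteq> {}" "c \<in> codes S x \<Longrightarrow> length c = arity S"
    "y \<in> points S \<Longrightarrow> c \<in> codes S x \<Longrightarrow> c \<in> codes S y \<Longrightarrow> x = y"
    "c \<in> codes S x \<Longrightarrow> same_code S c d \<longleftrightarrow> d \<in> codes S x"
  using assms unfolding proper_interp_def same_code_def by blast+

lemma fdef_same_code:
  assumes "proper_interp \<O> S"
  shows "fdef \<O> (\<lambda>E. same_code S (map (\<lambda>i. E (r i) (s i)) [0..<arity S]) (map (\<lambda>i. E (r' i) (s' i)) [0..<arity S]))"
proof -
  have "fdef \<O> (\<lambda>E. same_code S (map (E 0) [0..<arity S]) (map (E 1) [0..<arity S]))"
    using assms by (simp add: proper_interp_def)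
  from fdef_subst[OF this, of "\<lambda>b i. if b = 0 then r i else r' i" "\<lambda>b i. if b = 0 then s i else s' i"]
  show ?thesis by simp
qed

text \<open>If no formula of the type of \<open>(a, b)\<close> isolated \<open>y\<close> over \<open>x\<close>, saturation would yield a
  conjugate of \<open>(a, b)\<close> whose first half still represents \<open>x\<close> but whose second half does not
  represent \<open>y\<close>.\<close>

lemma in_dcl_automorphismI:
  fixes \<O> :: "'a::alg_closed_field set"
  assumes mon: "monster_model \<kappa> \<O>"
    and S: "proper_interp \<O> S" and T: "proper_interp \<O> T"
    and x: "x \<in> points S" and y: "y \<in> points T"
    and a: "a \<in> codes S x" and b: "b \<in> codes T y"
    and aut: "\<And>\<sigma>. valued_automorphism \<O> \<sigma> \<Longrightarrow> map \<sigma> a \<in> codes S x \<Longrightarrow> map \<sigma> b \<in> codes T y"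
  shows "in_dcl \<O> S x T y"
proof -
  define r s where "r = arity S" and "s = arity T"
  \<comment> \<open>The complete type of \<open>a @ b\<close> over the empty set, as an ultrafilter
    of \<emptyset>-definable sets.\<close>
  define tp where "tp = {X. definable \<O> {} (r + s) X \<and> a @ b \<in> X}"
  have len: "length a = r" "length b = s"
    using proper_interpD(2)[OF S x a] proper_interpD(2)[OF T y b] by (auto simp: r_def s_def)
  have "\<exists>X\<in>tp. \<forall>a' b'. a' @ b' \<in> X \<longrightarrow> a' \<in> codes S x \<longrightarrow> length b' = s \<longrightarrow> b' \<in> codes T y"
  proof (rule ccontr)
    assume neg: "\<not> ?thesis"
    \<comment> \<open>The first half of \<open>zs\<close> is the tuple sought, the second half holds
      the parameters \<open>a @ b\<close>.\<close>
    define Z where "Z X = {zs. length zs = (r + s) + (r + s) \<and> take (r + s) zs \<in> X \<and>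
      same_code S (take r (drop (r + s) zs)) (take r zs) \<and>
      \<not> same_code T (drop r (drop (r + s) zs)) (drop r (take (r + s) zs))}" for X
    have "\<exists>p. length p = r + s \<and> (\<forall>D\<in>Z ` tp. p @ (a @ b) \<in> D)"
    proof (rule saturated_tuple)
      show "Card_order \<kappa>" "natLeq <o \<kappa>" "saturated \<kappa> \<O>" using mon by (auto simp: monster_model_def)
      fix D assume "D \<in> Z ` tp"
      then obtain X where X: "X \<in> tp" "D = Z X" by blast
      have "definable \<O> {} ((r + s) + (r + s)) (Z X)"
      proof (rule definable_listI)
        have "fdef \<O> (\<lambda>E. map (\<lambda>i. E 0 i) [0..<r + s] \<in> X \<and>
          same_code S (map (\<lambda>i. E 0 (r + s + i)) [0..<r]) (map (\<lambda>i. E 0 i) [0..<r]) \<and>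
          \<not> same_code T (map (\<lambda>i. E 0 (r + s + r + i)) [0..<s]) (map (\<lambda>i. E 0 (r + i)) [0..<s]))"
          using X(1) unfolding r_def s_def tp_def
          by (intro fdef_conj fdef_not fdef_same_code S T fdef_mem) simp
        moreover have "take r (drop (r + s) (map f [0..<r + s + (r + s)])) = map (\<lambda>i. f (r + s + i)) [0..<r]"
            "drop r (drop (r + s) (map f [0..<r + s + (r + s)])) = map (\<lambda>i. f (r + s + r + i)) [0..<s]"
            "drop r (map f [0..<r + s]) = map (\<lambda>i. f (r + i)) [0..<s]" for f :: "nat \<Rightarrow> 'a"
          by (rule nth_equalityI; simp add: add_ac)+
        ultimately show "fdef \<O> (\<lambda>E. map (E 0) [0..<r + s + (r + s)] \<in> Z X)"
          by (simp add: Z_def take_map)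
      qed (simp add: Z_def)
      then show "definable \<O> {} (r + s + length (a @ b)) D" using X(2) len by simp
    next
      fix \<F> assume \<F>: "finite \<F>" "\<F> \<subseteq> Z ` tp"
      then obtain \<X> where \<X>: "\<X> \<subseteq> tp" "finite \<X>" "\<F> = Z ` \<X>"
        using finite_subset_image[OF \<F>] by auto
      \<comment> \<open>The type is closed under finite intersections, so the failure of isolation
        at the single set \<open>W\<close> realises all of \<open>\<F>\<close> at once.\<close>
      define W where "W = {xs. length xs = r + s \<and> (\<forall>X\<in>\<X>. xs \<in> X)}"
      have W: "W \<in> tp"
      proof -
        have "fdef \<O> (\<lambda>E. \<forall>X\<in>\<X>. map (E 0) [0..<r + s] \<in> X)"
          using \<X>(1) by (intro fdef_Ball[OF \<X>(2)] fdef_definable) (auto simp: tp_def)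
        then have "definable \<O> {} (r + s) {xs. length xs = r + s \<and> (\<forall>X\<in>\<X>. xs \<in> X)}"
          by (intro definable_listI) auto
        then show ?thesis using \<X>(1) len by (auto simp: tp_def W_def)
      qed
      have "\<not> (\<forall>a' b'. a' @ b' \<in> W \<longrightarrow> a' \<in> codes S x \<longrightarrow> length b' = s \<longrightarrow> b' \<in> codes T y)"
        by (rule notI, rule notE[OF neg], rule bexI[OF _ W])
      then obtain a' b' where ab: "length (a' @ b') = r + s" "\<forall>X\<in>\<X>. a' @ b' \<in> X"
        "a' \<in> codes S x" "b' \<notin> codes T y" "length b' = s"
        unfolding W_def by auto
      have "length a' = r" using proper_interpD(2)[OF S x ab(3)] by (simp add: r_def)
      then show "\<exists>xs. length xs = r + s \<and> (\<forall>D\<in>\<F>. xs @ a @ b \<in> D)"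
        using ab len proper_interpD(4)[OF S x a] proper_interpD(4)[OF T y b] unfolding \<X>(3) Z_def
        by (intro exI[of _ "a' @ b'"]) simp
    qed
    then obtain p where p: "length p = r + s" "\<And>X. X \<in> tp \<Longrightarrow> p @ (a @ b) \<in> Z X" by blast
    define z where "z = a @ b"
    have lz: "length z = r + s" using len by (simp add: z_def)
    have tp: "p \<in> X" if "X \<in> tp" for X using p(2)[OF that] p(1) by (auto simp: Z_def)
    have univ: "{xs. length xs = r + s} \<in> tp"
      using len by (auto simp: tp_def intro!: definable_listI fdef_const)
    define ix where "ix v = (SOME i. i < r + s \<and> z ! i = v)" for v
    have ix: "ix v < r + s" "z ! ix v = v" if "v \<in> set z" for v
      using someI_ex[of "\<lambda>i. i < r + s \<and> z ! i = v"] that lz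
      unfolding ix_def by (auto simp: in_set_conv_nth)
    \<comment> \<open>The entries of \<open>z\<close> may repeat. That \<open>f\<close> sends
      \<open>z ! i\<close> to \<open>p ! i\<close> for every \<open>i\<close> requires equal entries
      of \<open>z\<close> to be equal in \<open>p\<close>, which the type of \<open>z\<close>
      expresses by a formula.\<close>
    define f where "f v = p ! ix v" for v
    have f: "f (z ! i) = p ! i" if "i < r + s" for i
    proof -
      let ?i = "ix (z ! i)"
      have i: "?i < r + s" "z ! ?i = z ! i" using ix[of "z ! i"] that lz by auto
      have "definable \<O> {} (r + s) {xs. length xs = r + s \<and> xs ! ?i = xs ! i}"
        by (rule definable_fdefI) (use i that in \<open>auto intro!: fdef_intros\<close>)
      then have "{xs. length xs = r + s \<and> xs ! ?i = xs ! i} \<in> tp"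
        using i lz by (simp add: tp_def z_def)
      from tp[OF this] show ?thesis by (simp add: f_def)
    qed
    have "elementary_map \<O> (set z) f"
      unfolding elementary_map_def
    proof (intro allI impI)
      fix \<phi> :: fm and e assume e: "\<forall>i\<in>fvars \<phi>. e i \<in> set z"
      have val: "sat \<O> ((!) z) (ren (ix \<circ> e) \<phi>) \<longleftrightarrow> sat \<O> e \<phi>"
        unfolding sat_ren by (rule sat_cong) (use e ix in auto)
      have val': "sat \<O> ((!) p) (ren (ix \<circ> e) \<phi>) \<longleftrightarrow> sat \<O> (f \<circ> e) \<phi>"
        unfolding sat_ren by (rule sat_cong) (simp add: f_def)
      \<comment> \<open>With \<open>B\<close> the truth value at \<open>z\<close>, this is the
        formula or its negation, whichever belongs to the type; so both directions of elementarity
        are covered.\<close>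
      have def: "definable \<O> {} (r + s) {xs. length xs = r + s \<and> (sat \<O> ((!) xs) (ren (ix \<circ> e) \<phi>) \<longleftrightarrow> B)}" for B
      proof (rule definable_fdefI)
        have "fdef \<O> (\<lambda>E. sat \<O> (flat E) (ren (ix \<circ> e) \<phi>))" unfolding fdef_def by blast
        from fdef_subst[OF this, of "\<lambda>_ _. 0" "\<lambda>b i. prod_encode (b, i)"]
        show "fdef \<O> (\<lambda>E. sat \<O> (E 0) (ren (ix \<circ> e) \<phi>) \<longleftrightarrow> B)"
          by (intro fdef_iff fdef_const) (simp add: flat_inverse)
        show "(sat \<O> g (ren (ix \<circ> e) \<phi>) \<longleftrightarrow> B) \<longleftrightarrow> (sat \<O> g' (ren (ix \<circ> e) \<phi>) \<longleftrightarrow> B)"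
          if "\<And>i. i < r + s \<Longrightarrow> g i = g' i" for g g'
          unfolding sat_ren
          by (intro arg_cong2[of _ _ _ _ "(=)"] refl sat_cong) (use that e ix in auto)
      qed
      have "{xs. length xs = r + s \<and> (sat \<O> ((!) xs) (ren (ix \<circ> e) \<phi>) \<longleftrightarrow> sat \<O> e \<phi>)} \<in> tp"
        using def lz val by (simp add: tp_def z_def)
      from tp[OF this] show "sat \<O> (f \<circ> e) \<phi> \<longleftrightarrow> sat \<O> e \<phi>" using val' by simp
    qed
    moreover have "|set z| <o \<kappa>"
      using mon by (intro finite_card_less) (auto simp: monster_model_def)
    ultimately obtain \<sigma> where \<sigma>: "valued_automorphism \<O> \<sigma>" "\<forall>v\<in>set z. \<sigma> v = f v"
      using mon unfolding monster_model_def strongly_homogeneous_def by blast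
    have "map \<sigma> z = p"
      by (rule nth_equalityI) (use p(1) lz \<sigma>(2) f in auto)
    then have p_eq: "p = map \<sigma> a @ map \<sigma> b" by (simp add: z_def)
    have "p @ (a @ b) \<in> Z {xs. length xs = r + s}" by (rule p(2)[OF univ])
    then have "same_code S a (map \<sigma> a)" "\<not> same_code T b (map \<sigma> b)"
      unfolding Z_def p_eq using len by simp_all
    then show False
      using aut[OF \<sigma>(1)] proper_interpD(4)[OF S x a] proper_interpD(4)[OF T y b] by blast
  qed
  then obtain X where X: "definable \<O> {} (r + s) X" "a @ b \<in> X"
    "\<And>a' b'. a' @ b' \<in> X \<Longrightarrow> a' \<in> codes S x \<Longrightarrow> length b' = s \<Longrightarrow> b' \<in> codes T y"
    unfolding tp_def by blast
  \<comment> \<open>\<open>X\<close> relates codes, not points; \<open>R\<close> closes it under the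
    choice of codes on both sides.\<close>
  define R where "R = {(x', y'). x' \<in> points S \<and> y' \<in> points T \<and>
    (\<exists>a'\<in>codes S x'. \<exists>b'\<in>codes T y'. a' @ b' \<in> X)}"
  have "definable_rel \<O> S T R"
    unfolding definable_rel_def
  proof
    show "R \<subseteq> points S \<times> points T" by (auto simp: R_def)
    let ?C = "{a @ b |a b x y. (x, y) \<in> R \<and> a \<in> codes S x \<and> b \<in> codes T y}"
    have "definable \<O> {} (r + s) ?C"
    proof (rule definable_listI)
      have "fdef \<O> (\<lambda>E. \<exists>g. same_code S (map (E 0) [0..<r]) (map (\<lambda>i. g i) [0..<r]) \<and>
          same_code T (map (\<lambda>i. E 0 (r + i)) [0..<s]) (map (\<lambda>i. g (r + i)) [0..<s]) \<and>
          map g [0..<r + s] \<in> X)"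
        by (rule fdef_ex_block, unfold r_def s_def,
          intro fdef_conj fdef_same_code S T fdef_mem X(1)[unfolded r_def s_def])
      moreover have "map f [0..<r + s] \<in> ?C \<longleftrightarrow> (\<exists>g. same_code S (map f [0..<r]) (map (\<lambda>i. g i) [0..<r]) \<and>
          same_code T (map (\<lambda>i. f (r + i)) [0..<s]) (map (\<lambda>i. g (r + i)) [0..<s]) \<and>
          map g [0..<r + s] \<in> X)" (is "?l \<longleftrightarrow> ?r") for f :: "nat \<Rightarrow> 'a"
      proof -
        have split: "map g [0..<r + s] = map g [0..<r] @ map (\<lambda>i. g (r + i)) [0..<s]" for g :: "nat \<Rightarrow> 'a"
          by (rule nth_equalityI) (auto simp: nth_append not_less less_diff_conv2)
        show ?thesis
        proof
          assume ?l
          then obtain a1 b1 x1 y1 where 1: "map f [0..<r + s] = a1 @ b1" "(x1, y1) \<in> R"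
            "a1 \<in> codes S x1" "b1 \<in> codes T y1" by blast
          then obtain a2 b2 where 2: "x1 \<in> points S" "y1 \<in> points T" "a2 \<in> codes S x1"
            "b2 \<in> codes T y1" "a2 @ b2 \<in> X" by (auto simp: R_def)
          have l: "length a1 = r" "length b1 = s" "length a2 = r" "length b2 = s"
            using 1 2 proper_interpD(2)[OF S] proper_interpD(2)[OF T] by (auto simp: r_def s_def)
          have f: "map f [0..<r] = a1" "map (\<lambda>i. f (r + i)) [0..<s] = b1"
            using 1(1) l unfolding split by simp_all
          have g: "map ((!) (a2 @ b2)) [0..<r] = a2" "map (\<lambda>i. (a2 @ b2) ! (r + i)) [0..<s] = b2"
            "map ((!) (a2 @ b2)) [0..<r + s] = a2 @ b2"
            by (rule nth_equalityI; use l in \<open>simp add: nth_append\<close>)+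
          show ?r
            by (rule exI[of _ "(!) (a2 @ b2)"], unfold f g) (use 1 2 in \<open>auto simp: same_code_def\<close>)
        next
          assume ?r
          then show ?l unfolding split same_code_def R_def by blast
        qed
      qed
      ultimately show "fdef \<O> (\<lambda>E. map (E 0) [0..<r + s] \<in> ?C)" by simp
    next
      fix xs assume "xs \<in> ?C"
      then show "length xs = r + s"
        using proper_interpD(2)[OF S] proper_interpD(2)[OF T] by (auto simp: R_def r_def s_def)
    qed
    then show "definable \<O> {} (arity S + arity T) ?C" by (simp add: r_def s_def)
  qed
  moreover have "{y'. (x, y') \<in> R} = {y}"
  proof -
    have "y' = y" if yR: "(x, y') \<in> R" for y'
    proof -
      obtain a' b' where *: "y' \<in> points T" "a' \<in> codes S x" "b' \<in> codes T y'" "a' @ b' \<in> X"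
        using yR unfolding R_def by blast
      then have "b' \<in> codes T y"
        using X(3)[OF *(4,2)] proper_interpD(2)[OF T *(1,3)] by (simp add: s_def)
      then show ?thesis using proper_interpD(3)[OF T *(1) y *(3)] by simp
    qed
    moreover have "(x, y) \<in> R" using x y a b X(2) by (auto simp: R_def)
    ultimately show ?thesis by blast
  qed
  ultimately show ?thesis unfolding in_dcl_def by blast
qed

section \<open>Products and symmetric powers\<close>

definition equivariant ::
    "'a::field set \<Rightarrow> ('a, 'b) interp \<Rightarrow> (('a \<Rightarrow> 'a) \<Rightarrow> 'b \<Rightarrow> 'b) \<Rightarrow> bool" where
  "equivariant \<O> S act \<longleftrightarrow> (\<forall>\<sigma>. valued_automorphism \<O> \<sigma> \<longrightarrow> (\<forall>x\<in>points S.
    act \<sigma> x \<in> points S \<and> (\<forall>c\<in>codes S x. map \<sigma> c \<in> codes S (act \<sigma> x))))"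

text \<open>For proper interpretations an automorphism fixes a point exactly when it carries one
  given code of it to a code of the same point, which is the form that
  \<open>in_dcl_automorphismI\<close> asks for.\<close>

lemma interdefinableI:
  fixes \<O> :: "'a::alg_closed_field set"
  assumes mon: "monster_model \<kappa> \<O>"
    and S: "proper_interp \<O> S" "equivariant \<O> S actS" and T: "proper_interp \<O> T" "equivariant \<O> T actT"
    and x: "x \<in> points S" and y: "y \<in> points T"
    and fixed: "\<And>\<sigma>. valued_automorphism \<O> \<sigma> \<Longrightarrow> actS \<sigma> x = x \<longleftrightarrow> actT \<sigma> y = y"
  shows "interdefinable \<O> S x T y"
proof -
  obtain a b where ab: "a \<in> codes S x" "b \<in> codes T y"
    using proper_interpD(1)[OF S(1) x] proper_interpD(1)[OF T(1) y] by blast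
  have a: "map \<sigma> a \<in> codes S x \<longleftrightarrow> actS \<sigma> x = x" if "valued_automorphism \<O> \<sigma>" for \<sigma>
    using S(2) x ab(1) that proper_interpD(3)[OF S(1) x] unfolding equivariant_def by metis
  have b: "map \<sigma> b \<in> codes T y \<longleftrightarrow> actT \<sigma> y = y" if "valued_automorphism \<O> \<sigma>" for \<sigma>
    using T(2) y ab(2) that proper_interpD(3)[OF T(1) y] unfolding equivariant_def by metis
  show ?thesis unfolding interdefinable_def
    by (intro conjI in_dcl_automorphismI[OF mon S(1) T(1) x y ab] in_dcl_automorphismI[OF mon T(1) S(1) y x ab(2,1)])
      (simp_all add: a b fixed)
qed

section \<open>Finite products of interpretable sets\<close>

lemma prod_interp_Nil: "points (prod_interp []) = {[]}" "codes (prod_interp []) [] = {[]}"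
  "arity (prod_interp []) = 0"
  by (auto simp: prod_interp_def)

lemma prod_interp_Cons:
  "arity (prod_interp (S # Ss)) = arity S + arity (prod_interp Ss)"
  "points (prod_interp (S # Ss)) = {x # xs |x xs. x \<in> points S \<and> xs \<in> points (prod_interp Ss)}"
  "codes (prod_interp (S # Ss)) (x # xs) =
    {c @ d |c d. c \<in> codes S x \<and> d \<in> codes (prod_interp Ss) xs}"
proof -
  have "\<exists>es. c @ concat cs = concat es \<and> list_all2 (\<in>) es (codes S x # map2 codes Ss xs)"
    if "c \<in> codes S x" "list_all2 (\<in>) cs (map2 codes Ss xs)" for c cs
    using that by (intro exI[of _ "c # cs"]) simp
  moreover have "\<exists>c cs. concat es = c @ concat cs \<and> c \<in> codes S x \<and> list_all2 (\<in>) cs (map2 codes Ss xs)"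
    if "list_all2 (\<in>) es (codes S x # map2 codes Ss xs)" for es
    using that unfolding list_all2_Cons2 by (metis concat.simps(2))
  ultimately show "codes (prod_interp (S # Ss)) (x # xs) =
      {c @ d |c d. c \<in> codes S x \<and> d \<in> codes (prod_interp Ss) xs}"
    unfolding prod_interp_def by simp blast
qed (auto simp: prod_interp_def list_all2_Cons2)

lemma map_upt_append:
  "map f [0..<r + s] = map f [0..<r] @ map (\<lambda>i. f (r + i)) [0..<s]"
  by (rule nth_equalityI) (auto simp: nth_append not_less less_diff_conv2)

lemma proper_prod_interp:
  assumes "\<And>S. S \<in> set Ss \<Longrightarrow> proper_interp \<O> S"
  shows "proper_interp \<O> (prod_interp Ss)"
  using assms
proof (induction Ss)
  case Nil
  then show ?case
    by (auto simp: proper_interp_def prod_interp_Nil same_code_def intro: fdef_const)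
next
  case (Cons S Ss)
  let ?P = "prod_interp Ss"
  have S: "proper_interp \<O> S" and P: "proper_interp \<O> ?P" using Cons by auto
  have same: "same_code (prod_interp (S # Ss)) (map f [0..<arity S + arity ?P]) (map g [0..<arity S + arity ?P]) \<longleftrightarrow>
      same_code S (map f [0..<arity S]) (map g [0..<arity S]) \<and>
      same_code ?P (map (\<lambda>i. f (arity S + i)) [0..<arity ?P]) (map (\<lambda>i. g (arity S + i)) [0..<arity ?P])"
    (is "?l \<longleftrightarrow> ?r") for f g :: "nat \<Rightarrow> 'a"
  proof
    assume ?l
    then obtain x xs c d c' d' where *: "x \<in> points S" "xs \<in> points ?P"
      "c \<in> codes S x" "d \<in> codes ?P xs" "c' \<in> codes S x" "d' \<in> codes ?P xs"
      and eq: "map f [0..<arity S + arity ?P] = c @ d" "map g [0..<arity S + arity ?P] = c' @ d'"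
      unfolding same_code_def prod_interp_Cons(2) by (auto simp: prod_interp_Cons(3))
    have "length c = arity S" "length c' = arity S"
      using proper_interpD(2)[OF S] * by auto
    then show ?r
      using * eq unfolding map_upt_append same_code_def by auto
  next
    assume ?r
    then show ?l
      unfolding map_upt_append same_code_def prod_interp_Cons(2)
      by (fastforce simp: prod_interp_Cons(3))
  qed
  have "fdef \<O> (\<lambda>E. same_code (prod_interp (S # Ss)) (map (E 0) [0..<arity (prod_interp (S # Ss))])
      (map (E 1) [0..<arity (prod_interp (S # Ss))]))"
    unfolding prod_interp_Cons(1) same by (intro fdef_conj fdef_same_code S P)
  moreover have "codes (prod_interp (S # Ss)) x \<noteq> {} \<and>
      (\<forall>c\<in>codes (prod_interp (S # Ss)) x. length c = arity (prod_interp (S # Ss)))"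
    if "x \<in> points (prod_interp (S # Ss))" for x
    using that proper_interpD(1,2)[OF S] proper_interpD(1,2)[OF P]
    unfolding prod_interp_Cons(2) by (fastforce simp: prod_interp_Cons(1,3))
  moreover have "x = y" if xy': "x \<in> points (prod_interp (S # Ss))" "y \<in> points (prod_interp (S # Ss))"
    "codes (prod_interp (S # Ss)) x \<inter> codes (prod_interp (S # Ss)) y \<noteq> {}" for x y
  proof -
    obtain x1 xs y1 ys where xy: "x = x1 # xs" "y = y1 # ys" "x1 \<in> points S" "y1 \<in> points S"
      "xs \<in> points ?P" "ys \<in> points ?P" using xy'(1,2) unfolding prod_interp_Cons(2) by blast
    obtain c d c' d' where cd: "c @ d = c' @ d'" "c \<in> codes S x1" "c' \<in> codes S y1"
      "d \<in> codes ?P xs" "d' \<in> codes ?P ys"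
      using xy'(3) unfolding xy prod_interp_Cons(3) by blast
    have "length c = length c'" using cd proper_interpD(2)[OF S] xy by metis
    then have "c = c'" "d = d'" using cd(1) by auto
    then show ?thesis using proper_interpD(3)[OF S xy(3,4)] proper_interpD(3)[OF P xy(5,6)] cd xy(1,2) by blast
  qed
  ultimately show ?case unfolding proper_interp_def by blast
qed

lemma equivariant_prod_interp:
  assumes "\<And>S. S \<in> set Ss \<Longrightarrow> equivariant \<O> S act"
  shows "equivariant \<O> (prod_interp Ss) (\<lambda>\<sigma>. map (act \<sigma>))"
  using assms
proof (induction Ss)
  case Nil
  then show ?case by (simp add: equivariant_def prod_interp_Nil)
next
  case (Cons S Ss)
  then have S: "equivariant \<O> S act" and P: "equivariant \<O> (prod_interp Ss) (\<lambda>\<sigma>. map (act \<sigma>))" by auto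
  show ?case
    unfolding equivariant_def prod_interp_Cons(2)
  proof (intro allI impI ballI)
    fix \<sigma> z assume \<sigma>: "valued_automorphism \<O> \<sigma>"
      and "z \<in> {x # xs |x xs. x \<in> points S \<and> xs \<in> points (prod_interp Ss)}"
    then obtain x xs where z: "z = x # xs" "x \<in> points S" "xs \<in> points (prod_interp Ss)" by blast
    have 1: "act \<sigma> x \<in> points S" "\<And>c. c \<in> codes S x \<Longrightarrow> map \<sigma> c \<in> codes S (act \<sigma> x)"
      using S \<sigma> z unfolding equivariant_def by blast+
    have 2: "map (act \<sigma>) xs \<in> points (prod_interp Ss)"
      "\<And>c. c \<in> codes (prod_interp Ss) xs \<Longrightarrow> map \<sigma> c \<in> codes (prod_interp Ss) (map (act \<sigma>) xs)"
      using P \<sigma> z unfolding equivariant_def by blast+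
    show "map (act \<sigma>) z \<in> {x # xs |x xs. x \<in> points S \<and> xs \<in> points (prod_interp Ss)} \<and>
      (\<forall>c\<in>codes (prod_interp (S # Ss)) z. map \<sigma> c \<in> codes (prod_interp (S # Ss)) (map (act \<sigma>) z))"
      using 1 2 unfolding z(1) list.map prod_interp_Cons(3) by (fastforce simp: map_append)
  qed
qed

section \<open>Symmetric powers, with orbits of tuples seen as multisets\<close>

lemma perm_orbit_eq: "perm_orbit xs = {ys. mset ys = mset xs}"
proof (intro equalityI subsetI)
  fix ys assume "ys \<in> perm_orbit xs"
  then show "ys \<in> {ys. mset ys = mset xs}" by (auto simp: perm_orbit_def)
next
  fix ys assume "ys \<in> {ys. mset ys = mset xs}"
  then obtain \<pi> where "\<pi> permutes {..<length xs}" "permute_list \<pi> xs = ys"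
    using mset_eq_permutation[of ys xs] by auto
  then show "ys \<in> perm_orbit xs" by (auto simp: perm_orbit_def)
qed

lemma points_prod_replicate:
  "points (prod_interp (replicate n S)) = {xs. length xs = n \<and> set xs \<subseteq> points S}"
  by (auto simp: prod_interp_def list_all2_conv_all_nth set_conv_nth)

lemma Sym_member:
  assumes "q \<in> Sym n X" "xs \<in> q"
  shows "length xs = n" "set xs \<subseteq> X" "q = perm_orbit xs"
  using assms by (auto simp: Sym_def perm_orbit_eq dest: mset_eq_setD mset_eq_length)

lemma codes_prod_replicate:
  assumes S: "proper_interp \<O> S" and "set xs \<subseteq> points S"
  shows "map f [0..<length xs * arity S] \<in> codes (prod_interp (replicate (length xs) S)) xs \<longleftrightarrow>
    (\<forall>i<length xs. map (\<lambda>j. f (i * arity S + j)) [0..<arity S] \<in> codes S (xs ! i))"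
  using assms(2)
proof (induction xs arbitrary: f)
  case Nil
  then show ?case by (simp add: prod_interp_Nil)
next
  case (Cons x xs)
  let ?r = "arity S"
  have x: "x \<in> points S" using Cons.prems by simp
  have eq: "map f [0..<length (x # xs) * ?r] = map f [0..<?r] @ map (\<lambda>i. f (?r + i)) [0..<length xs * ?r]"
    by (simp add: map_upt_append)
  have "map f [0..<length (x # xs) * ?r] \<in> codes (prod_interp (replicate (length (x # xs)) S)) (x # xs) \<longleftrightarrow>
    map f [0..<?r] \<in> codes S x \<and>
    map (\<lambda>i. f (?r + i)) [0..<length xs * ?r] \<in> codes (prod_interp (replicate (length xs) S)) xs"
  proof -
    have "map f [0..<?r] @ map (\<lambda>i. f (?r + i)) [0..<length xs * ?r] = c @ d \<longleftrightarrow>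
      map f [0..<?r] = c \<and> map (\<lambda>i. f (?r + i)) [0..<length xs * ?r] = d" if "c \<in> codes S x" for c d
      using proper_interpD(2)[OF S x that] by (simp add: append_eq_append_conv)
    then show ?thesis
      unfolding eq unfolding length_Cons replicate_Suc prod_interp_Cons(3) mem_Collect_eq by blast
  qed
  also have "\<dots> \<longleftrightarrow> map f [0..<?r] \<in> codes S x \<and>
    (\<forall>i<length xs. map (\<lambda>j. f (?r + (i * ?r + j))) [0..<?r] \<in> codes S (xs ! i))"
    using Cons by simp
  also have "\<dots> \<longleftrightarrow> (\<forall>i<length (x # xs). map (\<lambda>j. f (i * ?r + j)) [0..<?r] \<in> codes S ((x # xs) ! i))"
    by (simp add: All_less_Suc2 add.assoc)
  finally show ?case .
qed

lemma length_codes_prod: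
  assumes S: "proper_interp \<O> S" and "length xs = n" "set xs \<subseteq> points S"
    "c \<in> codes (prod_interp (replicate n S)) xs"
  shows "length c = n * arity S"
proof -
  have "proper_interp \<O> (prod_interp (replicate n S))" using S by (intro proper_prod_interp) auto
  from proper_interpD(2)[OF this _ assms(4)] assms(2,3) show ?thesis
    by (simp add: points_prod_replicate) (simp add: prod_interp_def sum_list_replicate)
qed

text \<open>The existential over permutations is a finite disjunction, which makes equality in the
  symmetric power first order.\<close>

lemma same_code_Sym:
  assumes S: "proper_interp \<O> S"
  shows "same_code (Sym_interp n S) (map f [0..<n * arity S]) (map g [0..<n * arity S]) \<longleftrightarrow>
    (\<exists>\<pi>\<in>{\<pi>. \<pi> permutes {..<n}}. \<forall>i<n. same_code S (map (\<lambda>j. f (\<pi> i * arity S + j)) [0..<arity S])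
      (map (\<lambda>j. g (i * arity S + j)) [0..<arity S]))" (is "?l \<longleftrightarrow> ?r")
proof
  assume ?l
  then obtain q xs ys where q: "q \<in> Sym n (points S)" "xs \<in> q" "ys \<in> q"
    and c: "map f [0..<n * arity S] \<in> codes (prod_interp (replicate n S)) xs"
    "map g [0..<n * arity S] \<in> codes (prod_interp (replicate n S)) ys"
    unfolding same_code_def Sym_interp_def by auto
  have xs: "length xs = n" "set xs \<subseteq> points S" and ys: "length ys = n" "set ys \<subseteq> points S"
    using Sym_member[OF q(1)] q(2,3) by auto
  have "ys \<in> perm_orbit xs" using q(3) Sym_member(3)[OF q(1,2)] by simp
  then obtain \<pi> where \<pi>: "\<pi> permutes {..<n}" "ys = permute_list \<pi> xs"
    using xs(1) by (auto simp: perm_orbit_def)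
  have "same_code S (map (\<lambda>j. f (\<pi> i * arity S + j)) [0..<arity S])
      (map (\<lambda>j. g (i * arity S + j)) [0..<arity S])" if i: "i < n" for i
  proof -
    have \<pi>i: "\<pi> i < n" using permutes_in_image[OF \<pi>(1), of i] i by simp
    have "map (\<lambda>j. f (\<pi> i * arity S + j)) [0..<arity S] \<in> codes S (xs ! \<pi> i)"
      using c(1) codes_prod_replicate[OF S xs(2), of f] xs(1) \<pi>i by simp
    moreover have "map (\<lambda>j. g (i * arity S + j)) [0..<arity S] \<in> codes S (ys ! i)"
      using c(2) codes_prod_replicate[OF S ys(2), of g] ys(1) i by simp
    moreover have "ys ! i = xs ! \<pi> i" using \<pi> xs(1) i by (simp add: permute_list_nth)
    moreover have "xs ! \<pi> i \<in> points S" using xs \<pi>i by auto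
    ultimately show ?thesis unfolding same_code_def by auto
  qed
  then show ?r using \<pi>(1) by blast
next
  assume ?r
  then obtain \<pi> where \<pi>: "\<pi> permutes {..<n}"
    and *: "\<forall>i<n. \<exists>x. x \<in> points S \<and> map (\<lambda>j. f (\<pi> i * arity S + j)) [0..<arity S] \<in> codes S x \<and>
      map (\<lambda>j. g (i * arity S + j)) [0..<arity S] \<in> codes S x"
    unfolding same_code_def by blast
  obtain h where h: "\<And>i. i < n \<Longrightarrow> h i \<in> points S"
    "\<And>i. i < n \<Longrightarrow> map (\<lambda>j. f (\<pi> i * arity S + j)) [0..<arity S] \<in> codes S (h i)"
    "\<And>i. i < n \<Longrightarrow> map (\<lambda>j. g (i * arity S + j)) [0..<arity S] \<in> codes S (h i)"
    using * by metis
  define ys where "ys = map h [0..<n]"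
  \<comment> \<open>In \<open>f\<close> it is position \<open>\<pi> i\<close> that carries
    \<open>h i\<close>, so the list coded by \<open>f\<close> is \<open>ys\<close> rearranged by the
    inverse of \<open>\<pi>\<close>.\<close>
  define xs where "xs = permute_list (inv_into UNIV \<pi>) ys"
  have ys: "length ys = n" "set ys \<subseteq> points S" using h(1) by (auto simp: ys_def)
  have inv: "inv_into UNIV \<pi> permutes {..<n}" using \<pi> by (rule permutes_inv)
  have "mset xs = mset ys" using inv ys(1) by (simp add: xs_def)
  then have xs: "length xs = n" "set xs \<subseteq> points S" "xs \<in> perm_orbit ys"
    using ys by (auto simp: perm_orbit_eq dest: mset_eq_setD mset_eq_length)
  have "map f [0..<n * arity S] \<in> codes (prod_interp (replicate n S)) xs"
  proof -
    have "map (\<lambda>j. f (i * arity S + j)) [0..<arity S] \<in> codes S (xs ! i)" if i: "i < n" for i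
    proof -
      have "inv_into UNIV \<pi> i < n" using permutes_in_image[OF inv, of i] i by simp
      then have "xs ! i = h (inv_into UNIV \<pi> i)" "\<pi> (inv_into UNIV \<pi> i) = i"
        using i inv ys(1) permutes_inverses(1)[OF \<pi>] by (simp_all add: xs_def permute_list_nth ys_def)
      then show ?thesis using h(2)[of "inv_into UNIV \<pi> i"] \<open>inv_into UNIV \<pi> i < n\<close> by simp
    qed
    then show ?thesis using codes_prod_replicate[OF S xs(2), of f] xs(1) by simp
  qed
  moreover have "map g [0..<n * arity S] \<in> codes (prod_interp (replicate n S)) ys"
    using codes_prod_replicate[OF S ys(2), of g] ys(1) h(3) by (simp add: ys_def)
  moreover have "perm_orbit ys \<in> Sym n (points S)" using ys by (auto simp: Sym_def)
  moreover have "ys \<in> perm_orbit ys" by (simp add: perm_orbit_eq)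
  ultimately show ?l using xs(3) unfolding same_code_def Sym_interp_def by auto
qed

lemma proper_Sym_interp:
  assumes S: "proper_interp \<O> S"
  shows "proper_interp \<O> (Sym_interp n S)"
proof -
  let ?P = "prod_interp (replicate n S)"
  have P: "proper_interp \<O> ?P" using S by (intro proper_prod_interp) auto
  have pts: "xs \<in> points ?P" if "q \<in> Sym n (points S)" "xs \<in> q" for q xs
    using Sym_member[OF that] by (simp add: points_prod_replicate)
  have "fdef \<O> (\<lambda>E. same_code (Sym_interp n S) (map (E 0) [0..<arity (Sym_interp n S)])
      (map (E 1) [0..<arity (Sym_interp n S)]))"
  proof -
    have ar: "arity (Sym_interp n S) = n * arity S" by (simp add: Sym_interp_def)
    show ?thesis
      unfolding ar same_code_Sym[OF S]
      by (intro fdef_Bex fdef_all_less fdef_same_code S finite_permutations) simp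
  qed
  moreover have "codes (Sym_interp n S) q \<noteq> {} \<and> (\<forall>c\<in>codes (Sym_interp n S) q. length c = arity (Sym_interp n S))"
    if q: "q \<in> points (Sym_interp n S)" for q
  proof -
    have q': "q \<in> Sym n (points S)" using q by (simp add: Sym_interp_def)
    then obtain xs where "xs \<in> q" by (auto simp: Sym_def perm_orbit_eq)
    then have "codes ?P xs \<subseteq> codes (Sym_interp n S) q" "codes ?P xs \<noteq> {}"
      using proper_interpD(1)[OF P pts[OF q']] by (auto simp: Sym_interp_def)
    moreover have "length c = n * arity S" if c: "c \<in> codes (Sym_interp n S) q" for c
    proof -
      obtain ys where "ys \<in> q" "c \<in> codes ?P ys" using c by (auto simp: Sym_interp_def)
      then show ?thesis using length_codes_prod[OF S] Sym_member(1,2)[OF q'] by blast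
    qed
    ultimately show ?thesis by (auto simp: Sym_interp_def)
  qed
  moreover have "q = q'" if q: "q \<in> points (Sym_interp n S)" "q' \<in> points (Sym_interp n S)"
    "codes (Sym_interp n S) q \<inter> codes (Sym_interp n S) q' \<noteq> {}" for q q'
  proof -
    obtain c xs ys where c: "xs \<in> q" "ys \<in> q'" "c \<in> codes ?P xs" "c \<in> codes ?P ys"
      using q(3) by (auto simp: Sym_interp_def)
    have q12: "q \<in> Sym n (points S)" "q' \<in> Sym n (points S)" using q(1,2) by (auto simp: Sym_interp_def)
    have "xs = ys"
      using proper_interpD(3)[OF P pts[OF q12(1) c(1)] pts[OF q12(2) c(2)] c(3,4)] .
    then show ?thesis using Sym_member(3)[OF q12(1) c(1)] Sym_member(3)[OF q12(2) c(2)] by simp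
  qed
  ultimately show ?thesis unfolding proper_interp_def by blast
qed

lemma image_map_perm_orbit: "(map f ` perm_orbit xs :: 'b list set) = perm_orbit (map f xs)"
proof -
  have "permute_list \<pi> (map f xs) = map f (permute_list \<pi> xs)" if "\<pi> permutes {..<length xs}" for \<pi>
    using permutes_in_image[OF that] by (intro nth_equalityI) (auto simp: permute_list_def)
  then show ?thesis unfolding perm_orbit_def by (auto simp: image_iff) metis
qed

lemma equivariant_Sym_interp:
  assumes "equivariant \<O> S act"
  shows "equivariant \<O> (Sym_interp n S) (\<lambda>\<sigma> q. map (act \<sigma>) ` q)"
  unfolding equivariant_def
proof (intro allI impI ballI conjI)
  fix \<sigma> q assume \<sigma>: "valued_automorphism \<O> \<sigma>" and q: "q \<in> points (Sym_interp n S)"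
  have P: "equivariant \<O> (prod_interp (replicate n S)) (\<lambda>\<sigma>. map (act \<sigma>))"
    using assms by (intro equivariant_prod_interp) auto
  have q': "q \<in> Sym n (points S)" using q by (simp add: Sym_interp_def)
  then obtain xs where xs: "xs \<in> q" by (auto simp: Sym_def perm_orbit_eq)
  have "set (map (act \<sigma>) xs) \<subseteq> points S"
    using assms \<sigma> Sym_member(2)[OF q' xs] unfolding equivariant_def by auto
  then show "map (act \<sigma>) ` q \<in> points (Sym_interp n S)"
    using Sym_member(1,3)[OF q' xs]
    by (auto simp: Sym_interp_def Sym_def image_map_perm_orbit intro!: exI[of _ "map (act \<sigma>) xs"])
  fix c assume "c \<in> codes (Sym_interp n S) q"
  then obtain ys where ys: "ys \<in> q" "c \<in> codes (prod_interp (replicate n S)) ys"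
    by (auto simp: Sym_interp_def)
  then have "map \<sigma> c \<in> codes (prod_interp (replicate n S)) (map (act \<sigma>) ys)"
    using P \<sigma> Sym_member[OF q' ys(1)] unfolding equivariant_def by (auto simp: points_prod_replicate)
  then show "map \<sigma> c \<in> codes (Sym_interp n S) (map (act \<sigma>) ` q)"
    using ys(1) by (auto simp: Sym_interp_def)
qed

section \<open>Lattices over a valuation ring\<close>

lemma mult_mat_vec_nth:
  assumes "A \<in> carrier_mat n m" "v \<in> carrier_vec m" "i < n"
  shows "(A *\<^sub>v v) $ i = (\<Sum>j<m. A $$ (i, j) * v $ j)"
  using assms by (auto simp: scalar_prod_def atLeast0LessThan)

lemma scalar_prod_sum: "w \<in> carrier_vec n \<Longrightarrow> v \<bullet> w = (\<Sum>i<n. v $ i * w $ i)"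
  by (auto simp: scalar_prod_def atLeast0LessThan)

text \<open>Used with \<O> and with its maximal ideal as \<open>X\<close>, so that a lattice and the
  submodule divided out in its reduction are treated together.\<close>

definition box :: "nat \<Rightarrow> 'a set \<Rightarrow> 'a vec set" where
  "box n X = {v \<in> carrier_vec n. \<forall>i<n. v $ i \<in> X}"

lemma std_lattice_box: "std_lattice \<O> n = box n \<O>"
  by (simp add: std_lattice_def box_def)

text \<open>A basis, the columns of \<open>B\<close>, together with its coordinate functionals, the
  rows of \<open>D\<close>. The latter will form a basis of the dual lattice.\<close>

definition frame :: "nat \<Rightarrow> 'a::field mat \<Rightarrow> 'a mat \<Rightarrow> bool" where
  "frame n B D \<longleftrightarrow> B \<in> carrier_mat n n \<and> D \<in> carrier_mat n n \<and> B * D = 1\<^sub>m n \<and> D * B = 1\<^sub>m n"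

lemma frameD:
  assumes "frame n B D"
  shows "B \<in> carrier_mat n n" "D \<in> carrier_mat n n" "B * D = 1\<^sub>m n" "D * B = 1\<^sub>m n"
    "v \<in> carrier_vec n \<Longrightarrow> D *\<^sub>v (B *\<^sub>v v) = v" "v \<in> carrier_vec n \<Longrightarrow> B *\<^sub>v (D *\<^sub>v v) = v"
    "B *\<^sub>v v \<in> carrier_vec n" "D *\<^sub>v v \<in> carrier_vec n"
proof -
  show 1: "B \<in> carrier_mat n n" "D \<in> carrier_mat n n" "B * D = 1\<^sub>m n" "D * B = 1\<^sub>m n"
    using assms by (auto simp: frame_def)
  show "v \<in> carrier_vec n \<Longrightarrow> D *\<^sub>v (B *\<^sub>v v) = v" "v \<in> carrier_vec n \<Longrightarrow> B *\<^sub>v (D *\<^sub>v v) = v"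
    using assoc_mult_mat_vec[OF 1(2,1), of v] assoc_mult_mat_vec[OF 1(1,2), of v] 1(3,4) by simp_all
  have "dim_row B = n" "dim_row D = n" using 1(1,2) by auto
  then show "B *\<^sub>v v \<in> carrier_vec n" "D *\<^sub>v v \<in> carrier_vec n"
    by (intro carrier_vecI, simp)+
qed

lemma frame_sym: "frame n B D \<longleftrightarrow> frame n D B"
  by (auto simp: frame_def)

lemma frame_ex:
  fixes B :: "'a::field mat"
  assumes "B \<in> carrier_mat n n" "\<And>v. v \<in> carrier_vec n \<Longrightarrow> B *\<^sub>v v = 0\<^sub>v n \<Longrightarrow> v = 0\<^sub>v n"
  shows "\<exists>D. frame n B D"
proof -
  have "det B \<noteq> 0" using det_0_iff_vec_prod_zero_field[OF assms(1)] assms(2) by blast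
  from det_non_zero_imp_unit[OF assms(1) this, of "()"] show ?thesis
    using assms(1) by (auto simp: Units_def ring_mat_def frame_def)
qed

lemma frame_mult:
  assumes "frame n B D" "frame n B' D'"
  shows "frame n (B * B') (D' * D)"
proof -
  note 1 = frameD(1-4)[OF assms(1)] and 2 = frameD(1-4)[OF assms(2)]
  have "(B * B') * (D' * D) = B * (B' * (D' * D))"
    using 1 2 by (intro assoc_mult_mat[of _ n n _ n _ n]) auto
  also have "B' * (D' * D) = (B' * D') * D"
    using 1 2 by (intro assoc_mult_mat[of _ n n _ n _ n, symmetric]) auto
  finally have BB: "(B * B') * (D' * D) = 1\<^sub>m n" using 1 2 by simp
  have "(D' * D) * (B * B') = D' * (D * (B * B'))"
    using 1 2 by (intro assoc_mult_mat[of _ n n _ n _ n]) auto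
  also have "D * (B * B') = (D * B) * B'"
    using 1 2 by (intro assoc_mult_mat[of _ n n _ n _ n, symmetric]) auto
  finally have "(D' * D) * (B * B') = 1\<^sub>m n" using 1 2 by simp
  then show ?thesis using BB 1 2 by (auto simp: frame_def)
qed

text \<open>This inserts \<open>B * D = 1\<close> between \<open>g\<close> and \<open>v\<close>.
  Consequently \<open>g \<bullet> v\<close> is integral as soon as \<open>g\<close> is integral on
  the basis and \<open>v\<close> has integral coordinates.\<close>

lemma scalar_prod_frame:
  assumes B: "frame n B D" and v: "v \<in> carrier_vec n" and g: "g \<in> carrier_vec n"
  shows "g \<bullet> v = (\<Sum>i<n. (g \<bullet> col B i) * (D *\<^sub>v v) $ i)"
proof -
  have "g \<bullet> v = g \<bullet> (B *\<^sub>v (D *\<^sub>v v))" using frameD(6)[OF B v] by simp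
  also have "\<dots> = (\<Sum>k<n. g $ k * (\<Sum>i<n. B $$ (k, i) * (D *\<^sub>v v) $ i))"
    using scalar_prod_sum[OF frameD(7)[OF B, of "D *\<^sub>v v"], of g]
      mult_mat_vec_nth[OF frameD(1)[OF B] frameD(8)[OF B, of v]] by simp
  also have "\<dots> = (\<Sum>i<n. (\<Sum>k<n. g $ k * B $$ (k, i)) * (D *\<^sub>v v) $ i)"
    unfolding sum_distrib_left sum_distrib_right by (subst sum.swap) (simp add: mult_ac)
  also have "\<dots> = (\<Sum>i<n. (g \<bullet> col B i) * (D *\<^sub>v v) $ i)"
    using frameD(1)[OF B] by (intro sum.cong) (auto simp: scalar_prod_def atLeast0LessThan)
  finally show ?thesis .
qed

text \<open>Linearity is assumed on the box only, so \<open>v\<close> is reached coordinate by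
  coordinate through truncations \<open>w k\<close>, which stay inside the box. This turns an
  abstract module isomorphism into a matrix.\<close>

lemma linear_combination_eq:
  fixes f :: "'a::field vec \<Rightarrow> 'a vec"
  assumes f: "\<And>v. v \<in> box n X \<Longrightarrow> f v \<in> carrier_vec m"
    and add: "\<And>v w. v \<in> box n X \<Longrightarrow> w \<in> box n X \<Longrightarrow> f (v + w) = f v + f w"
    and smult: "\<And>a v. a \<in> X \<Longrightarrow> v \<in> box n X \<Longrightarrow> f (a \<cdot>\<^sub>v v) = a \<cdot>\<^sub>v f v"
    and X: "0 \<in> X" "1 \<in> X" "\<And>a b. a \<in> X \<Longrightarrow> b \<in> X \<Longrightarrow> a * b \<in> X"
    and v: "v \<in> box n X"
  shows "f v = mat_of_cols m (map (\<lambda>i. f (unit_vec n i)) [0..<n]) *\<^sub>v v"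
proof -
  let ?B = "mat_of_cols m (map (\<lambda>i. f (unit_vec n i)) [0..<n])"
  have unit: "unit_vec n i \<in> box n X" if "i < n" for i
    using X that by (auto simp: box_def unit_vec_def)
  have B: "?B \<in> carrier_mat m n" using mat_of_cols_carrier(1)[of m "map (\<lambda>i. f (unit_vec n i)) [0..<n]"] by simp
  define w where "w k = vec n (\<lambda>i. if i < k then v $ i else 0)" for k
  have w: "w k \<in> box n X" for k using v X by (auto simp: box_def w_def)
  have "f (w k) = ?B *\<^sub>v w k" if "k \<le> n" for k
    using that
  proof (induction k)
    case 0
    have "w 0 = 0 \<cdot>\<^sub>v w 0" by (auto simp: w_def)
    then have "f (w 0) = 0 \<cdot>\<^sub>v f (w 0)" using smult[OF X(1) w[of 0]] by metis
    also have "\<dots> = 0\<^sub>v m" using f[OF w[of 0]] by auto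
    also have "\<dots> = ?B *\<^sub>v w 0"
      using B by (intro eq_vecI) (auto simp: w_def scalar_prod_def)
    finally show ?case .
  next
    case (Suc k)
    then have k: "k < n" by simp
    have vk: "v $ k \<in> X" using v k by (auto simp: box_def)
    have eq: "w (Suc k) = w k + v $ k \<cdot>\<^sub>v unit_vec n k"
      using k by (intro eq_vecI) (auto simp: w_def unit_vec_def less_Suc_eq)
    have u: "v $ k \<cdot>\<^sub>v unit_vec n k \<in> box n X"
      using unit[OF k] vk X(3) by (auto simp: box_def)
    have "f (w (Suc k)) = f (w k) + v $ k \<cdot>\<^sub>v f (unit_vec n k)"
      unfolding eq by (simp add: add[OF w u] smult[OF vk unit[OF k]])
    also have "f (unit_vec n k) = ?B *\<^sub>v unit_vec n k"
    proof (rule eq_vecI)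
      have fk: "f (unit_vec n k) \<in> carrier_vec m" using f[OF unit[OF k]] .
      then show "dim_vec (f (unit_vec n k)) = dim_vec (?B *\<^sub>v unit_vec n k)" using B by simp
      fix i assume "i < dim_vec (?B *\<^sub>v unit_vec n k)"
      then show "f (unit_vec n k) $ i = (?B *\<^sub>v unit_vec n k) $ i"
        using B k by (simp add: mat_of_cols_index)
    qed
    also have "f (w k) + v $ k \<cdot>\<^sub>v (?B *\<^sub>v unit_vec n k) = ?B *\<^sub>v w (Suc k)"
      unfolding eq using Suc B w[of k] u
      by (simp add: mult_add_distrib_mat_vec[OF B] mult_mat_vec[OF B] box_def)
    finally show ?case .
  qed
  from this[of n] have "f (w n) = ?B *\<^sub>v w n" by simp
  moreover have "w n = v" using v by (auto simp: w_def box_def)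
  ultimately show ?thesis by simp
qed

section \<open>Arithmetic of a valuation ring, and lattices given by bases\<close>

locale valued_field =
  fixes \<O> :: "'a::field set"
  assumes valuation_ring: "valuation_ring \<O>"
begin

abbreviation "\<MM> \<equiv> max_ideal \<O>"

lemma O_0 [simp]: "0 \<in> \<O>" and O_1 [simp]: "1 \<in> \<O>"
  and O_add: "x \<in> \<O> \<Longrightarrow> y \<in> \<O> \<Longrightarrow> x + y \<in> \<O>"
  and O_mult: "x \<in> \<O> \<Longrightarrow> y \<in> \<O> \<Longrightarrow> x * y \<in> \<O>"
  and O_uminus: "x \<in> \<O> \<Longrightarrow> - x \<in> \<O>"
  and O_total: "x \<notin> \<O> \<Longrightarrow> inverse x \<in> \<O>"
  using valuation_ring unfolding valuation_ring_def by blast+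

lemma O_diff: "x \<in> \<O> \<Longrightarrow> y \<in> \<O> \<Longrightarrow> x - y \<in> \<O>"
  using O_add[of x "- y"] O_uminus[of y] by simp

lemma O_sum: "(\<And>i. i \<in> I \<Longrightarrow> f i \<in> \<O>) \<Longrightarrow> sum f I \<in> \<O>"
  by (induction I rule: infinite_finite_induct) (auto intro: O_add)

lemma O_prod: "(\<And>i. i \<in> I \<Longrightarrow> f i \<in> \<O>) \<Longrightarrow> prod f I \<in> \<O>"
  by (induction I rule: infinite_finite_induct) (auto intro: O_mult)

lemma mem_M: "x \<in> \<MM> \<longleftrightarrow> x \<in> \<O> \<and> (x = 0 \<or> inverse x \<notin> \<O>)"
proof -
  have "(\<exists>y\<in>\<O>. x * y = 1) \<longleftrightarrow> x \<noteq> 0 \<and> inverse x \<in> \<O>"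
  proof
    assume "\<exists>y\<in>\<O>. x * y = 1"
    then obtain y where y: "y \<in> \<O>" "x * y = 1" by blast
    then have "inverse x = y" by (intro inverse_unique)
    then show "x \<noteq> 0 \<and> inverse x \<in> \<O>" using y by auto
  next
    assume "x \<noteq> 0 \<and> inverse x \<in> \<O>"
    then show "\<exists>y\<in>\<O>. x * y = 1" by (intro bexI[of _ "inverse x"]) auto
  qed
  then show ?thesis by (auto simp: max_ideal_def)
qed

lemma M_O: "x \<in> \<MM> \<Longrightarrow> x \<in> \<O>" by (simp add: mem_M)

lemma M_0 [simp]: "0 \<in> \<MM>" by (simp add: mem_M)

lemma M_1 [simp]: "1 \<notin> \<MM>" by (simp add: mem_M)

lemma M_mult: "x \<in> \<MM> \<Longrightarrow> y \<in> \<O> \<Longrightarrow> x * y \<in> \<MM>"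
proof -
  assume xy: "x \<in> \<MM>" "y \<in> \<O>"
  show "x * y \<in> \<MM>"
  proof (rule ccontr)
    assume "x * y \<notin> \<MM>"
    then have "x * y \<noteq> 0" "inverse (x * y) \<in> \<O>" using xy by (auto simp: mem_M O_mult)
    then have "y * inverse (x * y) \<in> \<O>" using xy(2) O_mult by blast
    moreover have "y * inverse (x * y) = inverse x" using \<open>x * y \<noteq> 0\<close> by (simp add: field_simps)
    ultimately have "inverse x \<in> \<O>" by metis
    then show False using xy(1) \<open>x * y \<noteq> 0\<close> by (simp add: mem_M)
  qed
qed

lemma M_mult': "y \<in> \<O> \<Longrightarrow> x \<in> \<MM> \<Longrightarrow> y * x \<in> \<MM>"
  using M_mult by (simp add: mult.commute)

lemma notin_O: "x \<notin> \<O> \<Longrightarrow> inverse x \<in> \<MM>"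
  using O_total[of x] by (auto simp: mem_M)

lemma M_add: "x \<in> \<MM> \<Longrightarrow> y \<in> \<MM> \<Longrightarrow> x + y \<in> \<MM>"
proof -
  have *: "x + y \<in> \<MM>" if "x \<in> \<MM>" "y \<in> \<MM>" "x \<noteq> 0" "y / x \<in> \<O>" for x y
  proof -
    have "x + y = x * (1 + y / x)" using that(3) by (simp add: field_simps)
    then show ?thesis using that by (metis M_mult O_1 O_add)
  qed
  assume xy: "x \<in> \<MM>" "y \<in> \<MM>"
  show "x + y \<in> \<MM>"
  proof (cases "x = 0 \<or> y = 0")
    case False
    have "y / x \<in> \<O> \<or> x / y \<in> \<O>" using O_total[of "y / x"] by auto
    then show ?thesis using *[of x y] *[of y x] xy False by (auto simp: add.commute)
  qed (use xy in auto)
qed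

lemma M_uminus: "x \<in> \<MM> \<Longrightarrow> - x \<in> \<MM>"
  using M_mult[of x "- 1"] O_uminus[of 1] by simp

lemma unit_inverse: "x \<in> \<O> \<Longrightarrow> x \<notin> \<MM> \<Longrightarrow> inverse x \<in> \<O> \<and> x \<noteq> 0"
  by (auto simp: mem_M)

lemma M_prod: "finite I \<Longrightarrow> (\<And>i. i \<in> I \<Longrightarrow> f i \<in> \<O>) \<Longrightarrow> j \<in> I \<Longrightarrow> f j \<in> \<MM> \<Longrightarrow> prod f I \<in> \<MM>"
  unfolding prod.remove[of I j f] by (intro M_mult O_prod) auto

text \<open>Integrality of quotients is a total preorder, so a finite family has a largest entry.
  Dividing by it makes all entries integral and one equal to 1, which moves vectors into the
  standard lattice and supplies pivots.\<close>

lemma ex_dominant: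
  assumes "finite I" "i \<in> I" "f i \<noteq> 0"
  shows "\<exists>p\<in>I. f p \<noteq> 0 \<and> (\<forall>q\<in>I. f q / f p \<in> \<O>)"
proof -
  have "\<forall>i\<in>I. f i \<noteq> 0 \<longrightarrow> (\<exists>p\<in>I. f p \<noteq> 0 \<and> (\<forall>q\<in>I. f q / f p \<in> \<O>))"
    using assms(1)
  proof (induction I)
    case (insert j I)
    show ?case
    proof (cases "\<forall>i\<in>I. f i = 0")
      case True
      then show ?thesis by auto
    next
      case False
      then obtain p where p: "p \<in> I" "f p \<noteq> 0" "\<forall>q\<in>I. f q / f p \<in> \<O>" using insert.IH by blast
      show ?thesis
      proof (cases "f j / f p \<in> \<O>")
        case True
        then show ?thesis using p by auto
      next
        case False
        then have "f p / f j \<in> \<O>" "f j \<noteq> 0" using O_total[of "f j / f p"] by auto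
        moreover have "f q / f j \<in> \<O>" if "q \<in> I" for q
        proof -
          have "f q / f j = (f q / f p) * (f p / f j)" using p(2) by simp
          then show ?thesis using O_mult p(3) that calculation by metis
        qed
        ultimately have "f j \<noteq> 0" "\<forall>q\<in>insert j I. f q / f j \<in> \<O>" by auto
        then show ?thesis by blast
      qed
    qed
  qed simp
  then show ?thesis using assms by blast
qed

definition span_box :: "'a set \<Rightarrow> 'a mat \<Rightarrow> 'a vec set" where
  "span_box X B = (*\<^sub>v) B ` box (dim_col B) X"

lemma span_box_frame:
  assumes "frame n B D"
  shows "v \<in> span_box X B \<longleftrightarrow> v \<in> carrier_vec n \<and> D *\<^sub>v v \<in> box n X"
proof
  assume "v \<in> span_box X B"
  then obtain x where "x \<in> box n X" "v = B *\<^sub>v x"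
    using frameD(1)[OF assms] by (auto simp: span_box_def)
  then show "v \<in> carrier_vec n \<and> D *\<^sub>v v \<in> box n X"
    using frameD[OF assms] by (auto simp: box_def)
next
  assume v: "v \<in> carrier_vec n \<and> D *\<^sub>v v \<in> box n X"
  then have "v = B *\<^sub>v (D *\<^sub>v v)" using frameD(6)[OF assms] by simp
  then show "v \<in> span_box X B" using v frameD(1)[OF assms] by (auto simp: span_box_def)
qed

lemma submodule_box:
  assumes "X = \<O> \<or> X = \<MM>"
  shows "submodule \<O> n (box n X)"
proof -
  have X: "0 \<in> X" "\<And>x y. x \<in> X \<Longrightarrow> y \<in> X \<Longrightarrow> x + y \<in> X" "\<And>x y. x \<in> \<O> \<Longrightarrow> y \<in> X \<Longrightarrow> x * y \<in> X"
    using assms O_add O_mult M_add M_mult' by auto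
  then show ?thesis by (auto simp: submodule_def box_def)
qed

lemma submodule_span_box:
  assumes B: "frame n B D" and X: "X = \<O> \<or> X = \<MM>"
  shows "submodule \<O> n (span_box X B)"
proof -
  note b = submodule_box[OF X, of n, unfolded submodule_def]
  note D = frameD(2)[OF B]
  show ?thesis unfolding submodule_def span_box_frame[OF B]
  proof (intro conjI ballI)
    have "D *\<^sub>v 0\<^sub>v n = 0\<^sub>v n" using D by (intro eq_vecI) (auto simp: scalar_prod_def)
    then show "D *\<^sub>v 0\<^sub>v n \<in> box n X" using b by simp
  next
    fix v w assume "v \<in> span_box X B" "w \<in> span_box X B"
    then show "D *\<^sub>v (v + w) \<in> box n X"
      unfolding span_box_frame[OF B] using b by (simp add: mult_add_distrib_mat_vec[OF D])
  next
    fix a v assume "a \<in> \<O>" "v \<in> span_box X B"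
    then show "D *\<^sub>v (a \<cdot>\<^sub>v v) \<in> box n X"
      unfolding span_box_frame[OF B] using b by (simp add: mult_mat_vec[OF D])
  qed (auto simp: span_box_frame[OF B])
qed

lemma submodule_sum:
  assumes N: "submodule \<O> n N" and "\<And>i. i < k \<Longrightarrow> c i \<in> N"
  shows "vec n (\<lambda>j. \<Sum>i<(k::nat). c i $ j) \<in> N"
  using assms(2)
proof (induction k)
  case 0
  have "vec n (\<lambda>j. \<Sum>i<0. c i $ j) = 0\<^sub>v n" by auto
  then show ?case using N by (simp add: submodule_def)
next
  case (Suc k)
  have "c k \<in> N" "c k \<in> carrier_vec n" using Suc.prems[of k] N by (auto simp: submodule_def)
  moreover have "vec n (\<lambda>j. \<Sum>i<Suc k. c i $ j) = vec n (\<lambda>j. \<Sum>i<k. c i $ j) + c k"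
    using calculation by auto
  moreover have "vec n (\<lambda>j. \<Sum>i<k. c i $ j) \<in> N" using Suc by simp
  ultimately show ?case using N by (auto simp: submodule_def)
qed

text \<open>The products of scalars from \<MM> with basis vectors lie in every competing submodule,
  and their sums already exhaust the \<MM>-span.\<close>

lemma max_mult_span_box:
  assumes B: "frame n B D"
  shows "max_mult \<O> n (span_box \<O> B) = span_box \<MM> B"
proof (intro equalityI)
  have "a \<cdot>\<^sub>v v \<in> span_box \<MM> B" if "a \<in> \<MM>" "v \<in> span_box \<O> B" for a v
    using that(2) M_mult[OF that(1)] frameD(2)[OF B] unfolding span_box_frame[OF B]
    by (auto simp: mult_mat_vec[OF frameD(2)[OF B]] box_def)
  then show "max_mult \<O> n (span_box \<O> B) \<subseteq> span_box \<MM> B"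
    unfolding max_mult_def using submodule_span_box[OF B] by blast
next
  have "v \<in> N" if v: "v \<in> span_box \<MM> B" and N: "submodule \<O> n N"
    "\<forall>a\<in>\<MM>. \<forall>v\<in>span_box \<O> B. a \<cdot>\<^sub>v v \<in> N" for v N
  proof -
    define x where "x = D *\<^sub>v v"
    have x: "v \<in> carrier_vec n" "x \<in> box n \<MM>" using v by (auto simp: span_box_frame[OF B] x_def)
    have "x $ i \<cdot>\<^sub>v col B i \<in> N" if i: "i < n" for i
    proof -
      have "D *\<^sub>v col B i = unit_vec n i"
        using frameD(4)[OF B] col_mult2[OF frameD(2,1)[OF B] i] i by simp
      moreover have "unit_vec n i \<in> box n \<O>" by (auto simp: box_def unit_vec_def)
      ultimately have "col B i \<in> span_box \<O> B"
        using frameD(1)[OF B] by (auto simp: span_box_frame[OF B])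
      then show ?thesis using N(2) x(2) i by (auto simp: box_def)
    qed
    then have "vec n (\<lambda>j. \<Sum>i<n. (x $ i \<cdot>\<^sub>v col B i) $ j) \<in> N" by (rule submodule_sum[OF N(1)])
    also have "vec n (\<lambda>j. \<Sum>i<n. (x $ i \<cdot>\<^sub>v col B i) $ j) = B *\<^sub>v x"
      using frameD(1)[OF B] x(2)
      by (intro eq_vecI) (auto simp: box_def scalar_prod_sum[of x n] mult.commute intro!: sum.cong)
    also have "\<dots> = v" using frameD(6)[OF B x(1)] by (simp add: x_def)
    finally show ?thesis .
  qed
  then show "span_box \<MM> B \<subseteq> max_mult \<O> n (span_box \<O> B)" unfolding max_mult_def by blast
qed

lemma lattice_basis_frame:
  assumes "frame n B D"
  shows "lattice_basis \<O> n (span_box \<O> B) B"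
proof -
  have "inj_on ((*\<^sub>v) B) (box n \<O>)"
    using frameD(5)[OF assms] by (intro inj_on_inverseI[of _ "(*\<^sub>v) D"]) (auto simp: box_def)
  then show ?thesis
    using frameD(1)[OF assms] by (auto simp: lattice_basis_def bij_betw_def std_lattice_box span_box_def)
qed

text \<open>Injectivity is known on the standard lattice only. A nonzero kernel vector can be
  divided by its dominant entry, which moves it there without making it zero.\<close>

lemma frame_lattice_basis:
  assumes "lattice_basis \<O> n \<Lambda> B"
  shows "\<exists>D. frame n B D" "\<Lambda> = span_box \<O> B"
proof -
  have B: "B \<in> carrier_mat n n" and bij: "bij_betw ((*\<^sub>v) B) (box n \<O>) \<Lambda>"
    using assms by (auto simp: lattice_basis_def std_lattice_box)
  then show "\<Lambda> = span_box \<O> B" by (auto simp: bij_betw_def span_box_def)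
  show "\<exists>D. frame n B D"
  proof (rule frame_ex[OF B], rule ccontr)
    fix v assume v: "v \<in> carrier_vec n" "B *\<^sub>v v = 0\<^sub>v n" "v \<noteq> 0\<^sub>v n"
    then obtain i where "i < n" "v $ i \<noteq> 0" by (metis carrier_vecD eq_vecI index_zero_vec(1) index_zero_vec(2))
    then obtain p where p: "p < n" "v $ p \<noteq> 0" "\<And>q. q < n \<Longrightarrow> v $ q / v $ p \<in> \<O>"
      using ex_dominant[of "{..<n}" i "\<lambda>i. v $ i"] by auto
    define w where "w = inverse (v $ p) \<cdot>\<^sub>v v"
    have w: "w \<in> box n \<O>" using v(1) p(3) by (auto simp: w_def box_def field_simps)
    have "B *\<^sub>v w = 0\<^sub>v n" unfolding w_def mult_mat_vec[OF B v(1)] v(2) by (intro eq_vecI) auto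
    moreover have "B *\<^sub>v 0\<^sub>v n = 0\<^sub>v n" using B by (intro eq_vecI) (auto simp: scalar_prod_def)
    moreover have "0\<^sub>v n \<in> box n \<O>" by (simp add: box_def)
    ultimately have "w = 0\<^sub>v n" using bij w unfolding bij_betw_def inj_on_def by metis
    then have "w $ p = 0" using p(1) by simp
    then show False using p(1,2) v(1) by (simp add: w_def)
  qed
qed

text \<open>By \<open>linear_combination_eq\<close> the abstract isomorphism is multiplication by a
  matrix, which \<open>frame_lattice_basis\<close> shows to be invertible. From here on lattices are
  handled through such frames.\<close>

lemma is_lattice_iff: "is_lattice \<O> n \<Lambda> \<longleftrightarrow> (\<exists>B D. frame n B D \<and> \<Lambda> = span_box \<O> B)"
proof
  assume L: "is_lattice \<O> n \<Lambda>"
  then obtain f where f: "bij_betw f (box n \<O>) \<Lambda>"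
    "\<And>v w. v \<in> box n \<O> \<Longrightarrow> w \<in> box n \<O> \<Longrightarrow> f (v + w) = f v + f w"
    "\<And>a v. a \<in> \<O> \<Longrightarrow> v \<in> box n \<O> \<Longrightarrow> f (a \<cdot>\<^sub>v v) = a \<cdot>\<^sub>v f v"
    unfolding is_lattice_def std_lattice_box by blast
  have "\<Lambda> \<subseteq> carrier_vec n" using L by (auto simp: is_lattice_def submodule_def)
  then have fc: "f v \<in> carrier_vec n" if "v \<in> box n \<O>" for v using f(1) that by (auto simp: bij_betw_def)
  define B where "B = mat_of_cols n (map (\<lambda>i. f (unit_vec n i)) [0..<n])"
  have "f v = B *\<^sub>v v" if "v \<in> box n \<O>" for v
    unfolding B_def by (rule linear_combination_eq[OF fc f(2,3)]) (use that O_mult in auto)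
  then have "bij_betw ((*\<^sub>v) B) (box n \<O>) \<Lambda>" using f(1) by (simp cong: bij_betw_cong)
  moreover have "B \<in> carrier_mat n n"
    unfolding B_def using mat_of_cols_carrier(1)[of n "map (\<lambda>i. f (unit_vec n i)) [0..<n]"] by simp
  ultimately have "lattice_basis \<O> n \<Lambda> B" by (simp add: lattice_basis_def std_lattice_box)
  then show "\<exists>B D. frame n B D \<and> \<Lambda> = span_box \<O> B" using frame_lattice_basis by blast
next
  assume "\<exists>B D. frame n B D \<and> \<Lambda> = span_box \<O> B"
  then obtain B D where B: "frame n B D" and \<Lambda>: "\<Lambda> = span_box \<O> B" by blast
  have "\<exists>f. bij_betw f (box n \<O>) \<Lambda> \<and>
    (\<forall>v\<in>box n \<O>. \<forall>w\<in>box n \<O>. f (v + w) = f v + f w) \<and>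
    (\<forall>a\<in>\<O>. \<forall>v\<in>box n \<O>. f (a \<cdot>\<^sub>v v) = a \<cdot>\<^sub>v f v)"
  proof (intro exI conjI ballI)
    show "bij_betw ((*\<^sub>v) B) (box n \<O>) \<Lambda>"
      using lattice_basis_frame[OF B] by (simp add: \<Lambda> lattice_basis_def std_lattice_box)
  qed (auto simp: box_def mult_add_distrib_mat_vec[OF frameD(1)[OF B]] mult_mat_vec[OF frameD(1)[OF B]])
  then show "is_lattice \<O> n \<Lambda>"
    using submodule_span_box[OF B] by (simp add: is_lattice_def std_lattice_box \<Lambda>)
qed

end

section \<open>The reduction of a lattice and its subspaces\<close>

context valued_field
begin

lemma res_class_eq_iff:
  assumes B: "frame n B D" and v: "v \<in> carrier_vec n" and w: "w \<in> carrier_vec n"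
  shows "res_class \<O> n (span_box \<O> B) v = res_class \<O> n (span_box \<O> B) w \<longleftrightarrow>
    (\<forall>i<n. (D *\<^sub>v v) $ i - (D *\<^sub>v w) $ i \<in> \<MM>)"
proof -
  let ?N = "span_box \<MM> B"
  have N: "submodule \<O> n ?N" using submodule_span_box[OF B] by blast
  then have carr: "?N \<subseteq> carrier_vec n" by (simp add: submodule_def)
  have sub: "{v + z |z. z \<in> ?N} \<subseteq> {w + z |z. z \<in> ?N}"
    if vw: "v \<in> carrier_vec n" "w \<in> carrier_vec n" "v - w \<in> ?N" for v w
  proof
    fix y assume "y \<in> {v + z |z. z \<in> ?N}"
    then obtain z where z: "y = v + z" "z \<in> ?N" by blast
    have "y = w + ((v - w) + z)" using z carr vw by (intro eq_vecI) auto
    moreover have "(v - w) + z \<in> ?N" using N z(2) vw(3) by (simp add: submodule_def)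
    ultimately show "y \<in> {w + z |z. z \<in> ?N}" by blast
  qed
  have neg: "w - v \<in> ?N" if "v - w \<in> ?N"
  proof -
    have "w - v = (- 1) \<cdot>\<^sub>v (v - w)" using v w by (intro eq_vecI) auto
    moreover have "- 1 \<in> \<O>" using O_uminus[of 1] by simp
    ultimately show ?thesis using N that unfolding submodule_def by metis
  qed
  have "res_class \<O> n (span_box \<O> B) v = res_class \<O> n (span_box \<O> B) w \<longleftrightarrow> v - w \<in> ?N"
    unfolding res_class_def max_mult_span_box[OF B]
  proof
    assume eq: "{v + z |z. z \<in> ?N} = {w + z |z. z \<in> ?N}"
    have "v = v + 0\<^sub>v n" "0\<^sub>v n \<in> ?N" using v N by (auto simp: submodule_def)
    then have "v \<in> {w + z |z. z \<in> ?N}" unfolding eq[symmetric] by blast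
    then obtain z where z: "v = w + z" "z \<in> ?N" by blast
    then have "v - w = z" using w carr by (intro eq_vecI) auto
    then show "v - w \<in> ?N" using z by simp
  next
    assume "v - w \<in> ?N"
    then show "{v + z |z. z \<in> ?N} = {w + z |z. z \<in> ?N}"
      using sub[OF v w] sub[OF w v] neg by blast
  qed
  also have "\<dots> \<longleftrightarrow> (\<forall>i<n. (D *\<^sub>v v) $ i - (D *\<^sub>v w) $ i \<in> \<MM>)"
    using v w frameD(2,8)[OF B] unfolding span_box_frame[OF B]
    by (simp add: mult_minus_distrib_mat_vec[OF frameD(2)[OF B] v w] box_def)
  finally show ?thesis .
qed

text \<open>Two vectors in one class differ by an element of the \<MM>-span, which \<open>N\<close>
  contains. Thus subspaces of the reduction may be treated as submodules lying above that
  span.\<close>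

lemma res_class_image_iff:
  assumes B: "frame n B D" and N: "submodule \<O> n N" "span_box \<MM> B \<subseteq> N" and v: "v \<in> carrier_vec n"
  shows "res_class \<O> n (span_box \<O> B) v \<in> res_class \<O> n (span_box \<O> B) ` N \<longleftrightarrow> v \<in> N"
proof
  assume "res_class \<O> n (span_box \<O> B) v \<in> res_class \<O> n (span_box \<O> B) ` N"
  then obtain w where w: "w \<in> N" "res_class \<O> n (span_box \<O> B) v = res_class \<O> n (span_box \<O> B) w" by blast
  have wc: "w \<in> carrier_vec n" using w(1) N(1) by (auto simp: submodule_def)
  have "v - w \<in> span_box \<MM> B"
    using w(2) unfolding res_class_eq_iff[OF B v wc] span_box_frame[OF B]
    using v wc frameD(2,8)[OF B]
    by (simp add: mult_minus_distrib_mat_vec[OF frameD(2)[OF B] v wc] box_def)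
  then have "w + (v - w) \<in> N" using N w(1) by (auto simp: submodule_def)
  moreover have "w + (v - w) = v" using v wc by (intro eq_vecI) auto
  ultimately show "v \<in> N" by simp
qed auto

text \<open>One round of Gaussian elimination: multiples of coordinate \<open>p\<close> are added to
  all coordinates, including \<open>p\<close> itself, which is thereby scaled by
  \<open>1 + c p\<close>.\<close>

lemma elementary_frame:
  fixes c :: "nat \<Rightarrow> 'a"
  assumes B: "frame n B D" and p: "p < n" "1 + c p \<noteq> 0"
  shows "\<exists>B' D'. frame n B' D' \<and>
    (\<forall>v\<in>carrier_vec n. \<forall>q<n. (D' *\<^sub>v v) $ q = (D *\<^sub>v v) $ q + c q * (D *\<^sub>v v) $ p)"
proof -
  define E where "E = mat n n (\<lambda>(q, r). (if q = r then 1 else 0) + (if r = p then c q else 0))"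
  have E: "E \<in> carrier_mat n n" by (simp add: E_def)
  have Ey: "(E *\<^sub>v y) $ q = y $ q + c q * y $ p" if "y \<in> carrier_vec n" "q < n" for y q
  proof -
    have "(E *\<^sub>v y) $ q = (\<Sum>r<n. (if q = r then y $ r else 0) + (if r = p then c q * y $ r else 0))"
      unfolding mult_mat_vec_nth[OF E that] using that(2)
      by (intro sum.cong) (auto simp: E_def distrib_right)
    also have "\<dots> = y $ q + c q * y $ p"
      using that(2) p(1) by (simp add: sum.distrib)
    finally show ?thesis .
  qed
  have "\<exists>F. frame n E F"
  proof (rule frame_ex[OF E])
    fix y assume y: "y \<in> carrier_vec n" "E *\<^sub>v y = 0\<^sub>v n"
    have *: "y $ q + c q * y $ p = 0" if "q < n" for q
      using Ey[OF y(1) that] y(2) that by simp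
    have "(1 + c p) * y $ p = 0" using *[OF p(1)] by (simp add: algebra_simps)
    then have "y $ p = 0" using p(2) by simp
    then show "y = 0\<^sub>v n" using * y(1) by (intro eq_vecI) auto
  qed
  then obtain F where "frame n F E" using frame_sym by blast
  from frame_mult[OF B this] have "frame n (B * F) (E * D)" .
  moreover have "((E * D) *\<^sub>v v) $ q = (D *\<^sub>v v) $ q + c q * (D *\<^sub>v v) $ p"
    if "v \<in> carrier_vec n" "q < n" for v q
    using Ey[OF frameD(8)[OF B, of v] that(2)] assoc_mult_mat_vec[OF E frameD(2)[OF B] that(1)] by simp
  ultimately show ?thesis by blast
qed

lemma exchange:
  fixes l :: nat
  assumes B: "frame n B D"
    and u: "\<And>j. j < l \<Longrightarrow> u j \<in> span_box \<O> B"
    and indep: "\<And>c. (\<And>j. j < l \<Longrightarrow> c j \<in> \<O>) \<Longrightarrow>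
      vec n (\<lambda>i. \<Sum>j<l. c j * u j $ i) \<in> span_box \<MM> B \<Longrightarrow> \<forall>j<l. c j \<in> \<MM>"
  shows "\<exists>B' D' \<iota>. frame n B' D' \<and> span_box \<O> B' = span_box \<O> B \<and> span_box \<MM> B' = span_box \<MM> B \<and>
    inj_on \<iota> {..<l} \<and> \<iota> ` {..<l} \<subseteq> {..<n} \<and> (\<forall>j<l. D' *\<^sub>v u j = unit_vec n (\<iota> j))"
  using u indep
proof (induction l)
  case 0
  then show ?case using B by auto
next
  case (Suc l)
  have ind: "\<forall>j<l. c j \<in> \<MM>" if c: "\<And>j. j < l \<Longrightarrow> c j \<in> \<O>"
    "vec n (\<lambda>i. \<Sum>j<l. c j * u j $ i) \<in> span_box \<MM> B" for c
  proof -
    have "(c(l := 0)) j \<in> \<O>" if "j < Suc l" for j using c(1) that by (auto simp: less_Suc_eq)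
    moreover have "vec n (\<lambda>i. \<Sum>j<Suc l. (c(l := 0)) j * u j $ i) \<in> span_box \<MM> B" using c(2) by simp
    ultimately have "\<forall>j<Suc l. (c(l := 0)) j \<in> \<MM>" by (rule Suc.prems(2))
    then show ?thesis by (metis fun_upd_other less_SucI less_irrefl)
  qed
  have "\<exists>B' D' \<iota>. frame n B' D' \<and> span_box \<O> B' = span_box \<O> B \<and> span_box \<MM> B' = span_box \<MM> B \<and>
      inj_on \<iota> {..<l} \<and> \<iota> ` {..<l} \<subseteq> {..<n} \<and> (\<forall>j<l. D' *\<^sub>v u j = unit_vec n (\<iota> j))"
    by (rule Suc.IH) (simp add: Suc.prems(1), fact ind)
  then obtain B' D' \<iota> where B': "frame n B' D'" and
    span: "span_box \<O> B' = span_box \<O> B" "span_box \<MM> B' = span_box \<MM> B" and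
    \<iota>: "inj_on \<iota> {..<l}" "\<iota> ` {..<l} \<subseteq> {..<n}" and
    D'u: "\<And>j. j < l \<Longrightarrow> D' *\<^sub>v u j = unit_vec n (\<iota> j)"
    by blast
  have uc: "u j \<in> carrier_vec n" if "j \<le> l" for j
    using Suc.prems(1)[of j] that by (auto simp: span_box_frame[OF B])
  define x where "x = D' *\<^sub>v u l"
  have x: "x \<in> carrier_vec n" "\<And>i. i < n \<Longrightarrow> x $ i \<in> \<O>"
    using Suc.prems(1)[of l] unfolding span[symmetric] span_box_frame[OF B'] by (auto simp: x_def box_def)
  have "\<exists>p<n. p \<notin> \<iota> ` {..<l} \<and> x $ p \<notin> \<MM>"
  proof (rule ccontr)
    assume "\<not> ?thesis"
    then have neg: "\<And>p. p < n \<Longrightarrow> p \<notin> \<iota> ` {..<l} \<Longrightarrow> x $ p \<in> \<MM>" by blast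
    define c where "c j = (if j = l then 1 else - x $ \<iota> j)" for j
    have cO: "c j \<in> \<O>" if "j < Suc l" for j
    proof (cases "j = l")
      case False
      then have "\<iota> j < n" using that \<iota>(2) by (simp add: image_subset_iff)
      then show ?thesis using x(2) False by (simp add: c_def O_uminus)
    qed (simp add: c_def)
    define w where "w = vec n (\<lambda>i. \<Sum>j<Suc l. c j * u j $ i)"
    have "(D' *\<^sub>v w) $ i \<in> \<MM>" if i: "i < n" for i
    proof -
      have "(D' *\<^sub>v w) $ i = (\<Sum>k<n. D' $$ (i, k) * (\<Sum>j<Suc l. c j * u j $ k))"
        using mult_mat_vec_nth[OF frameD(2)[OF B'] _ i, of w] by (simp add: w_def)
      also have "\<dots> = (\<Sum>j<Suc l. c j * (\<Sum>k<n. D' $$ (i, k) * u j $ k))"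
        unfolding sum_distrib_left by (subst sum.swap) (simp add: mult_ac)
      also have "\<dots> = (\<Sum>j<Suc l. c j * (D' *\<^sub>v u j) $ i)"
        using mult_mat_vec_nth[OF frameD(2)[OF B'] uc i] by (intro sum.cong) auto
      also have "\<dots> = x $ i + (\<Sum>j<l. c j * unit_vec n (\<iota> j) $ i)"
        by (simp add: D'u x_def c_def)
      also have "(\<Sum>j<l. c j * unit_vec n (\<iota> j) $ i) = (\<Sum>j<l. if i = \<iota> j then - x $ i else 0)"
        using i by (intro sum.cong) (auto simp: c_def unit_vec_def left_diff_distrib)
      finally have Dw: "(D' *\<^sub>v w) $ i = x $ i + (\<Sum>j<l. if i = \<iota> j then - x $ i else 0)" .
      show ?thesis
      proof (cases "i \<in> \<iota> ` {..<l}")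
        case True
        then obtain j where j: "j < l" "i = \<iota> j" by auto
        have "(\<Sum>j<l. if i = \<iota> j then - x $ i else 0) = (\<Sum>j'<l. if j' = j then - x $ i else 0)"
          using j \<iota>(1) by (intro sum.cong) (auto simp: inj_on_def)
        then show ?thesis unfolding Dw using j by simp
      next
        case False
        then have "(\<Sum>j<l. if i = \<iota> j then - x $ i else 0) = 0" by (intro sum.neutral) auto
        then show ?thesis unfolding Dw using neg[OF i False] by simp
      qed
    qed
    then have "w \<in> span_box \<MM> B"
      unfolding span(2)[symmetric] span_box_frame[OF B'] using frameD(2)[OF B'] by (auto simp: w_def box_def)
    then have "c l \<in> \<MM>" using Suc.prems(2)[of c] cO unfolding w_def by blast
    then show False by (simp add: c_def)
  qed
  then obtain p where p: "p < n" "p \<notin> \<iota> ` {..<l}" "x $ p \<notin> \<MM>" by blast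
  then have xp: "inverse (x $ p) \<in> \<O>" "x $ p \<noteq> 0" using unit_inverse x(2) by auto
  \<comment> \<open>Chosen so that coordinate \<open>p\<close> of \<open>u l\<close> becomes 1 and
    all others become 0. As \<open>x $ p\<close> is a unit, the step is invertible over \<O> and
    preserves both spans.\<close>
  define c where "c q = (if q = p then inverse (x $ p) - 1 else - x $ q * inverse (x $ p))" for q
  have cO: "c q \<in> \<O>" if "q < n" for q
    using that xp x(2) by (auto simp: c_def intro!: O_diff O_mult O_uminus)
  have "1 + c p \<noteq> 0" using xp by (simp add: c_def)
  from elementary_frame[where c = c, OF B' p(1) this] obtain B2 D2 where B2: "frame n B2 D2"
    and D2: "\<And>v q. v \<in> carrier_vec n \<Longrightarrow> q < n \<Longrightarrow>
      (D2 *\<^sub>v v) $ q = (D' *\<^sub>v v) $ q + c q * (D' *\<^sub>v v) $ p" by blast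
  have X: "span_box X B2 = span_box X B'" if X: "X = \<O> \<or> X = \<MM>" for X
  proof -
    have Xadd: "a + b \<in> X" "a - b \<in> X" if "a \<in> X" "b \<in> X" for a b
      using that X O_add O_diff M_add M_uminus[of b] M_add[of a "- b"] by auto
    have Xmult: "a * b \<in> X" if "a \<in> \<O>" "b \<in> X" for a b
      using that X O_mult M_mult' by auto
    have "(\<forall>q<n. (D2 *\<^sub>v v) $ q \<in> X) \<longleftrightarrow> (\<forall>q<n. (D' *\<^sub>v v) $ q \<in> X)" (is "?l \<longleftrightarrow> ?r")
      if v: "v \<in> carrier_vec n" for v
    proof
      assume ?l
      have "(D' *\<^sub>v v) $ p = x $ p * (D2 *\<^sub>v v) $ p"
        unfolding D2[OF v p(1)] using xp by (simp add: c_def field_simps)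
      then have "(D' *\<^sub>v v) $ p \<in> X" using \<open>?l\<close> p(1) x(2) Xmult by metis
      moreover have "(D' *\<^sub>v v) $ q = (D2 *\<^sub>v v) $ q - c q * (D' *\<^sub>v v) $ p" if "q < n" for q
        using D2[OF v that] by simp
      ultimately show ?r using \<open>?l\<close> Xadd Xmult cO by metis
    next
      assume ?r
      then show ?l using D2[OF v] Xadd Xmult cO p(1) by metis
    qed
    then show ?thesis
      unfolding set_eq_iff span_box_frame[OF B2] span_box_frame[OF B']
      using frameD(8)[OF B2] frameD(8)[OF B'] by (auto simp: box_def)
  qed
  define \<iota>' where "\<iota>' = \<iota>(l := p)"
  have "D2 *\<^sub>v u j = unit_vec n (\<iota>' j)" if j: "j < Suc l" for j
  proof (rule eq_vecI)
    show "dim_vec (D2 *\<^sub>v u j) = dim_vec (unit_vec n (\<iota>' j))" using frameD(2)[OF B2] by simp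
    fix q assume "q < dim_vec (unit_vec n (\<iota>' j))"
    then have q: "q < n" by simp
    have "u j \<in> carrier_vec n" using uc j by simp
    note D2q = D2[OF this q]
    show "(D2 *\<^sub>v u j) $ q = unit_vec n (\<iota>' j) $ q"
    proof (cases "j = l")
      case True
      then show ?thesis unfolding D2q using q p(1) xp
        by (simp add: \<iota>'_def x_def[symmetric] c_def unit_vec_def left_diff_distrib)
    next
      case False
      then have "j < l" using j by simp
      then have "\<iota> j \<noteq> p" using p(2) by auto
      then show ?thesis unfolding D2q using q p(1) False \<open>j < l\<close> by (simp add: \<iota>'_def D'u unit_vec_def)
    qed
  qed
  moreover have "inj_on \<iota>' {..<Suc l}" "\<iota>' ` {..<Suc l} \<subseteq> {..<n}"
    using \<iota> p by (auto simp: \<iota>'_def inj_on_def lessThan_Suc)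
  moreover have "span_box \<O> B2 = span_box \<O> B" "span_box \<MM> B2 = span_box \<MM> B"
    using X span by auto
  ultimately show ?case using B2 by blast
qed

text \<open>Only a functional with a coefficient of value larger than 1 cuts down the lattice; it can
  then replace the coordinate in which it is dominant.\<close>

lemma constrain_lattice:
  assumes B: "frame n B D" and s: "s \<in> carrier_vec n"
  shows "\<exists>B' D'. frame n B' D' \<and> span_box \<O> B' = {v \<in> span_box \<O> B. s \<bullet> v \<in> \<O>}"
proof -
  define x where "x i = s \<bullet> col B i" for i
  have sv: "s \<bullet> v = (\<Sum>i<n. x i * (D *\<^sub>v v) $ i)" if "v \<in> carrier_vec n" for v
    unfolding x_def by (rule scalar_prod_frame[OF B that s])
  show ?thesis
  proof (cases "\<forall>i<n. x i \<in> \<O>")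
    case True
    then have "s \<bullet> v \<in> \<O>" if "v \<in> span_box \<O> B" for v
      using that sv[of v] unfolding span_box_frame[OF B] by (auto simp: box_def intro!: O_sum O_mult)
    then have "span_box \<O> B = {v \<in> span_box \<O> B. s \<bullet> v \<in> \<O>}" by blast
    then show ?thesis using B by blast
  next
    case False
    then obtain i where i: "i < n" "x i \<notin> \<O>" by blast
    then have "x i \<noteq> 0" by auto
    then obtain p where p: "p < n" "x p \<noteq> 0" "\<And>q. q < n \<Longrightarrow> x q / x p \<in> \<O>"
      using ex_dominant[of "{..<n}" i x] i by auto
    have "x p \<notin> \<O>"
    proof
      assume "x p \<in> \<O>"
      then have "x i / x p * x p \<in> \<O>" using p(3)[OF i(1)] O_mult by blast
      then show False using i p(2) by simp
    qed
    then have ip: "inverse (x p) \<in> \<O>" by (rule O_total)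
    define E where "E = mat n n (\<lambda>(q, r). if q = p then x r else if q = r then 1 else 0)"
    have E: "E \<in> carrier_mat n n" by (simp add: E_def)
    have Ey: "(E *\<^sub>v y) $ q = (if q = p then \<Sum>r<n. x r * y $ r else y $ q)"
      if "y \<in> carrier_vec n" "q < n" for y q
    proof -
      have "(E *\<^sub>v y) $ q = (\<Sum>r<n. if q = p then x r * y $ r else if q = r then y $ r else 0)"
        unfolding mult_mat_vec_nth[OF E that] using that(2) by (intro sum.cong) (auto simp: E_def)
      also have "\<dots> = (if q = p then \<Sum>r<n. x r * y $ r else y $ q)" using that(2) by simp
      finally show ?thesis .
    qed
    \<comment> \<open>The old coordinate \<open>p\<close> is recovered from
      \<open>s \<bullet> v\<close> and the other coordinates. All coefficients are integral, the
      ratios because \<open>x p\<close> is dominant and \<open>inverse (x p)\<close> because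
      \<open>x p\<close> is not integral.\<close>
    have solve: "y $ p = inverse (x p) * (\<Sum>r<n. x r * y $ r) - (\<Sum>r\<in>{..<n} - {p}. (x r / x p) * y $ r)" for y :: "'a vec"
    proof -
      have "(\<Sum>r<n. x r * y $ r) = x p * y $ p + (\<Sum>r\<in>{..<n} - {p}. x r * y $ r)"
        using p(1) by (subst sum.remove[of _ p]) auto
      moreover have "(\<Sum>r\<in>{..<n} - {p}. (x r / x p) * y $ r) = inverse (x p) * (\<Sum>r\<in>{..<n} - {p}. x r * y $ r)"
        by (simp add: sum_distrib_left field_simps)
      ultimately show ?thesis using p(2) by (simp add: algebra_simps)
    qed
    have "\<exists>F. frame n E F"
    proof (rule frame_ex[OF E])
      fix y assume y: "y \<in> carrier_vec n" "E *\<^sub>v y = 0\<^sub>v n"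
      then have *: "(if q = p then \<Sum>r<n. x r * y $ r else y $ q) = 0" if "q < n" for q
        using Ey[OF y(1) that] that by simp
      have "y $ q = 0" if "q < n" "q \<noteq> p" for q using *[OF that(1)] that(2) by simp
      moreover from this have "y $ p = 0" using solve[of y] *[OF p(1)] by simp
      ultimately show "y = 0\<^sub>v n" using y(1) by (intro eq_vecI) auto
    qed
    then obtain F where "frame n F E" using frame_sym by blast
    from frame_mult[OF B this] have fr: "frame n (B * F) (E * D)" .
    have "v \<in> span_box \<O> (B * F) \<longleftrightarrow> v \<in> span_box \<O> B \<and> s \<bullet> v \<in> \<O>" for v
    proof (cases "v \<in> carrier_vec n")
      case v: True
      define y where "y = D *\<^sub>v v"
      have y: "y \<in> carrier_vec n" using frameD(8)[OF B] by (simp add: y_def)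
      have ED: "(E * D) *\<^sub>v v = E *\<^sub>v y"
        using assoc_mult_mat_vec[OF E frameD(2)[OF B] v] by (simp add: y_def)
      have "(\<forall>q<n. (E *\<^sub>v y) $ q \<in> \<O>) \<longleftrightarrow> (\<forall>q<n. y $ q \<in> \<O>) \<and> s \<bullet> v \<in> \<O>" (is "?l \<longleftrightarrow> ?r")
      proof
        assume ?l
        then have *: "(if q = p then s \<bullet> v else y $ q) \<in> \<O>" if "q < n" for q
          using Ey[OF y that] that sv[OF v] \<open>?l\<close> unfolding y_def[symmetric] by metis
        have sO: "s \<bullet> v \<in> \<O>" using *[OF p(1)] by simp
        have yO: "y $ q \<in> \<O>" if "q < n" "q \<noteq> p" for q using *[OF that(1)] that(2) by simp
        have "x r / x p * y $ r \<in> \<O>" if "r \<in> {..<n} - {p}" for r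
          using that yO p(3) by (intro O_mult) auto
        then have "(\<Sum>r\<in>{..<n} - {p}. x r / x p * y $ r) \<in> \<O>" by (rule O_sum)
        moreover have "(\<Sum>r<n. x r * y $ r) \<in> \<O>" using sv[OF v] sO by (simp add: y_def)
        ultimately have "y $ p \<in> \<O>"
          unfolding solve[of y] using ip by (intro O_diff O_mult)
        then show ?r using yO sO by metis
      next
        assume ?r
        then show ?l using Ey[OF y] sv[OF v] by (simp add: y_def)
      qed
      then show ?thesis
        unfolding span_box_frame[OF fr] span_box_frame[OF B] ED using v y E by (simp add: box_def y_def)
    next
      case False
      then show ?thesis by (simp add: span_box_frame[OF fr] span_box_frame[OF B])
    qed
    then show ?thesis using fr by blast
  qed
qed

lemma constrain_lattice_finite:
  assumes "finite S" and B: "frame n B D" and S: "S \<subseteq> carrier_vec n"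
  shows "\<exists>B' D'. frame n B' D' \<and> span_box \<O> B' = {v \<in> span_box \<O> B. \<forall>s\<in>S. s \<bullet> v \<in> \<O>}"
  using assms(1) S
proof (induction S)
  case empty
  then show ?case using B by auto
next
  case (insert s S)
  then obtain B' D' where "frame n B' D'"
    "span_box \<O> B' = {v \<in> span_box \<O> B. \<forall>s\<in>S. s \<bullet> v \<in> \<O>}" by auto
  with constrain_lattice[of n B' D' s] insert.prems show ?case by auto
qed

lemma mat_of_vecs_mult:
  fixes c :: "'a vec"
  assumes "c \<in> carrier_vec l"
  shows "mat n l (\<lambda>(i, j). u j $ i) *\<^sub>v c = vec n (\<lambda>i. \<Sum>j<l. c $ j * u j $ i)"
  using assms by (intro eq_vecI) (auto simp: scalar_prod_sum[OF assms] mult.commute intro!: sum.cong)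

lemma res_subspace_image:
  assumes B: "frame n B D" and N: "submodule \<O> n N" "span_box \<MM> B \<subseteq> N" "N \<subseteq> span_box \<O> B"
  shows "res_subspace \<O> n (span_box \<O> B) (res_class \<O> n (span_box \<O> B) ` N)"
proof -
  have c: "v \<in> carrier_vec n" if "v \<in> span_box \<O> B" for v
    using that by (simp add: span_box_frame[OF B])
  note iff = res_class_image_iff[OF B N(1,2)]
  show ?thesis
    unfolding res_subspace_def
  proof (intro conjI ballI impI)
    show "res_class \<O> n (span_box \<O> B) ` N \<subseteq> res \<O> n (span_box \<O> B)" using N(3) by (auto simp: res_def)
    show "res_class \<O> n (span_box \<O> B) (0\<^sub>v n) \<in> res_class \<O> n (span_box \<O> B) ` N"
      using N(1) by (auto simp: submodule_def)
  next
    fix v w assume "v \<in> span_box \<O> B" "w \<in> span_box \<O> B"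
      "res_class \<O> n (span_box \<O> B) v \<in> res_class \<O> n (span_box \<O> B) ` N"
      "res_class \<O> n (span_box \<O> B) w \<in> res_class \<O> n (span_box \<O> B) ` N"
    then have "v \<in> N" "w \<in> N" using iff c by auto
    then show "res_class \<O> n (span_box \<O> B) (v + w) \<in> res_class \<O> n (span_box \<O> B) ` N"
      using N(1) by (auto simp: submodule_def)
  next
    fix a v assume "a \<in> \<O>" "v \<in> span_box \<O> B"
      "res_class \<O> n (span_box \<O> B) v \<in> res_class \<O> n (span_box \<O> B) ` N"
    then show "res_class \<O> n (span_box \<O> B) (a \<cdot>\<^sub>v v) \<in> res_class \<O> n (span_box \<O> B) ` N"
      using N(1) iff c by (auto simp: submodule_def)
  qed
qed

text \<open>The dimension is the largest size of a family in \<open>N\<close> that is independent in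
  the reduction; \<open>exchange\<close> bounds such sizes by \<open>n\<close>. Maximality makes the
  family span.\<close>

lemma ex_res_basis:
  assumes B: "frame n B D" and N: "submodule \<O> n N" "span_box \<MM> B \<subseteq> N" "N \<subseteq> span_box \<O> B"
  shows "\<exists>l. (span_box \<O> B, res_class \<O> n (span_box \<O> B) ` N) \<in> R_set \<O> n l"
proof -
  let ?\<Lambda> = "span_box \<O> B" and ?M = "span_box \<MM> B"
  define ind where "ind l u \<longleftrightarrow> (\<forall>j<l. u j \<in> N) \<and> (\<forall>c. (\<forall>j<l. c j \<in> \<O>) \<longrightarrow>
    vec n (\<lambda>i. \<Sum>j<l. c j * u j $ i) \<in> ?M \<longrightarrow> (\<forall>j<l. c j \<in> \<MM>))" for l :: nat and u
  have sM: "submodule \<O> n ?M" using submodule_span_box[OF B] by blast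
  have c: "v \<in> carrier_vec n" if "v \<in> N" for v using that N(1) by (auto simp: submodule_def)
  have comb: "vec n (\<lambda>i. \<Sum>j<l. c j * u j $ i) \<in> N"
    if "\<And>j. j < l \<Longrightarrow> u j \<in> N" "\<And>j. j < l \<Longrightarrow> c j \<in> \<O>" for l :: nat and c u
  proof -
    have "vec n (\<lambda>i. \<Sum>j<l. (c j \<cdot>\<^sub>v u j) $ i) \<in> N"
      using that N(1) by (intro submodule_sum) (auto simp: submodule_def)
    moreover have "vec n (\<lambda>i. \<Sum>j<l. (c j \<cdot>\<^sub>v u j) $ i) = vec n (\<lambda>i. \<Sum>j<l. c j * u j $ i)"
      using carrier_vecD[OF c[OF that(1)]] by (intro eq_vecI) (auto intro!: sum.cong)
    ultimately show ?thesis by simp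
  qed
  have "l \<le> n" if iu: "ind l u" for l u
  proof -
    have 1: "\<And>j. j < l \<Longrightarrow> u j \<in> ?\<Lambda>" using iu N(3) by (auto simp: ind_def)
    have 2: "\<forall>j<l. c j \<in> \<MM>" if "\<And>j. j < l \<Longrightarrow> c j \<in> \<O>" "vec n (\<lambda>i. \<Sum>j<l. c j * u j $ i) \<in> ?M" for c
      using iu that unfolding ind_def by blast
    from exchange[where u = u and l = l, OF B 1 2] obtain \<iota> where \<iota>: "inj_on \<iota> {..<l}" "\<iota> ` {..<l} \<subseteq> {..<n}" by blast
    then show "l \<le> n" using card_inj_on_le[of \<iota> "{..<l}" "{..<n}"] by simp
  qed
  moreover have "\<exists>u. ind 0 u" by (simp add: ind_def)
  ultimately obtain l where l: "\<exists>u. ind l u" "\<And>l'. \<exists>u. ind l' u \<Longrightarrow> l' \<le> l"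
    using Nat.ex_has_greatest_nat[of "\<lambda>l. \<exists>u. ind l u" 0 n] by blast
  then obtain u where iu: "ind l u" by blast
  have uN: "\<And>j. j < l \<Longrightarrow> u j \<in> N" using iu by (simp add: ind_def)
  define U where "U = mat n l (\<lambda>(i, j). u j $ i)"
  have U: "U \<in> carrier_mat n l" by (simp add: U_def)
  have Uc: "U *\<^sub>v x = vec n (\<lambda>i. \<Sum>j<l. x $ j * u j $ i)" if "x \<in> carrier_vec l" for x
    unfolding U_def by (rule mat_of_vecs_mult[OF that])
  have res0: "res_class \<O> n ?\<Lambda> v = res_class \<O> n ?\<Lambda> w \<longleftrightarrow> v - w \<in> ?M"
    if "v \<in> carrier_vec n" "w \<in> carrier_vec n" for v w
    unfolding res_class_eq_iff[OF B that] span_box_frame[OF B]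
    using that frameD(8)[OF B] frameD(2)[OF B]
    by (simp add: mult_minus_distrib_mat_vec[OF frameD(2)[OF B] that] box_def)
  have "res_basis \<O> n l ?\<Lambda> (res_class \<O> n ?\<Lambda> ` N) U"
    unfolding res_basis_def std_lattice_box
  proof (intro conjI ballI impI)
    show "U \<in> carrier_mat n l" by (rule U)
    have "col U j = u j" if "j < l" for j using that c[OF uN[OF that]] by (intro eq_vecI) (auto simp: U_def)
    then show "set (cols U) \<subseteq> ?\<Lambda>" using uN N(3) U by (auto simp: cols_def)
  next
    fix x assume x: "x \<in> box l \<O>" "res_class \<O> n ?\<Lambda> (U *\<^sub>v x) = res_class \<O> n ?\<Lambda> (0\<^sub>v n)"
    have xc: "x \<in> carrier_vec l" using x(1) by (simp add: box_def)
    have "U *\<^sub>v x - 0\<^sub>v n = U *\<^sub>v x" using U by (intro eq_vecI) auto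
    then have "vec n (\<lambda>i. \<Sum>j<l. x $ j * u j $ i) \<in> ?M"
      using x(2) Uc[OF xc] by (simp add: res0)
    then show "\<forall>i<l. x $ i \<in> \<MM>" using iu x(1) unfolding ind_def box_def by blast
  next
    have "\<exists>x\<in>box l \<O>. res_class \<O> n ?\<Lambda> v = res_class \<O> n ?\<Lambda> (U *\<^sub>v x)" if v: "v \<in> N" for v
    proof -
      \<comment> \<open>By maximality \<open>v\<close> and the \<open>u j\<close> satisfy a
        nontrivial relation modulo \<MM>. Its coefficient at \<open>v\<close> is a unit, for
        otherwise that term could be dropped and the \<open>u j\<close> would be dependent; so the
        relation can be solved for \<open>v\<close>.\<close>
      have "\<not> ind (Suc l) (u(l := v))" using l(2)[of "Suc l"] by auto
      moreover have "\<forall>j<Suc l. (u(l := v)) j \<in> N" using uN v by (simp add: less_Suc_eq)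
      ultimately obtain a where a: "\<And>j. j < Suc l \<Longrightarrow> a j \<in> \<O>" "\<not> (\<forall>j<Suc l. a j \<in> \<MM>)"
        "vec n (\<lambda>i. \<Sum>j<Suc l. a j * (u(l := v)) j $ i) \<in> ?M"
        unfolding ind_def by blast
      define s where "s = vec n (\<lambda>i. \<Sum>j<l. a j * u j $ i)"
      have "vec n (\<lambda>i. \<Sum>j<Suc l. a j * (u(l := v)) j $ i) = s + a l \<cdot>\<^sub>v v"
        using c[OF v] by (intro eq_vecI) (auto simp: s_def)
      with a(3) have sa: "s + a l \<cdot>\<^sub>v v \<in> ?M" by simp
      have vc: "v \<in> carrier_vec n" and sc: "s \<in> carrier_vec n" using c[OF v] by (auto simp: s_def)
      have al: "a l \<notin> \<MM>"
      proof
        assume al: "a l \<in> \<MM>"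
        have "v \<in> ?\<Lambda>" using v N(3) by blast
        then have "b \<cdot>\<^sub>v v \<in> ?M" if "b \<in> \<MM>" for b
          using M_mult[OF that] frameD(2)[OF B] unfolding span_box_frame[OF B]
          by (auto simp: mult_mat_vec[OF frameD(2)[OF B]] box_def)
        from this[OF M_uminus[OF al]] have "(s + a l \<cdot>\<^sub>v v) + (- a l) \<cdot>\<^sub>v v \<in> ?M" using sa sM by (simp add: submodule_def)
        moreover have "(s + a l \<cdot>\<^sub>v v) + (- a l) \<cdot>\<^sub>v v = s" using vc sc by (intro eq_vecI) auto
        ultimately have "\<forall>j<l. a j \<in> \<MM>" using iu a(1) unfolding ind_def s_def by (metis less_SucI)
        then show False using a(2) al by (auto simp: less_Suc_eq)
      qed
      then have inv: "inverse (a l) \<in> \<O>" "a l \<noteq> 0" using unit_inverse a(1) by auto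
      define x where "x = vec l (\<lambda>j. - inverse (a l) * a j)"
      have x: "x \<in> box l \<O>" using a(1) inv by (auto simp: x_def box_def intro!: O_mult O_uminus)
      have "v - U *\<^sub>v x = inverse (a l) \<cdot>\<^sub>v (s + a l \<cdot>\<^sub>v v)"
        using vc sc inv(2) x unfolding Uc[of x] s_def
        by (intro eq_vecI) (auto simp: Uc x_def sum_distrib_left sum_negf mult.assoc distrib_left)
      then have "v - U *\<^sub>v x \<in> ?M" using sa sM inv by (simp add: submodule_def)
      moreover have "U *\<^sub>v x \<in> carrier_vec n" using U by (intro carrier_vecI) simp
      ultimately have "res_class \<O> n ?\<Lambda> v = res_class \<O> n ?\<Lambda> (U *\<^sub>v x)"
        using res0[OF vc] by blast
      then show ?thesis using x by blast
    qed
    moreover have "U *\<^sub>v x \<in> N" if x: "x \<in> box l \<O>" for x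
    proof -
      have "vec n (\<lambda>i. \<Sum>j<l. x $ j * u j $ i) \<in> N"
        using x by (intro comb uN) (auto simp: box_def)
      then show ?thesis using Uc[of x] x by (simp add: box_def)
    qed
    ultimately show "res_class \<O> n ?\<Lambda> ` N = {res_class \<O> n ?\<Lambda> (U *\<^sub>v c) |c. c \<in> box l \<O>}"
      by blast
  qed
  moreover have "is_lattice \<O> n ?\<Lambda>" using B is_lattice_iff by blast
  ultimately show ?thesis
    using res_subspace_image[OF B N] unfolding R_set_def by blast
qed

text \<open>A lift of a basis of \<open>V\<close> is completed by \<open>exchange\<close>. In the
  resulting lattice basis, \<open>V\<close> is spanned by the basis vectors with index in
  \<open>J\<close>, so it is cut out by the vanishing of the other coordinates modulo \<MM>.\<close>

lemma adapted_frame: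
  assumes "(\<Lambda>, V) \<in> R_set \<O> n l"
  shows "\<exists>B D J. frame n B D \<and> \<Lambda> = span_box \<O> B \<and>
    (\<forall>v\<in>\<Lambda>. res_class \<O> n \<Lambda> v \<in> V \<longleftrightarrow> (\<forall>p<n. p \<notin> J \<longrightarrow> (D *\<^sub>v v) $ p \<in> \<MM>))"
proof -
  obtain U where L: "is_lattice \<O> n \<Lambda>" and U: "res_basis \<O> n l \<Lambda> V U"
    using assms by (auto simp: R_set_def)
  obtain B D where B: "frame n B D" and \<Lambda>: "\<Lambda> = span_box \<O> B" using L is_lattice_iff by blast
  have Uc: "U \<in> carrier_mat n l" and cols: "set (cols U) \<subseteq> \<Lambda>"
    and V: "V = {res_class \<O> n \<Lambda> (U *\<^sub>v c) |c. c \<in> box l \<O>}"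
    and ind: "\<And>c. c \<in> box l \<O> \<Longrightarrow> res_class \<O> n \<Lambda> (U *\<^sub>v c) = res_class \<O> n \<Lambda> (0\<^sub>v n) \<Longrightarrow> \<forall>i<l. c $ i \<in> \<MM>"
    using U unfolding res_basis_def std_lattice_box by blast+
  have Umult: "U *\<^sub>v vec l c = vec n (\<lambda>i. \<Sum>j<l. c j * col U j $ i)" for c
    using Uc by (intro eq_vecI) (auto simp: scalar_prod_sum[of "vec l c" l] mult.commute intro!: sum.cong)
  have 1: "col U j \<in> span_box \<O> B" if "j < l" for j
    using that cols Uc by (auto simp: \<Lambda> cols_def)
  have 2: "\<forall>j<l. c j \<in> \<MM>" if c: "\<And>j. j < l \<Longrightarrow> c j \<in> \<O>"
    "vec n (\<lambda>i. \<Sum>j<l. c j * col U j $ i) \<in> span_box \<MM> B" for c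
  proof -
    have carr: "U *\<^sub>v vec l c \<in> carrier_vec n" using Uc by (intro carrier_vecI) simp
    have "\<forall>i<n. (D *\<^sub>v (U *\<^sub>v vec l c)) $ i \<in> \<MM>"
      using c(2) unfolding Umult[symmetric] span_box_frame[OF B] by (simp add: box_def)
    moreover have "D *\<^sub>v 0\<^sub>v n = 0\<^sub>v n" using frameD(2)[OF B] by (intro eq_vecI) (auto simp: scalar_prod_def)
    ultimately have "res_class \<O> n \<Lambda> (U *\<^sub>v vec l c) = res_class \<O> n \<Lambda> (0\<^sub>v n)"
      unfolding \<Lambda> res_class_eq_iff[OF B carr zero_carrier_vec] by simp
    moreover have "vec l c \<in> box l \<O>" using c(1) by (simp add: box_def)
    ultimately have "\<forall>i<l. vec l c $ i \<in> \<MM>" by (intro ind)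
    then show ?thesis by simp
  qed
  from exchange[where u = "col U" and l = l, OF B 1 2] obtain B' D' \<iota> where B': "frame n B' D'" and
    span: "span_box \<O> B' = \<Lambda>" and \<iota>: "inj_on \<iota> {..<l}" "\<iota> ` {..<l} \<subseteq> {..<n}"
    and D': "\<And>j. j < l \<Longrightarrow> D' *\<^sub>v col U j = unit_vec n (\<iota> j)" unfolding \<Lambda> by blast
  have DU: "(D' *\<^sub>v (U *\<^sub>v c)) $ p = (\<Sum>j<l. if p = \<iota> j then c $ j else 0)"
    if c: "c \<in> carrier_vec l" and p: "p < n" for c p
  proof -
    have "vec l (\<lambda>j. c $ j) = c" using c by auto
    then have "U *\<^sub>v c = vec n (\<lambda>i. \<Sum>j<l. c $ j * col U j $ i)" using Umult[of "\<lambda>j. c $ j"] by simp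
    then have "(D' *\<^sub>v (U *\<^sub>v c)) $ p = (\<Sum>k<n. D' $$ (p, k) * (\<Sum>j<l. c $ j * col U j $ k))"
      using mult_mat_vec_nth[OF frameD(2)[OF B'] _ p, of "U *\<^sub>v c"] by simp
    also have "\<dots> = (\<Sum>j<l. c $ j * (\<Sum>k<n. D' $$ (p, k) * col U j $ k))"
      unfolding sum_distrib_left by (subst sum.swap) (simp add: mult_ac)
    also have "\<dots> = (\<Sum>j<l. c $ j * (D' *\<^sub>v col U j) $ p)"
      using Uc by (intro sum.cong) (auto simp: mult_mat_vec_nth[OF frameD(2)[OF B'] _ p] simp del: index_mult_mat_vec)
    also have "\<dots> = (\<Sum>j<l. if p = \<iota> j then c $ j else 0)"
      using p by (intro sum.cong) (auto simp: D' unit_vec_def simp del: index_mult_mat_vec)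
    finally show ?thesis .
  qed
  have "res_class \<O> n \<Lambda> v \<in> V \<longleftrightarrow> (\<forall>p<n. p \<notin> \<iota> ` {..<l} \<longrightarrow> (D' *\<^sub>v v) $ p \<in> \<MM>)" if v: "v \<in> \<Lambda>" for v
  proof -
    have vc: "v \<in> carrier_vec n" "\<And>p. p < n \<Longrightarrow> (D' *\<^sub>v v) $ p \<in> \<O>"
      using v unfolding span[symmetric] span_box_frame[OF B'] by (auto simp: box_def)
    have Ucc: "U *\<^sub>v c \<in> carrier_vec n" for c using Uc by (intro carrier_vecI) simp
    have eq: "res_class \<O> n \<Lambda> v = res_class \<O> n \<Lambda> (U *\<^sub>v c) \<longleftrightarrow>
      (\<forall>p<n. (D' *\<^sub>v v) $ p - (D' *\<^sub>v (U *\<^sub>v c)) $ p \<in> \<MM>)" for c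
      unfolding span[symmetric] by (rule res_class_eq_iff[OF B' vc(1) Ucc])
    show ?thesis
    proof
      assume "res_class \<O> n \<Lambda> v \<in> V"
      then obtain c where c: "c \<in> box l \<O>" "res_class \<O> n \<Lambda> v = res_class \<O> n \<Lambda> (U *\<^sub>v c)"
        unfolding V by blast
      have "(D' *\<^sub>v (U *\<^sub>v c)) $ p = 0" if "p < n" "p \<notin> \<iota> ` {..<l}" for p
      proof -
        have "(\<Sum>j<l. if p = \<iota> j then c $ j else 0) = 0" using that(2) by (intro sum.neutral) auto
        then show ?thesis using DU[of c p] c(1) that(1) by (simp add: box_def)
      qed
      then show "\<forall>p<n. p \<notin> \<iota> ` {..<l} \<longrightarrow> (D' *\<^sub>v v) $ p \<in> \<MM>" using c(2) unfolding eq by (metis diff_zero)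
    next
      assume *: "\<forall>p<n. p \<notin> \<iota> ` {..<l} \<longrightarrow> (D' *\<^sub>v v) $ p \<in> \<MM>"
      define c where "c = vec l (\<lambda>j. (D' *\<^sub>v v) $ \<iota> j)"
      have c: "c \<in> box l \<O>" using vc(2) \<iota>(2) by (auto simp: c_def box_def)
      have "(D' *\<^sub>v v) $ p - (D' *\<^sub>v (U *\<^sub>v c)) $ p \<in> \<MM>" if p: "p < n" for p
      proof (cases "p \<in> \<iota> ` {..<l}")
        case True
        then obtain j where j: "j < l" "p = \<iota> j" by auto
        have "(\<Sum>k<l. if p = \<iota> k then c $ k else 0) = (\<Sum>k<l. if k = j then c $ k else 0)"
          using j \<iota>(1) by (intro sum.cong) (auto simp: inj_on_def)
        then have "(D' *\<^sub>v (U *\<^sub>v c)) $ p = (D' *\<^sub>v v) $ p"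
          using DU[of c p] c p j by (simp add: box_def) (simp add: c_def)
        then show ?thesis by simp
      next
        case False
        then have "(\<Sum>j<l. if p = \<iota> j then c $ j else 0) = 0" by (intro sum.neutral) auto
        then have "(D' *\<^sub>v (U *\<^sub>v c)) $ p = 0" using DU[of c p] c p by (simp add: box_def)
        then show ?thesis using * p False by simp
      qed
      then show "res_class \<O> n \<Lambda> v \<in> V" unfolding V using eq[of c] c by blast
    qed
  qed
  then show ?thesis using B' span by blast
qed

end

section \<open>Values and separation\<close>

context valued_field
begin

text \<open>\<open>(a, u)\<close> with \<open>a \<noteq> 0\<close> represents the element \<open>(|a|, u)\<close> of \<open>\<Gamma> \<times> \<int>\<close>, written multiplicatively in the
  first component; \<open>lev\<close> is the lexicographic order and \<open>eqv\<close> equality of the represented elements.\<close>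

definition lev :: "'a \<times> nat \<Rightarrow> 'a \<times> nat \<Rightarrow> bool" where
  "lev x y \<longleftrightarrow> fst x / fst y \<in> \<MM> \<or> fst x / fst y \<in> \<O> \<and> snd x \<le> snd y"

definition eqv :: "'a \<times> nat \<Rightarrow> 'a \<times> nat \<Rightarrow> bool" where
  "eqv x y \<longleftrightarrow> lev x y \<and> lev y x"

definition vmul :: "'a \<times> nat \<Rightarrow> 'a \<times> nat \<Rightarrow> 'a \<times> nat" where
  "vmul x y = (fst x * fst y, snd x + snd y)"

lemma fst_vmul: "fst x \<noteq> 0 \<Longrightarrow> fst y \<noteq> 0 \<Longrightarrow> fst (vmul x y) \<noteq> 0"
  by (simp add: vmul_def)

lemma lev_refl: "fst x \<noteq> 0 \<Longrightarrow> lev x x"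
  by (simp add: lev_def)

lemma MO_mult:
  assumes "a \<in> \<MM> \<or> a \<in> \<O> \<and> p" "b \<in> \<MM> \<or> b \<in> \<O> \<and> q"
  shows "a * b \<in> \<MM> \<or> a * b \<in> \<O> \<and> p \<and> q"
  using assms O_mult[of a b] M_mult[of a b] M_mult'[of a b] M_O by blast

lemma lev_trans:
  assumes "lev x y" "lev y z" "fst y \<noteq> 0"
  shows "lev x z"
proof -
  have eq: "fst x / fst z = (fst x / fst y) * (fst y / fst z)" using assms(3) by simp
  show ?thesis
    using MO_mult[OF assms(1,2)[unfolded lev_def]] unfolding lev_def eq by linarith
qed

lemma lev_total:
  assumes "fst x \<noteq> 0" "fst y \<noteq> 0"
  shows "lev x y \<or> lev y x"
  using assms O_total[of "fst x / fst y"] unfolding lev_def mem_M by auto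

lemma lev_vmul:
  assumes "lev x y" "lev x' y'"
  shows "lev (vmul x x') (vmul y y')"
proof -
  have eq: "fst (vmul x x') / fst (vmul y y') = (fst x / fst y) * (fst x' / fst y')"
    by (simp add: vmul_def)
  show ?thesis
    using MO_mult[OF assms[unfolded lev_def]] unfolding lev_def eq by (auto simp: vmul_def)
qed

lemma lev_cancel: "fst z \<noteq> 0 \<Longrightarrow> lev (vmul z x) (vmul z y) \<longleftrightarrow> lev x y"
  by (simp add: lev_def vmul_def)

lemma eqv_cancel: "fst z \<noteq> 0 \<Longrightarrow> eqv (vmul z x) (vmul z y) \<longleftrightarrow> eqv x y"
  by (simp add: eqv_def lev_cancel)

lemma eqv_sym: "eqv x y \<Longrightarrow> eqv y x"
  by (simp add: eqv_def)

lemma eqv_trans: "eqv x y \<Longrightarrow> eqv y z \<Longrightarrow> fst y \<noteq> 0 \<Longrightarrow> eqv x z"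
  unfolding eqv_def using lev_trans by blast

lemma vmul_comm: "vmul x y = vmul y x"
  by (simp add: vmul_def)

lemma vmul_assoc: "vmul (vmul x y) z = vmul x (vmul y z)"
  by (simp add: vmul_def)

lemma eqv_iff:
  assumes "fst x \<noteq> 0" "fst y \<noteq> 0"
  shows "eqv x y \<longleftrightarrow> fst x / fst y \<in> \<O> \<and> fst y / fst x \<in> \<O> \<and> snd x = snd y"
  using assms unfolding eqv_def lev_def mem_M by auto

definition vpow :: "'a \<times> nat \<Rightarrow> nat \<Rightarrow> 'a \<times> nat" where
  "vpow x k = (fst x ^ k, k * snd x)"

lemma fst_vpow: "fst x \<noteq> 0 \<Longrightarrow> fst (vpow x k) \<noteq> 0"
  by (simp add: vpow_def)

lemma vpow_add: "vpow x (k + m) = vmul (vpow x k) (vpow x m)"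
  by (simp add: vpow_def vmul_def power_add distrib_right)

lemma O_power: "x \<in> \<O> \<Longrightarrow> x ^ k \<in> \<O>"
  by (induction k) (auto intro: O_mult)

lemma M_power: "x \<in> \<MM> \<Longrightarrow> 0 < k \<Longrightarrow> x ^ k \<in> \<MM>"
  by (cases k) (auto intro!: M_mult O_power dest: M_O)

text \<open>The value group is torsion free: for \<open>x\<close> outside \<O>, the power of its
  inverse would lie in \<MM>, so \<open>x ^ k\<close> could not be integral.\<close>

lemma O_powerD:
  assumes "x ^ k \<in> \<O>" "0 < k"
  shows "x \<in> \<O>"
proof (rule ccontr)
  assume x: "x \<notin> \<O>"
  then have "inverse x ^ k \<in> \<MM>" using M_power[OF notin_O] assms(2) by blast
  moreover have "x \<noteq> 0" using x by auto
  ultimately show False using assms(1) by (simp add: mem_M power_inverse)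
qed

lemma eqv_vpow_cancel:
  assumes "fst x \<noteq> 0" "fst y \<noteq> 0" "0 < k" "eqv (vpow x k) (vpow y k)"
  shows "eqv x y"
  using assms(3,4) O_powerD[of "fst x / fst y" k] O_powerD[of "fst y / fst x" k]
  unfolding eqv_iff[OF assms(1,2)] eqv_iff[OF fst_vpow[OF assms(1)] fst_vpow[OF assms(2)]]
  by (simp add: vpow_def power_divide)

section \<open>Products of values and their separation\<close>

definition vprod :: "('b \<Rightarrow> 'a \<times> nat) \<Rightarrow> 'b list \<Rightarrow> 'a \<times> nat" where
  "vprod v xs = (prod_list (map (\<lambda>x. fst (v x)) xs), sum_list (map (\<lambda>x. snd (v x)) xs))"

lemma vprod_simps [simp]:
  "vprod v [] = (1, 0)" "vprod v (x # xs) = vmul (v x) (vprod v xs)"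
  "vprod v (xs @ ys) = vmul (vprod v xs) (vprod v ys)"
  by (auto simp: vprod_def vmul_def)

lemma vprod_mset: "mset xs = mset ys \<Longrightarrow> vprod v xs = vprod v ys"
  unfolding vprod_def prod_mset_prod_list[symmetric] sum_mset_sum_list[symmetric] mset_map by simp

lemma fst_vprod: "(\<And>x. x \<in> set xs \<Longrightarrow> fst (v x) \<noteq> 0) \<Longrightarrow> fst (vprod v xs) \<noteq> 0"
  by (auto simp: vprod_def prod_list_zero_iff)

lemma vprod_replicate: "vprod v (concat (replicate k gs)) = vpow (vprod v gs) k"
proof (induction k)
  case (Suc k)
  then show ?case using vpow_add[of "vprod v gs" 1 k] by (simp add: vpow_def)
qed (simp add: vpow_def)

text \<open>The recursion follows \<open>separating_list\<close>: each ordered pair of the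
  \<open>r + 1\<close> indices rules out at most one exponent, so some exponent of at most
  \<open>(r + 1)^2\<close> is allowed, and one more factor is appended.\<close>

fun sep_bound :: "nat \<Rightarrow> nat" where
  "sep_bound 0 = 0"
| "sep_bound (Suc r) = Suc (Suc (Suc r * Suc r) * sep_bound r)"

lemma sep_bound_mono: "r \<le> r' \<Longrightarrow> sep_bound r \<le> sep_bound r'"
proof (induction r' rule: dec_induct)
  case (step m)
  have "sep_bound m \<le> sep_bound (Suc m)" by (simp add: trans_le_add1 algebra_simps)
  then show ?case using step by linarith
qed simp

text \<open>If \<open>gs\<close> separates all of \<open>J\<close> but not \<open>j\<close> from \<open>i\<close>, then \<open>gs\<^sup>a h\<close> with \<open>h\<close> separating \<open>i\<close>
  from \<open>j\<close> works for all but finitely many \<open>a\<close>, as the value group is torsion free.\<close>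

lemma separating_list:
  fixes v :: "'i \<Rightarrow> 'h \<Rightarrow> 'a \<times> nat"
  assumes "finite J" and nz: "\<And>j h. j \<in> J \<Longrightarrow> h \<in> H \<Longrightarrow> fst (v j h) \<noteq> 0"
    and sep: "\<And>i j. i \<in> J \<Longrightarrow> j \<in> J \<Longrightarrow> i \<noteq> j \<Longrightarrow> \<exists>h\<in>H. \<not> eqv (v i h) (v j h)"
  shows "\<exists>gs. set gs \<subseteq> H \<and> length gs \<le> sep_bound (card J) \<and>
    (\<forall>i\<in>J. \<forall>j\<in>J. i \<noteq> j \<longrightarrow> \<not> eqv (vprod (v i) gs) (vprod (v j) gs))"
  using assms
proof (induction J)
  case empty
  then show ?case by (intro exI[of _ "[]"]) simp
next
  case (insert j J)
  then obtain gs where gs: "set gs \<subseteq> H" "length gs \<le> sep_bound (card J)"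
    "\<And>i i'. i \<in> J \<Longrightarrow> i' \<in> J \<Longrightarrow> i \<noteq> i' \<Longrightarrow> \<not> eqv (vprod (v i) gs) (vprod (v i') gs)"
    by (metis insertCI)
  let ?J = "insert j J"
  let ?x = "\<lambda>i. vprod (v i) gs"
  have nzx: "fst (?x i) \<noteq> 0" if "i \<in> ?J" for i
    using that insert.prems(1) gs(1) by (intro fst_vprod) blast
  have card: "card ?J = Suc (card J)" using insert.hyps by simp
  show ?case
  proof (cases "\<exists>i\<in>J. eqv (?x i) (?x j)")
    case False
    then have "\<forall>i\<in>?J. \<forall>i'\<in>?J. i \<noteq> i' \<longrightarrow> \<not> eqv (?x i) (?x i')"
      using gs(3) eqv_sym by blast
    moreover have "length gs \<le> sep_bound (card ?J)"
      using gs(2) sep_bound_mono[of "card J" "card ?J"] card by simp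
    ultimately show ?thesis using gs(1) by blast
  next
    case True
    then obtain i0 where i0: "i0 \<in> J" "eqv (?x i0) (?x j)" by blast
    have "i0 \<noteq> j" using i0 insert.hyps by blast
    then obtain h where h: "h \<in> H" "\<not> eqv (v i0 h) (v j h)"
      using insert.prems(2)[of i0 j] i0(1) by blast
    let ?y = "\<lambda>i. v i h"
    \<comment> \<open>The exponents to avoid for a pair of indices that \<open>gs\<close> already
      separates.\<close>
    define bad where "bad p a \<longleftrightarrow> eqv (vmul (vpow (?x (fst p)) a) (?y (fst p))) (vmul (vpow (?x (snd p)) a) (?y (snd p)))"
      for p a
    define P where "P = {p \<in> ?J \<times> ?J. \<not> eqv (?x (fst p)) (?x (snd p))}"
    have nzy: "fst (?y i) \<noteq> 0" if "i \<in> ?J" for i using that insert.prems(1) h(1) by blast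
    \<comment> \<open>For two bad exponents \<open>a < b\<close>, dividing out the common part
      leaves equivalent powers with exponent \<open>b - a\<close>, and
      \<open>eqv_vpow_cancel\<close> contradicts the choice of \<open>p\<close>.\<close>
    have unique: "a = b" if p: "p \<in> P" and ab: "bad p a" "bad p b" for p a b
    proof -
      have False if ab: "a < b" "bad p a" "bad p b" for a b
      proof -
        obtain i i' where p': "p = (i, i')" "i \<in> ?J" "i' \<in> ?J" "\<not> eqv (?x i) (?x i')"
          using p by (auto simp: P_def)
        define e where "e = b - a"
        have e: "0 < e" "b = e + a" using ab(1) by (auto simp: e_def)
        let ?A = "vmul (vpow (?x i) a) (?y i)" and ?A' = "vmul (vpow (?x i') a) (?y i')"
        have A: "eqv ?A ?A'" using ab(2) by (simp add: bad_def p')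
        have A0: "fst ?A \<noteq> 0" "fst ?A' \<noteq> 0"
          using fst_vmul[OF fst_vpow[OF nzx] nzy] p'(2,3) by blast+
        have E0: "fst (vpow (?x i) e) \<noteq> 0" "fst (vpow (?x i') e) \<noteq> 0"
          using fst_vpow[OF nzx] p'(2,3) by blast+
        have "eqv (vmul (vpow (?x i) e) ?A) (vmul (vpow (?x i') e) ?A')"
          using ab(3) by (simp add: bad_def p' e(2) vpow_add vmul_assoc)
        moreover have "eqv (vmul (vpow (?x i') e) ?A') (vmul (vpow (?x i') e) ?A)"
          using A E0(2) by (simp add: eqv_cancel eqv_sym)
        ultimately have "eqv (vmul (vpow (?x i) e) ?A) (vmul (vpow (?x i') e) ?A)"
          using eqv_trans fst_vmul[OF E0(2) A0(2)] by blast
        then have "eqv (vpow (?x i) e) (vpow (?x i') e)"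
          using eqv_cancel[OF A0(1)] by (simp add: vmul_comm[of _ ?A])
        then have "eqv (?x i) (?x i')" using eqv_vpow_cancel[OF nzx nzx e(1)] p'(2,3) by blast
        then show False using p'(4) by blast
      qed
      then show ?thesis using ab by (meson linorder_neqE_nat)
    qed
    \<comment> \<open>Where no bad exponent exists, \<open>THE\<close> yields an arbitrary number;
      excluding it as well does no harm to the count.\<close>
    define f where "f p = (THE a. bad p a)" for p
    have f: "f p = a" if "p \<in> P" "bad p a" for p a
      unfolding f_def using that unique[OF that(1)] by blast
    have finP: "finite P" using insert.hyps by (simp add: P_def)
    have "card (f ` P) \<le> card P" by (rule card_image_le[OF finP])
    also have "\<dots> \<le> card (?J \<times> ?J)"
      by (rule card_mono) (use insert.hyps(1) in \<open>unfold P_def, blast+\<close>)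
    also have "\<dots> = card ?J * card ?J" by (rule card_cartesian_product)
    also have "\<dots> < card {..card ?J * card ?J}" by simp
    \<comment> \<open>There is one more exponent from 0 to the square of \<open>card ?J\<close> than
      there are pairs of indices, so one is hit by no \<open>f p\<close>.\<close>
    finally have "\<not> {..card ?J * card ?J} \<subseteq> f ` P"
      using card_mono[of "f ` P" "{..card ?J * card ?J}"] finP by (metis finite_imageI not_less)
    then obtain a where a: "a \<le> card ?J * card ?J" "a \<notin> f ` P" by auto
    define gs' where "gs' = concat (replicate a gs) @ [h]"
    have gs': "vprod (v i) gs' = vmul (vpow (?x i) a) (?y i)" for i
      by (simp add: gs'_def vprod_replicate vmul_def)
    have "\<not> eqv (vprod (v i) gs') (vprod (v i') gs')" if i: "i \<in> ?J" "i' \<in> ?J" "i \<noteq> i'" for i i'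
    proof
      assume e: "eqv (vprod (v i) gs') (vprod (v i') gs')"
      show False
      proof (cases "eqv (?x i) (?x i')")
        case False
        then have "(i, i') \<in> P" using i unfolding P_def by simp blast
        moreover have "bad (i, i') a" using e by (simp add: bad_def gs')
        ultimately show False using f a(2) by blast
      next
        case True
        \<comment> \<open>\<open>gs\<close> separates the old indices from each other, so the only
          one it can confuse with \<open>j\<close> is \<open>i0\<close>; there the powers are
          equivalent and \<open>h\<close> decides.\<close>
        have key: False if "i1 \<in> J" "eqv (?x i1) (?x j)" "eqv (vprod (v i1) gs') (vprod (v j) gs')" for i1
        proof -
          have "eqv (?x i1) (?x i0)"
            using eqv_trans[OF that(2) eqv_sym[OF i0(2)]] nzx by blast
          then have "i1 = i0" using gs(3) that(1) i0(1) by blast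
          have pw: "eqv (vpow z a) (vpow z' a)" if "eqv z z'" "fst z \<noteq> 0" "fst z' \<noteq> 0" for z z'
            using that(1) O_power[of "fst z / fst z'" a] O_power[of "fst z' / fst z" a]
            unfolding eqv_iff[OF that(2,3)] eqv_iff[OF fst_vpow[OF that(2)] fst_vpow[OF that(3)]]
            by (simp add: vpow_def power_divide)
          have J0: "i0 \<in> ?J" "j \<in> ?J" using i0 by auto
          have pw0: "eqv (vpow (?x j) a) (vpow (?x i0) a)"
            by (rule pw[OF eqv_sym[OF i0(2)] nzx nzx]) (use J0 in auto)
          have "eqv (vmul (vpow (?x j) a) (?y j)) (vmul (vpow (?x i0) a) (?y j))"
            using eqv_cancel[OF nzy[OF J0(2)]] pw0 by (simp add: vmul_comm[of _ "?y j"])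
          with that(3) have "eqv (vmul (vpow (?x i0) a) (?y i0)) (vmul (vpow (?x i0) a) (?y j))"
            unfolding gs' \<open>i1 = i0\<close>
            using eqv_trans fst_vmul[OF fst_vpow[OF nzx[OF J0(2)]] nzy[OF J0(2)]] by blast
          then show False using h(2) eqv_cancel[OF fst_vpow[OF nzx[OF J0(1)]]] by blast
        qed
        show False
        proof (cases "i = j \<or> i' = j")
          case True
          then show False
            using key[of i] key[of i'] i \<open>eqv (?x i) (?x i')\<close> e eqv_sym by (metis insertE)
        next
          case False
          then show False using gs(3)[of i i'] i \<open>eqv (?x i) (?x i')\<close> by blast
        qed
      qed
    qed
    moreover have "set gs' \<subseteq> H" using gs(1) h(1) by (auto simp: gs'_def)
    moreover have "length gs' \<le> sep_bound (card ?J)"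
    proof -
      have "length gs' = Suc (a * length gs)"
        by (simp add: gs'_def length_concat sum_list_replicate)
      also have "\<dots> \<le> Suc (Suc (card ?J * card ?J) * sep_bound (card J))"
        using mult_le_mono[of a "Suc (card ?J * card ?J)" "length gs" "sep_bound (card J)"] a(1) gs(2) by simp
      finally show ?thesis unfolding card by simp
    qed
    ultimately show ?thesis by blast
  qed
qed

text \<open>Selection sort: \<open>lev\<close> is only a preorder, total among pairs with nonzero
  first entry, so a largest element is split off repeatedly.\<close>

lemma ex_sorted_list:
  assumes "\<And>x. x \<in># X \<Longrightarrow> fst (v x) \<noteq> 0"
  shows "\<exists>xs. mset xs = X \<and> sorted_wrt (\<lambda>x y. lev (v y) (v x)) xs"
  using assms
proof (induction "size X" arbitrary: X)
  case 0
  then show ?case by (intro exI[of _ "[]"]) simp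
next
  case (Suc m)
  have "\<exists>x\<in>#X. \<forall>y\<in>#X. lev (v y) (v x)" if "X \<noteq> {#}" "\<forall>x\<in>#X. fst (v x) \<noteq> 0" for X
    using that
  proof (induction X)
    case (add z X)
    show ?case
    proof (cases "X = {#}")
      case True
      then show ?thesis using add.prems lev_refl by simp
    next
      case False
      then obtain x where x: "x \<in># X" "\<forall>y\<in>#X. lev (v y) (v x)" using add by auto
      show ?thesis
      proof (cases "lev (v z) (v x)")
        case True
        then show ?thesis using x by auto
      next
        case False
        then have "lev (v x) (v z)" using lev_total[of "v z" "v x"] add.prems x(1) by simp
        then have "\<forall>y\<in>#add_mset z X. lev (v y) (v z)"
          using x add.prems lev_trans lev_refl by (metis insert_iff set_mset_add_mset_insert)
        then show ?thesis by auto
      qed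
    qed
  qed simp
  then obtain x where x: "x \<in># X" "\<forall>y\<in>#X. lev (v y) (v x)"
    using Suc by (metis size_empty nat.distinct(1))
  obtain X' where X': "X = add_mset x X'" using x(1) by (metis multi_member_split)
  then obtain xs where "mset xs = X'" "sorted_wrt (\<lambda>x y. lev (v y) (v x)) xs"
    using Suc.hyps(1)[of X'] Suc.hyps(2) Suc.prems by auto
  then show ?case using x X' by (intro exI[of _ "x # xs"]) auto
qed

text \<open>Greedy exchange: either the head \<open>x\<close> occurs in \<open>ys\<close> and is
  split off, or it replaces an entry of \<open>ys\<close>, which cannot decrease the product. So an
  initial segment of a decreasing list gives the largest product of its length.\<close>

lemma lev_vprod_take:
  assumes "\<And>x. x \<in> set xs \<Longrightarrow> fst (v x) \<noteq> 0" "sorted_wrt (\<lambda>x y. lev (v y) (v x)) xs" "mset ys \<subseteq># mset xs"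
  shows "lev (vprod v ys) (vprod v (take (length ys) xs))"
  using assms
proof (induction xs arbitrary: ys)
  case Nil
  then show ?case using lev_refl by simp
next
  case (Cons x xs)
  show ?case
  proof (cases "ys = []")
    case True
    then show ?thesis using lev_refl by simp
  next
    case False
    obtain y zs where yz: "mset ys = mset (y # zs)" "mset zs \<subseteq># mset xs" "lev (v y) (v x)"
    proof (cases "x \<in> set ys")
      case True
      then have "mset ys = mset (x # remove1 x ys)" by simp
      moreover have "mset (remove1 x ys) \<subseteq># mset xs"
        using Cons.prems(3) by (simp add: subset_eq_diff_conv)
      ultimately show ?thesis using that[of x "remove1 x ys"] Cons.prems(1)[of x] lev_refl[of "v x"] by simp
    next
      case False
      then have sub: "mset ys \<subseteq># mset xs"
        using Cons.prems(3) subset_eq_diff_conv[of "mset ys" "{#x#}" "mset xs"]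
        by (simp add: diff_single_trivial)
      obtain y zs where yz: "ys = y # zs" using \<open>ys \<noteq> []\<close> by (cases ys) auto
      have "y \<in> set xs" using sub yz by (metis list.set_intros(1) mset_subset_eqD set_mset_mset)
      moreover have "mset zs \<subseteq># mset xs" using sub subset_mset.order_trans[of "mset zs" "mset ys"] by (simp add: yz)
      ultimately show ?thesis using that yz Cons.prems(2) by simp
    qed
    have "lev (vprod v zs) (vprod v (take (length zs) xs))"
      using Cons yz(2) by simp
    then have "lev (vmul (v y) (vprod v zs)) (vmul (v x) (vprod v (take (length zs) xs)))"
      using yz(3) lev_vmul by blast
    moreover have "vprod v ys = vmul (v y) (vprod v zs)" using vprod_mset[OF yz(1)] by simp
    moreover have "length ys = Suc (length zs)" using yz(1) by (metis length_Cons mset_eq_length)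
    ultimately show ?thesis by simp
  qed
qed

end

section \<open>Tensor powers\<close>

lemma digit_low:
  fixes n :: nat
  assumes "p < q" "0 < n"
  shows "(i * n ^ q + y) div n ^ p mod n = y div n ^ p mod n"
proof -
  have q: "q = p + Suc (q - Suc p)" using assms(1) by simp
  have "i * n ^ q = (i * n ^ (q - Suc p) * n) * n ^ p"
    by (subst q) (simp add: power_add mult_ac)
  then have "(i * n ^ q + y) div n ^ p = (y + (i * n ^ (q - Suc p) * n) * n ^ p) div n ^ p"
    by (simp only: add.commute)
  also have "\<dots> = i * n ^ (q - Suc p) * n + y div n ^ p"
    using assms(2) by (intro div_mult_self1) simp
  finally have "(i * n ^ q + y) div n ^ p = i * n ^ (q - Suc p) * n + y div n ^ p" .
  then show ?thesis by simp
qed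

text \<open>The distributive law: a choice of one summand from each of the \<open>q\<close> sums is
  the digit string of a number below \<open>n ^ q\<close>.\<close>

lemma sum_prod_digits:
  fixes F :: "nat \<Rightarrow> nat \<Rightarrow> 'a::comm_semiring_1"
  shows "(\<Sum>x<n ^ q. \<Prod>p<q. F p (x div n ^ p mod n)) = (\<Prod>p<q. \<Sum>i<n. F p i)"
proof (induction q)
  case 0
  then show ?case by (simp add: lessThan_Suc)
next
  case (Suc q)
  show ?case
  proof (cases "n = 0")
    case True
    then show ?thesis by simp
  next
    case n: False
    have low: "(\<Prod>p<q. F p ((i * n ^ q + y) div n ^ p mod n)) = (\<Prod>p<q. F p (y div n ^ p mod n))" for i y
      using n by (intro prod.cong refl) (simp add: digit_low)
    have "(\<Sum>x<n ^ Suc q. \<Prod>p<Suc q. F p (x div n ^ p mod n)) =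
      (\<Sum>i<n. \<Sum>x\<in>{i * n ^ q..<i * n ^ q + n ^ q}. \<Prod>p<Suc q. F p (x div n ^ p mod n))"
      by (simp add: sum.nat_group mult.commute)
    also have "\<dots> = (\<Sum>i<n. \<Sum>y<n ^ q. \<Prod>p<Suc q. F p ((i * n ^ q + y) div n ^ p mod n))"
    proof (rule sum.cong[OF refl])
      fix i
      show "(\<Sum>x\<in>{i * n ^ q..<i * n ^ q + n ^ q}. \<Prod>p<Suc q. F p (x div n ^ p mod n)) =
        (\<Sum>y<n ^ q. \<Prod>p<Suc q. F p ((i * n ^ q + y) div n ^ p mod n))"
        by (rule sum.reindex_bij_witness[of _ "\<lambda>y. i * n ^ q + y" "\<lambda>x. x - i * n ^ q"]) auto
    qed
    also have "\<dots> = (\<Sum>i<n. \<Sum>y<n ^ q. (\<Prod>p<q. F p (y div n ^ p mod n)) * F q i)"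
      using n by (intro sum.cong refl) (simp add: low)
    also have "\<dots> = (\<Prod>p<Suc q. \<Sum>i<n. F p i)"
      by (simp add: sum_distrib_right[symmetric] sum_distrib_left[symmetric] Suc)
    finally show ?thesis .
  qed
qed

lemma digits_inject:
  fixes n :: nat
  assumes "x < n ^ q" "z < n ^ q" "\<And>p. p < q \<Longrightarrow> x div n ^ p mod n = z div n ^ p mod n"
  shows "x = z"
proof -
  have "x mod n ^ r = z mod n ^ r" if "r \<le> q" for r
    using that
  proof (induction r)
    case (Suc r)
    then show ?case using assms(3)[of r] by (simp add: mod_mult2_eq mult.commute[of n])
  qed simp
  from this[of q] show ?thesis using assms(1,2) by simp
qed

text \<open>The coordinates of \<open>(K\<^sup>n)\<^sup>\<otimes>\<^sup>q\<close> are indexed by the numbers below \<open>n ^ q\<close> through their base \<open>n\<close> digits.\<close>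

definition tens :: "nat \<Rightarrow> nat \<Rightarrow> (nat \<Rightarrow> 'a::comm_semiring_1 vec) \<Rightarrow> 'a vec" where
  "tens n q g = vec (n ^ q) (\<lambda>x. \<Prod>p<q. g p $ (x div n ^ p mod n))"

lemma tens_carrier [simp]: "tens n q g \<in> carrier_vec (n ^ q)"
  by (simp add: tens_def)

lemma tens_scalar_prod:
  fixes g h :: "nat \<Rightarrow> 'a::comm_ring_1 vec"
  assumes "\<And>p. p < q \<Longrightarrow> h p \<in> carrier_vec n"
  shows "tens n q g \<bullet> tens n q h = (\<Prod>p<q. g p \<bullet> h p)"
proof -
  have "tens n q g \<bullet> tens n q h =
    (\<Sum>x<n ^ q. \<Prod>p<q. g p $ (x div n ^ p mod n) * h p $ (x div n ^ p mod n))"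
    by (simp add: tens_def scalar_prod_def atLeast0LessThan prod.distrib)
  also have "\<dots> = (\<Prod>p<q. \<Sum>i<n. g p $ i * h p $ i)" by (rule sum_prod_digits)
  also have "\<dots> = (\<Prod>p<q. g p \<bullet> h p)"
    using assms by (intro prod.cong refl) (simp add: scalar_prod_sum[of _ n])
  finally show ?thesis .
qed

text \<open>The Kronecker product. Its rows and columns are pure tensors, so tensoring frames gives
  a frame whose dual basis again consists of pure tensors.\<close>

definition tens_mat :: "nat \<Rightarrow> nat \<Rightarrow> (nat \<Rightarrow> 'a::comm_semiring_1 mat) \<Rightarrow> 'a mat" where
  "tens_mat n q B = mat (n ^ q) (n ^ q) (\<lambda>(x, y). \<Prod>p<q. B p $$ (x div n ^ p mod n, y div n ^ p mod n))"

lemma digit_less: "x < n ^ q \<Longrightarrow> p < q \<Longrightarrow> x div n ^ p mod n < n" for n :: nat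
  by (cases "n = 0") (auto simp: power_0_left split: if_splits)

lemma tens_mat_mult:
  fixes B D :: "nat \<Rightarrow> 'a::comm_ring_1 mat"
  assumes "\<And>p. p < q \<Longrightarrow> B p \<in> carrier_mat n n \<and> D p \<in> carrier_mat n n \<and> B p * D p = 1\<^sub>m n"
  shows "tens_mat n q B * tens_mat n q D = 1\<^sub>m (n ^ q)"
proof (rule eq_matI)
  fix x z assume "x < dim_row (1\<^sub>m (n ^ q) :: 'a mat)" "z < dim_col (1\<^sub>m (n ^ q) :: 'a mat)"
  then have xz: "x < n ^ q" "z < n ^ q" by auto
  have "(tens_mat n q B * tens_mat n q D) $$ (x, z) =
    (\<Sum>y<n ^ q. \<Prod>p<q. B p $$ (x div n ^ p mod n, y div n ^ p mod n) * D p $$ (y div n ^ p mod n, z div n ^ p mod n))"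
    using xz by (simp add: tens_mat_def scalar_prod_def atLeast0LessThan prod.distrib)
  also have "\<dots> = (\<Prod>p<q. \<Sum>i<n. B p $$ (x div n ^ p mod n, i) * D p $$ (i, z div n ^ p mod n))"
    by (rule sum_prod_digits)
  also have "\<dots> = (\<Prod>p<q. (1\<^sub>m n :: 'a mat) $$ (x div n ^ p mod n, z div n ^ p mod n))"
  proof (intro prod.cong refl)
    fix p assume "p \<in> {..<q}"
    then have p: "p < q" by simp
    have d: "x div n ^ p mod n < n" "z div n ^ p mod n < n" using digit_less p xz by blast+
    have c: "B p \<in> carrier_mat n n" "D p \<in> carrier_mat n n" "B p * D p = 1\<^sub>m n" using assms[OF p] by auto
    have "(B p * D p) $$ (x div n ^ p mod n, z div n ^ p mod n) =
      (\<Sum>i<n. B p $$ (x div n ^ p mod n, i) * D p $$ (i, z div n ^ p mod n))"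
      using c(1,2) d by (auto simp: scalar_prod_def atLeast0LessThan simp del: mod_less_divisor)
    then show "(\<Sum>i<n. B p $$ (x div n ^ p mod n, i) * D p $$ (i, z div n ^ p mod n)) =
      (1\<^sub>m n :: 'a mat) $$ (x div n ^ p mod n, z div n ^ p mod n)" using c(3) by simp
  qed
  also have "\<dots> = (\<Prod>p<q. if x div n ^ p mod n = z div n ^ p mod n then 1 else 0)"
    using digit_less xz by (intro prod.cong) auto
  also have "\<dots> = (1\<^sub>m (n ^ q) :: 'a mat) $$ (x, z)"
  proof (cases "x = z")
    case False
    then obtain p where "p < q" "x div n ^ p mod n \<noteq> z div n ^ p mod n" using digits_inject[OF xz] by blast
    then have "(\<Prod>p<q. if x div n ^ p mod n = z div n ^ p mod n then 1 else 0) = (0::'a)"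
      by (intro prod_zero) auto
    then show ?thesis using False xz by simp
  qed (use xz in simp)
  finally show "(tens_mat n q B * tens_mat n q D) $$ (x, z) = (1\<^sub>m (n ^ q) :: 'a mat) $$ (x, z)" .
qed (auto simp: tens_mat_def)

lemma frame_tens_mat:
  assumes "\<And>p. p < q \<Longrightarrow> frame n (B p) (D p)"
  shows "frame (n ^ q) (tens_mat n q B) (tens_mat n q D)"
  using tens_mat_mult[of q B n D] tens_mat_mult[of q D n B] frameD(1-4)[OF assms]
  unfolding frame_def by (auto simp: tens_mat_def)

lemma tens_mat_col:
  assumes "\<And>p. p < q \<Longrightarrow> B p \<in> carrier_mat n n" "y < n ^ q"
  shows "col (tens_mat n q B) y = tens n q (\<lambda>p. col (B p) (y div n ^ p mod n))"
proof (rule eq_vecI)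
  fix x assume "x < dim_vec (tens n q (\<lambda>p. col (B p) (y div n ^ p mod n)))"
  then have x: "x < n ^ q" by (simp add: tens_def)
  have "B p $$ (x div n ^ p mod n, y div n ^ p mod n) = col (B p) (y div n ^ p mod n) $ (x div n ^ p mod n)"
    if "p < q" for p
    using assms(1)[OF that] digit_less[OF x that] digit_less[OF assms(2) that] by simp
  then show "col (tens_mat n q B) y $ x = tens n q (\<lambda>p. col (B p) (y div n ^ p mod n)) $ x"
    using x assms(2) by (auto simp: tens_mat_def tens_def intro!: prod.cong)
qed (simp add: tens_mat_def tens_def)

lemma tens_mat_row:
  assumes "\<And>p. p < q \<Longrightarrow> D p \<in> carrier_mat n n" "x < n ^ q"
  shows "row (tens_mat n q D) x = tens n q (\<lambda>p. row (D p) (x div n ^ p mod n))"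
proof (rule eq_vecI)
  fix y assume "y < dim_vec (tens n q (\<lambda>p. row (D p) (x div n ^ p mod n)))"
  then have y: "y < n ^ q" by (simp add: tens_def)
  have "D p $$ (x div n ^ p mod n, y div n ^ p mod n) = row (D p) (x div n ^ p mod n) $ (y div n ^ p mod n)"
    if "p < q" for p
    using assms(1)[OF that] digit_less[OF y that] digit_less[OF assms(2) that] by simp
  then show "row (tens_mat n q D) x $ y = tens n q (\<lambda>p. row (D p) (x div n ^ p mod n)) $ y"
    using y assms(2) by (auto simp: tens_mat_def tens_def intro!: prod.cong)
qed (simp add: tens_mat_def tens_def)

section \<open>Dual lattices and the values of a pair\<close>

context valued_field
begin

text \<open>The dual lattice, with \<open>K^n\<close> paired with itself by the scalar product. It
  describes norms without a basis: the norm of \<open>h\<close> is the largest absolute value of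
  \<open>g \<bullet> h\<close> for \<open>g\<close> in the dual.\<close>

definition dual :: "nat \<Rightarrow> 'a vec set \<times> 'a vec set set \<Rightarrow> 'a vec set" where
  "dual n x = {g \<in> carrier_vec n. \<forall>v\<in>fst x. g \<bullet> v \<in> \<O>}"

text \<open>The lift to the dual lattice of the annihilator of the subspace in the dual of the
  reduction.\<close>

definition annihilator :: "nat \<Rightarrow> 'a vec set \<times> 'a vec set set \<Rightarrow> 'a vec set" where
  "annihilator n x = {g \<in> dual n x. \<forall>v\<in>fst x. res_class \<O> n (fst x) v \<in> snd x \<longrightarrow> g \<bullet> v \<in> \<MM>}"

text \<open>The rows of \<open>D\<close> are the basis dual to the columns of \<open>B\<close>, and
  by \<open>adapted_frame\<close> those with index outside \<open>J\<close> vanish on the subspace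
  modulo \<MM>.\<close>

lemma dual_adapted_frame:
  assumes "x \<in> R_set \<O> n l"
  obtains B D J where "frame n B D" "fst x = span_box \<O> B"
    "\<And>v. v \<in> fst x \<Longrightarrow> res_class \<O> n (fst x) v \<in> snd x \<longleftrightarrow> (\<forall>p<n. p \<notin> J \<longrightarrow> (D *\<^sub>v v) $ p \<in> \<MM>)"
    "\<And>p. p < n \<Longrightarrow> row D p \<in> dual n x" "\<And>p. p < n \<Longrightarrow> p \<notin> J \<Longrightarrow> row D p \<in> annihilator n x"
    "\<And>p. p < n \<Longrightarrow> col B p \<in> fst x"
proof -
  obtain B D J where B: "frame n B D" and x: "fst x = span_box \<O> B"
    and J: "\<forall>v\<in>fst x. res_class \<O> n (fst x) v \<in> snd x \<longleftrightarrow> (\<forall>p<n. p \<notin> J \<longrightarrow> (D *\<^sub>v v) $ p \<in> \<MM>)"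
    using adapted_frame[of "fst x" "snd x" n l] assms unfolding prod.collapse by blast
  have D: "D \<in> carrier_mat n n" by (rule frameD(2)[OF B])
  have row: "row D p \<in> carrier_vec n" "row D p \<bullet> v = (D *\<^sub>v v) $ p" if "p < n" for p v
    using that D by auto
  have 1: "row D p \<in> dual n x" if "p < n" for p
    using row[OF that] that unfolding dual_def x by (auto simp: box_def span_box_frame[OF B])
  have 2: "row D p \<in> annihilator n x" if "p < n" "p \<notin> J" for p
    using 1[OF that(1)] J row(2)[OF that(1)] that unfolding annihilator_def by auto
  have "col B p \<in> fst x" if "p < n" for p
  proof -
    have "D *\<^sub>v col B p = unit_vec n p"
      using frameD(4)[OF B] col_mult2[OF frameD(2,1)[OF B] that] that by simp
    moreover have "unit_vec n p \<in> box n \<O>" by (auto simp: box_def unit_vec_def)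
    ultimately show ?thesis
      unfolding x span_box_frame[OF B] using frameD(1)[OF B] by auto
  qed
  then show ?thesis using that[OF B x _ 1 2] J by blast
qed

text \<open>Biduality: the coordinates of \<open>v\<close> in a lattice basis are its pairings with
  the rows of \<open>D\<close>, which lie in the dual.\<close>

lemma mem_lattice_iff_dual:
  assumes "x \<in> R_set \<O> n l" "v \<in> carrier_vec n"
  shows "v \<in> fst x \<longleftrightarrow> (\<forall>g\<in>dual n x. g \<bullet> v \<in> \<O>)"
proof -
  obtain B D J where B: "frame n B D" "fst x = span_box \<O> B" "\<And>p. p < n \<Longrightarrow> row D p \<in> dual n x"
    using dual_adapted_frame[OF assms(1)] by metis
  have "v \<in> fst x" if "\<forall>g\<in>dual n x. g \<bullet> v \<in> \<O>"
  proof -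
    have "(D *\<^sub>v v) $ p \<in> \<O>" if p: "p < n" for p
      using \<open>\<forall>g\<in>dual n x. g \<bullet> v \<in> \<O>\<close> B(3)[OF p] frameD(2)[OF B(1)] p by auto
    then show ?thesis unfolding B(2) span_box_frame[OF B(1)] using assms(2) frameD(8)[OF B(1)] by (auto simp: box_def)
  qed
  then show ?thesis by (auto simp: dual_def)
qed

lemma mem_subspace_iff_annihilator:
  assumes "x \<in> R_set \<O> n l" "v \<in> fst x"
  shows "res_class \<O> n (fst x) v \<in> snd x \<longleftrightarrow> (\<forall>g\<in>annihilator n x. g \<bullet> v \<in> \<MM>)"
proof -
  obtain B D J where B: "frame n B D"
    "\<And>v. v \<in> fst x \<Longrightarrow> res_class \<O> n (fst x) v \<in> snd x \<longleftrightarrow> (\<forall>p<n. p \<notin> J \<longrightarrow> (D *\<^sub>v v) $ p \<in> \<MM>)"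
    "\<And>p. p < n \<Longrightarrow> p \<notin> J \<Longrightarrow> row D p \<in> annihilator n x"
    using dual_adapted_frame[OF assms(1)] by metis
  have "res_class \<O> n (fst x) v \<in> snd x" if "\<forall>g\<in>annihilator n x. g \<bullet> v \<in> \<MM>"
  proof -
    have "(D *\<^sub>v v) $ p \<in> \<MM>" if p: "p < n" "p \<notin> J" for p
      using \<open>\<forall>g\<in>annihilator n x. g \<bullet> v \<in> \<MM>\<close> B(3)[OF p] frameD(2)[OF B(1)] p by auto
    then show ?thesis using B(2)[OF assms(2)] by blast
  qed
  then show ?thesis using assms(2) by (auto simp: annihilator_def)
qed

text \<open>The value of \<open>h\<close> at \<open>(\<Lambda>, V)\<close> refines the \<open>\<Lambda>\<close>-norm of \<open>h\<close>, given by its representative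
  \<open>a\<close>, by a bit telling whether the reduction of \<open>h / a\<close> lies outside of \<open>V\<close>.\<close>

definition is_value :: "nat \<Rightarrow> 'a vec set \<times> 'a vec set set \<Rightarrow> 'a vec \<Rightarrow> 'a \<times> nat \<Rightarrow> bool" where
  "is_value n x h z \<longleftrightarrow> fst z \<noteq> 0 \<and> snd z \<le> 1 \<and> (\<forall>g\<in>dual n x. g \<bullet> h / fst z \<in> \<O>) \<and>
    (\<exists>g\<in>dual n x. g \<bullet> h = fst z \<and> (g \<in> annihilator n x \<longleftrightarrow> snd z = 1)) \<and>
    (snd z = 0 \<longrightarrow> (\<forall>g\<in>annihilator n x. g \<bullet> h / fst z \<in> \<MM>))"

text \<open>The conditions in \<open>is_value\<close> fix the pair only up to \<open>eqv\<close>, as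
  the first entry may be changed by a unit of \<O>. Hence the choice.\<close>

definition vvalue :: "nat \<Rightarrow> 'a vec set \<times> 'a vec set set \<Rightarrow> 'a vec \<Rightarrow> 'a \<times> nat" where
  "vvalue n x h = (SOME z. is_value n x h z)"

lemma is_value_vvalue:
  assumes x: "x \<in> R_set \<O> n l" and h: "h \<in> carrier_vec n" "h \<noteq> 0\<^sub>v n"
  shows "is_value n x h (vvalue n x h)"
proof -
  obtain B D J where B: "frame n B D" "\<And>p. p < n \<Longrightarrow> row D p \<in> dual n x"
    "\<And>p. p < n \<Longrightarrow> col B p \<in> fst x"
    using dual_adapted_frame[OF x] by metis
  have D: "D \<in> carrier_mat n n" by (rule frameD(2)[OF B(1)])
  have "\<exists>i<n. (D *\<^sub>v h) $ i \<noteq> 0"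
  proof (rule ccontr)
    assume "\<not> ?thesis"
    then have "D *\<^sub>v h = 0\<^sub>v n" using D by (intro eq_vecI) auto
    then have "B *\<^sub>v 0\<^sub>v n = h" using frameD(6)[OF B(1) h(1)] by simp
    moreover have "B *\<^sub>v 0\<^sub>v n = 0\<^sub>v n" using frameD(1)[OF B(1)] by (intro eq_vecI) (auto simp: scalar_prod_def)
    ultimately show False using h(2) by simp
  qed
  then obtain i where i: "i < n" "(D *\<^sub>v h) $ i \<noteq> 0" by blast
  then obtain p where p: "p < n" "(D *\<^sub>v h) $ p \<noteq> 0" "\<And>q. q < n \<Longrightarrow> (D *\<^sub>v h) $ q / (D *\<^sub>v h) $ p \<in> \<O>"
    using ex_dominant[of "{..<n}" i "\<lambda>i. (D *\<^sub>v h) $ i"] unfolding lessThan_iff Ball_def Bex_def by blast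
  \<comment> \<open>A dominant coordinate of \<open>h\<close> in a lattice basis represents its
    norm.\<close>
  define a where "a = (D *\<^sub>v h) $ p"
  have a0: "a \<noteq> 0" using p(2) by (simp add: a_def)
  have int: "g \<bullet> h / a \<in> \<O>" if g: "g \<in> dual n x" for g
  proof -
    have "g \<bullet> h = (\<Sum>i<n. (g \<bullet> col B i) * (D *\<^sub>v h) $ i)"
      using g by (intro scalar_prod_frame[OF B(1) h(1)]) (simp add: dual_def)
    then have "g \<bullet> h / a = (\<Sum>i<n. (g \<bullet> col B i) * ((D *\<^sub>v h) $ i / a))"
      by (simp add: sum_divide_distrib)
    also have "\<dots> \<in> \<O>"
      using g B(3) p(3) by (intro O_sum O_mult) (auto simp: dual_def a_def)
    finally show ?thesis .
  qed
  have row: "row D p \<in> dual n x" "row D p \<bullet> h = a" using B(2)[OF p(1)] D p(1) by (auto simp: a_def)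
  have "\<exists>z. is_value n x h z"
  \<comment> \<open>The bit is 1 if a functional from the annihilator attains the norm as well. Its
    value on \<open>h\<close> then replaces \<open>a\<close> as representative, since
    \<open>is_value\<close> asks for an annihilator functional with exactly this value.\<close>
  proof (cases "\<exists>g\<in>annihilator n x. g \<bullet> h / a \<notin> \<MM>")
    case True
    then obtain g where g: "g \<in> annihilator n x" "g \<bullet> h / a \<notin> \<MM>" by blast
    have gd: "g \<in> dual n x" using g(1) by (simp add: annihilator_def)
    have "inverse (g \<bullet> h / a) \<in> \<O>" "g \<bullet> h / a \<noteq> 0" using unit_inverse[OF int[OF gd] g(2)] by auto
    then have u: "a / (g \<bullet> h) \<in> \<O>" "g \<bullet> h \<noteq> 0" by auto
    have "g' \<bullet> h / (g \<bullet> h) \<in> \<O>" if "g' \<in> dual n x" for g'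
    proof -
      have "g' \<bullet> h / (g \<bullet> h) = (g' \<bullet> h / a) * (a / (g \<bullet> h))" using a0 by simp
      then show ?thesis using int[OF that] u(1) O_mult by metis
    qed
    then have "is_value n x h (g \<bullet> h, 1)" using g gd u(2) by (auto simp: is_value_def)
    then show ?thesis by blast
  next
    case False
    have "row D p \<bullet> h / a \<notin> \<MM>" using row(2) a0 by simp
    then have "row D p \<notin> annihilator n x" using False by blast
    then have "is_value n x h (a, 0)" using False a0 int row by (auto simp: is_value_def)
    then show ?thesis by blast
  qed
  then show ?thesis unfolding vvalue_def by (rule someI_ex)
qed

text \<open>The pair is recovered from two balls: the lattice consists of the \<open>h\<close> of
  norm at most 1, and the preimage of the subspace of those of value at most \<open>(1, 0)\<close>.
  Both conditions are invariant under \<open>eqv\<close>.\<close>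

lemma lattice_subspace_eqI:
  assumes x: "x \<in> R_set \<O> n l" and y: "y \<in> R_set \<O> n l'"
    and eq: "\<And>h. h \<in> carrier_vec n \<Longrightarrow> h \<noteq> 0\<^sub>v n \<Longrightarrow> eqv (vvalue n x h) (vvalue n y h)"
  shows "x = y"
proof -
  have mem: "h \<in> fst x \<longleftrightarrow> fst (vvalue n x h) \<in> \<O>"
    and mem_sub: "h \<in> fst x \<Longrightarrow> res_class \<O> n (fst x) h \<in> snd x \<longleftrightarrow>
      fst (vvalue n x h) \<in> \<MM> \<or> snd (vvalue n x h) = 0"
    if x: "x \<in> R_set \<O> n l" and h: "h \<in> carrier_vec n" "h \<noteq> 0\<^sub>v n" for x h l
  proof -
    define z where "z = vvalue n x h"
    have z: "is_value n x h z" using is_value_vvalue[OF x h] by (simp add: z_def)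
    then have z0: "fst z \<noteq> 0" and int: "\<And>g. g \<in> dual n x \<Longrightarrow> g \<bullet> h / fst z \<in> \<O>" by (auto simp: is_value_def)
    obtain g where g: "g \<in> dual n x" "g \<bullet> h = fst z" "g \<in> annihilator n x \<longleftrightarrow> snd z = 1"
      using z by (auto simp: is_value_def)
    have gh: "g' \<bullet> h = (g' \<bullet> h / fst z) * fst z" for g' using z0 by simp
    show mem: "h \<in> fst x \<longleftrightarrow> fst (vvalue n x h) \<in> \<O>"
      unfolding mem_lattice_iff_dual[OF x h(1)] z_def[symmetric]
      using g(1,2) int gh O_mult by metis
    assume hx: "h \<in> fst x"
    then have zO: "fst z \<in> \<O>" using mem by (simp add: z_def)
    show "res_class \<O> n (fst x) h \<in> snd x \<longleftrightarrow> fst (vvalue n x h) \<in> \<MM> \<or> snd (vvalue n x h) = 0"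
      unfolding mem_subspace_iff_annihilator[OF x hx] z_def[symmetric]
    proof
      assume all: "\<forall>g\<in>annihilator n x. g \<bullet> h \<in> \<MM>"
      show "fst z \<in> \<MM> \<or> snd z = 0"
      proof (cases "snd z = 0")
        case False
        then have "snd z = 1" using z by (auto simp: is_value_def)
        then show ?thesis using all g by metis
      qed simp
    next
      assume or: "fst z \<in> \<MM> \<or> snd z = 0"
      show "\<forall>g\<in>annihilator n x. g \<bullet> h \<in> \<MM>"
      proof
        fix g' assume g': "g' \<in> annihilator n x"
        then have d: "g' \<bullet> h / fst z \<in> \<O>" using int by (simp add: annihilator_def)
        show "g' \<bullet> h \<in> \<MM>"
        proof (cases "fst z \<in> \<MM>")
          case True
          then show ?thesis using gh[of g'] d M_mult' by metis
        next
          case False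
          then have "g' \<bullet> h / fst z \<in> \<MM>" using or z g' by (auto simp: is_value_def)
          then show ?thesis using gh[of g'] zO M_mult by metis
        qed
      qed
    qed
  qed
  have nz: "fst (vvalue n x h) \<noteq> 0" "fst (vvalue n y h) \<noteq> 0" if "h \<in> carrier_vec n" "h \<noteq> 0\<^sub>v n" for h
    using is_value_vvalue[OF x that] is_value_vvalue[OF y that] by (auto simp: is_value_def)
  have trans: "a \<in> X \<longleftrightarrow> b \<in> X"
    if X: "X = \<O> \<or> X = \<MM>" and ab: "a \<noteq> 0" "b \<noteq> 0" "a / b \<in> \<O>" "b / a \<in> \<O>" for a b X
  proof -
    have "a = a / b * b" "b = b / a * a" using ab by auto
    then show ?thesis using ab(3,4) X O_mult M_mult' by metis
  qed
  have in_eq: "h \<in> fst x \<longleftrightarrow> h \<in> fst y" for h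
  proof (cases "h \<in> carrier_vec n \<and> h \<noteq> 0\<^sub>v n")
    case True
    then have h: "h \<in> carrier_vec n" "h \<noteq> 0\<^sub>v n" by auto
    show ?thesis
      unfolding mem[OF x h] mem[OF y h]
      using eq[OF h] trans[of \<O>] nz[OF h] unfolding eqv_iff[OF nz[OF h]] by blast
  next
    case False
    have "submodule \<O> n (fst x)" "submodule \<O> n (fst y)"
      using x y by (auto simp: R_set_def is_lattice_def)
    then show ?thesis using False unfolding submodule_def by auto
  qed
  then have fst_eq: "fst x = fst y" by blast
  have in_sub: "res_class \<O> n (fst x) h \<in> snd x \<longleftrightarrow> res_class \<O> n (fst x) h \<in> snd y" if hx: "h \<in> fst x" for h
  proof (cases "h = 0\<^sub>v n")
    case True
    then show ?thesis using x y fst_eq by (auto simp: R_set_def res_subspace_def)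
  next
    case False
    have h: "h \<in> carrier_vec n" using hx x by (auto simp: R_set_def is_lattice_def submodule_def)
    have hy: "h \<in> fst y" using hx fst_eq by simp
    show ?thesis
      using mem_sub[OF x h False hx] mem_sub[OF y h False hy] eq[OF h False]
        trans[of \<MM>] nz[OF h False] fst_eq unfolding eqv_iff[OF nz[OF h False]] by metis
  qed
  have "snd x \<subseteq> res \<O> n (fst x)" "snd y \<subseteq> res \<O> n (fst x)"
    using x y fst_eq by (auto simp: R_set_def res_subspace_def)
  then have "snd x = snd y" using in_sub unfolding res_def by blast
  then show ?thesis using fst_eq by (simp add: prod_eq_iff)
qed

end

section \<open>The symmetric modules of a multiset\<close>

context valued_field
begin

text \<open>\<open>ys\<close> chooses \<open>k\<close> of the pairs; the tensor factors \<open>i * d, \<dots>, i * d + d - 1\<close> carry the norm of \<open>ys ! i\<close>.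
  The module is the intersection over all \<open>ys\<close> of the balls of radius \<open>(1, w)\<close>, written down
  without a basis through the dual lattices.\<close>

definition sym_module ::
    "nat \<Rightarrow> nat \<Rightarrow> nat \<Rightarrow> nat \<Rightarrow> ('a vec set \<times> 'a vec set set) multiset \<Rightarrow> 'a vec set" where
  "sym_module n k d w X = {f \<in> carrier_vec (n ^ (k * d)).
    \<forall>ys. length ys = k \<longrightarrow> mset ys \<subseteq># X \<longrightarrow>
      (\<forall>g. (\<forall>p<k * d. g p \<in> dual n (ys ! (p div d))) \<longrightarrow>
        tens n (k * d) g \<bullet> f \<in> \<O> \<and>
        (w < card {p. p < k * d \<and> g p \<in> annihilator n (ys ! (p div d))} \<longrightarrow> tens n (k * d) g \<bullet> f \<in> \<MM>))}"

lemma card_annihilator_le: "card {p. p < (q::nat) \<and> P p} \<le> q"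
  using card_mono[of "{..<q}" "{p. p < q \<and> P p}"] by auto

lemma submodule_sym_module: "submodule \<O> (n ^ (k * d)) (sym_module n k d w X)"
  unfolding submodule_def
proof (intro conjI ballI)
  show "sym_module n k d w X \<subseteq> carrier_vec (n ^ (k * d))" by (auto simp: sym_module_def)
  show "0\<^sub>v (n ^ (k * d)) \<in> sym_module n k d w X" by (simp add: sym_module_def)
next
  fix v u assume "v \<in> sym_module n k d w X" "u \<in> sym_module n k d w X"
  then show "v + u \<in> sym_module n k d w X"
    unfolding sym_module_def
    by (simp add: scalar_prod_add_distrib[OF tens_carrier] O_add M_add)
next
  fix a v assume "a \<in> \<O>" "v \<in> sym_module n k d w X"
  then show "a \<cdot>\<^sub>v v \<in> sym_module n k d w X"
    unfolding sym_module_def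
    by (simp add: scalar_prod_smult_distrib[OF tens_carrier] O_mult M_mult')
qed

text \<open>No number of annihilator factors exceeds \<open>k * d\<close>, so the second condition
  is void: this is the unit ball for the norms without their bits.\<close>

lemma sym_module_top:
  "sym_module n k d (k * d) X = {f \<in> carrier_vec (n ^ (k * d)).
    \<forall>ys. length ys = k \<longrightarrow> mset ys \<subseteq># X \<longrightarrow>
      (\<forall>g. (\<forall>p<k * d. g p \<in> dual n (ys ! (p div d))) \<longrightarrow> tens n (k * d) g \<bullet> f \<in> \<O>)}"
proof -
  have "\<not> k * d < card {p. p < k * d \<and> P p}" for P by (simp add: not_less card_annihilator_le)
  then show ?thesis unfolding sym_module_def by simp
qed

text \<open>Integrality against all pure tensors from the dual lattices can be tested on the
  finitely many tensors of dual basis vectors. One choice of \<open>k\<close> pairs gives a lattice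
  to start from, and the functionals of all choices cut it down. For \<open>k\<close> above the size
  of \<open>X\<close> there would be no choice, and the module would be the whole space.\<close>

lemma sym_module_lattice:
  assumes X: "\<And>x. x \<in># X \<Longrightarrow> x \<in> R_set \<O> n l" and k: "k \<le> size X"
  shows "\<exists>B D. frame (n ^ (k * d)) B D \<and> span_box \<O> B = sym_module n k d (k * d) X"
proof -
  let ?q = "k * d"
  define Y where "Y = {ys. length ys = k \<and> mset ys \<subseteq># X}"
  have "Y \<subseteq> {ys. set ys \<subseteq> set_mset X \<and> length ys = k}"
    by (auto simp: Y_def dest: mset_subset_eqD)
  then have finY: "finite Y" using finite_lists_length_eq[of "set_mset X" k] finite_subset by blast
  obtain xs where xs: "mset xs = X" using ex_mset by blast
  have "mset (take k xs) \<subseteq># X"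
    using xs by (metis append_take_drop_id mset_append mset_subset_eq_add_left)
  moreover have "length (take k xs) = k" using k xs by auto
  ultimately have y0: "take k xs \<in> Y" by (simp add: Y_def)
  have "\<forall>x\<in>#X. \<exists>B D. frame n B D \<and> fst x = span_box \<O> B \<and>
    (\<forall>p<n. row D p \<in> dual n x) \<and> (\<forall>p<n. col B p \<in> fst x)"
    using X by (metis dual_adapted_frame)
  then obtain fB fD where fr: "\<And>x. x \<in># X \<Longrightarrow> frame n (fB x) (fD x)"
    "\<And>x p. x \<in># X \<Longrightarrow> p < n \<Longrightarrow> row (fD x) p \<in> dual n x"
    "\<And>x p. x \<in># X \<Longrightarrow> p < n \<Longrightarrow> col (fB x) p \<in> fst x"
    by metis
  define TB where "TB ys = tens_mat n ?q (\<lambda>p. fB (ys ! (p div d)))" for ys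
  define TD where "TD ys = tens_mat n ?q (\<lambda>p. fD (ys ! (p div d)))" for ys
  have ysX: "ys ! (p div d) \<in># X" if "ys \<in> Y" "p < ?q" for ys p
  proof -
    have "p div d < k" using that(2) by (simp add: less_mult_imp_div_less)
    then show ?thesis using that(1) by (auto simp: Y_def dest!: mset_subset_eqD)
  qed
  have T: "frame (n ^ ?q) (TB ys) (TD ys)" if "ys \<in> Y" for ys
    unfolding TB_def TD_def using fr(1) ysX[OF that] by (intro frame_tens_mat) blast
  \<comment> \<open>The rows of \<open>TD ys\<close> are themselves pure tensors from the dual
    lattices. Conversely any such tensor is integral on the columns of \<open>TB ys\<close>, and
    \<open>scalar_prod_frame\<close> expands its pairing with \<open>f\<close>.\<close>
  have key: "(\<forall>g. (\<forall>p<?q. g p \<in> dual n (ys ! (p div d))) \<longrightarrow> tens n ?q g \<bullet> f \<in> \<O>) \<longleftrightarrow>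
      (\<forall>x<n ^ ?q. row (TD ys) x \<bullet> f \<in> \<O>)" (is "?l \<longleftrightarrow> ?r")
    if ys: "ys \<in> Y" and f: "f \<in> carrier_vec (n ^ ?q)" for ys f
  proof
    assume l: ?l
    show ?r
    proof (intro allI impI)
      fix x assume x: "x < n ^ ?q"
      have "row (TD ys) x = tens n ?q (\<lambda>p. row (fD (ys ! (p div d))) (x div n ^ p mod n))"
        unfolding TD_def using frameD(2)[OF fr(1)] ysX[OF ys] x by (intro tens_mat_row) blast+
      moreover have "row (fD (ys ! (p div d))) (x div n ^ p mod n) \<in> dual n (ys ! (p div d))" if "p < ?q" for p
        using fr(2)[OF ysX[OF ys that]] digit_less[OF x that] by blast
      ultimately show "row (TD ys) x \<bullet> f \<in> \<O>" using l by simp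
    qed
  next
    assume r: ?r
    show ?l
    proof (intro allI impI)
      fix g assume g: "\<forall>p<?q. g p \<in> dual n (ys ! (p div d))"
      have "tens n ?q g \<bullet> f = (\<Sum>x<n ^ ?q. (tens n ?q g \<bullet> col (TB ys) x) * (TD ys *\<^sub>v f) $ x)"
        by (rule scalar_prod_frame[OF T[OF ys] f tens_carrier])
      also have "\<dots> \<in> \<O>"
      proof (intro O_sum O_mult)
        fix x assume "x \<in> {..<n ^ ?q}"
        then have x: "x < n ^ ?q" by simp
        have "row (TD ys) x \<bullet> f = (TD ys *\<^sub>v f) $ x" using frameD(2)[OF T[OF ys]] x by auto
        then show "(TD ys *\<^sub>v f) $ x \<in> \<O>" using r x by metis
        have col: "col (TB ys) x = tens n ?q (\<lambda>p. col (fB (ys ! (p div d))) (x div n ^ p mod n))"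
          unfolding TB_def using frameD(1)[OF fr(1)] ysX[OF ys] x by (intro tens_mat_col) blast+
        have "col (fB (ys ! (p div d))) (x div n ^ p mod n) \<in> carrier_vec n" if "p < ?q" for p
          using frameD(1)[OF fr(1)[OF ysX[OF ys that]]] by auto
        then have "tens n ?q g \<bullet> col (TB ys) x = (\<Prod>p<?q. g p \<bullet> col (fB (ys ! (p div d))) (x div n ^ p mod n))"
          unfolding col by (rule tens_scalar_prod)
        also have "\<dots> \<in> \<O>"
        proof (rule O_prod)
          fix p assume "p \<in> {..<?q}"
          then have p: "p < ?q" by simp
          have "col (fB (ys ! (p div d))) (x div n ^ p mod n) \<in> fst (ys ! (p div d))"
            using fr(3)[OF ysX[OF ys p] digit_less[OF x p]] .
          then show "g p \<bullet> col (fB (ys ! (p div d))) (x div n ^ p mod n) \<in> \<O>"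
            using g p unfolding dual_def by blast
        qed
        finally show "tens n ?q g \<bullet> col (TB ys) x \<in> \<O>" .
      qed
      finally show "tens n ?q g \<bullet> f \<in> \<O>" .
    qed
  qed
  define S where "S = (\<Union>ys\<in>Y. (\<lambda>x. row (TD ys) x) ` {..<n ^ ?q})"
  have finS: "finite S" using finY by (simp add: S_def)
  have "S \<subseteq> carrier_vec (n ^ ?q)" using frameD(2)[OF T] unfolding S_def by fastforce
  from constrain_lattice_finite[OF finS T[OF y0] this]
  obtain B D where B: "frame (n ^ ?q) B D"
    "span_box \<O> B = {v \<in> span_box \<O> (TB (take k xs)). \<forall>s\<in>S. s \<bullet> v \<in> \<O>}"
    by blast
  have span0: "v \<in> span_box \<O> (TB (take k xs)) \<longleftrightarrow>
      v \<in> carrier_vec (n ^ ?q) \<and> (\<forall>x<n ^ ?q. row (TD (take k xs)) x \<bullet> v \<in> \<O>)" for v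
    unfolding span_box_frame[OF T[OF y0]] box_def
    using frameD(2)[OF T[OF y0]] frameD(8)[OF T[OF y0], of v] by auto
  have "v \<in> span_box \<O> B \<longleftrightarrow> v \<in> sym_module n k d ?q X" for v
  proof -
    have "v \<in> span_box \<O> B \<longleftrightarrow> v \<in> carrier_vec (n ^ ?q) \<and> (\<forall>ys\<in>Y. \<forall>x<n ^ ?q. row (TD ys) x \<bullet> v \<in> \<O>)"
      unfolding B(2) mem_Collect_eq span0 using y0 by (auto simp: S_def)
    also have "\<dots> \<longleftrightarrow> v \<in> sym_module n k d ?q X"
      unfolding sym_module_top mem_Collect_eq using key[of _ v] by (auto simp: Y_def)
    finally show ?thesis .
  qed
  then show ?thesis using B(1) by blast
qed

text \<open>A scalar from \<MM> moves integral pairings into \<MM>, where the condition holds for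
  every \<open>w\<close>. So each ball is the preimage of a subspace of the reduction.\<close>

lemma sym_module_bounds:
  assumes B: "frame (n ^ (k * d)) B D" "span_box \<O> B = sym_module n k d (k * d) X"
  shows "span_box \<MM> B \<subseteq> sym_module n k d w X" "sym_module n k d w X \<subseteq> span_box \<O> B"
proof -
  have "a \<cdot>\<^sub>v v \<in> sym_module n k d w X" if a: "a \<in> \<MM>" and v: "v \<in> sym_module n k d (k * d) X" for a v
    using v M_mult[OF a] M_O unfolding sym_module_top unfolding sym_module_def
    by (simp add: scalar_prod_smult_distrib[OF tens_carrier])
  then have "max_mult \<O> (n ^ (k * d)) (span_box \<O> B) \<subseteq> sym_module n k d w X"
    unfolding max_mult_def B(2) using submodule_sym_module by blast
  then show "span_box \<MM> B \<subseteq> sym_module n k d w X" unfolding max_mult_span_box[OF B(1)] .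
  show "sym_module n k d w X \<subseteq> span_box \<O> B"
    unfolding B(2) sym_module_top unfolding sym_module_def by blast
qed

lemma sum_card_bits:
  fixes u :: "nat \<Rightarrow> nat"
  assumes "\<And>p. p < q \<Longrightarrow> u p \<le> 1"
  shows "card {p. p < q \<and> u p = 1} = (\<Sum>p<q. u p)"
proof -
  have "(\<Sum>p<q. u p) = (\<Sum>p<q. if u p = 1 then 1 else 0)"
    using assms by (intro sum.cong) (auto simp: le_Suc_eq)
  also have "\<dots> = card {p. p < q \<and> u p = 1}"
    using sum.inter_filter[of "{..<q}" "\<lambda>_. 1::nat" "\<lambda>p. u p = 1"] by simp
  finally show ?thesis by simp
qed

text \<open>Pairings of pure tensors factor, and each factor is bounded by the value of
  \<open>h p\<close>. Taking in each factor a functional that attains this value shows that the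
  product of the bounds is sharp, bits included.\<close>

lemma pure_tensor_iff:
  fixes y :: "nat \<Rightarrow> 'a vec set \<times> 'a vec set set"
  assumes val: "\<And>p. p < q \<Longrightarrow> is_value n (y p) (h p) (z p)" and h: "\<And>p. p < q \<Longrightarrow> h p \<in> carrier_vec n"
    and c: "c \<noteq> 0"
  shows "(\<forall>g. (\<forall>p<q. g p \<in> dual n (y p)) \<longrightarrow>
      tens n q g \<bullet> (inverse c \<cdot>\<^sub>v tens n q h) \<in> \<O> \<and>
      (w < card {p. p < q \<and> g p \<in> annihilator n (y p)} \<longrightarrow> tens n q g \<bullet> (inverse c \<cdot>\<^sub>v tens n q h) \<in> \<MM>)) \<longleftrightarrow>
    lev (\<Prod>p<q. fst (z p), \<Sum>p<q. snd (z p)) (c, w)" (is "?l \<longleftrightarrow> ?r")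
proof -
  let ?A = "\<Prod>p<q. fst (z p)"
  have z0: "fst (z p) \<noteq> 0" if "p < q" for p using val[OF that] by (simp add: is_value_def)
  have A0: "?A \<noteq> 0" using z0 by auto
  have eq: "tens n q g \<bullet> (inverse c \<cdot>\<^sub>v tens n q h) = (?A / c) * (\<Prod>p<q. g p \<bullet> h p / fst (z p))" for g
  proof -
    have "tens n q g \<bullet> (inverse c \<cdot>\<^sub>v tens n q h) = inverse c * (\<Prod>p<q. g p \<bullet> h p)"
      by (simp add: scalar_prod_smult_distrib[OF tens_carrier tens_carrier] tens_scalar_prod[OF h])
    also have "(\<Prod>p<q. g p \<bullet> h p) = ?A * (\<Prod>p<q. g p \<bullet> h p / fst (z p))"
      using A0 by (simp add: prod_dividef)
    finally show ?thesis by (simp add: field_simps)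
  qed
  have int: "g p \<bullet> h p / fst (z p) \<in> \<O>" if "\<forall>p<q. g p \<in> dual n (y p)" "p < q" for g p
    using that val[OF that(2)] by (auto simp: is_value_def)
  have "\<forall>p. \<exists>g. p < q \<longrightarrow> g \<in> dual n (y p) \<and> g \<bullet> h p = fst (z p) \<and> (g \<in> annihilator n (y p) \<longleftrightarrow> snd (z p) = 1)"
    using val unfolding is_value_def by blast
  \<comment> \<open>A tensor that attains all values at once; the number of its factors in the
    annihilators is the sum of the bits.\<close>
  then obtain g0 where g0: "\<And>p. p < q \<Longrightarrow> g0 p \<in> dual n (y p)" "\<And>p. p < q \<Longrightarrow> g0 p \<bullet> h p = fst (z p)"
    "\<And>p. p < q \<Longrightarrow> g0 p \<in> annihilator n (y p) \<longleftrightarrow> snd (z p) = 1" by metis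
  have "(\<Prod>p<q. g0 p \<bullet> h p / fst (z p)) = 1" using g0(2) z0 by (intro prod.neutral) auto
  then have eq0: "tens n q g0 \<bullet> (inverse c \<cdot>\<^sub>v tens n q h) = ?A / c" using eq[of g0] by simp
  have bits: "snd (z p) \<le> 1" if "p < q" for p using val[OF that] by (simp add: is_value_def)
  have "card {p. p < q \<and> g0 p \<in> annihilator n (y p)} = card {p. p < q \<and> snd (z p) = 1}"
    by (rule arg_cong[where f = card]) (use g0(3) in auto)
  also have "\<dots> = (\<Sum>p<q. snd (z p))" using bits by (rule sum_card_bits)
  finally have card0: "card {p. p < q \<and> g0 p \<in> annihilator n (y p)} = (\<Sum>p<q. snd (z p))" .
  show ?thesis
  proof
    assume l: ?l
    have "?A / c \<in> \<O>" "w < (\<Sum>p<q. snd (z p)) \<longrightarrow> ?A / c \<in> \<MM>"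
      using l[rule_format, of g0] g0(1) eq0 card0 by auto
    then show ?r by (auto simp: lev_def not_less)
  next
    assume r: ?r
    show ?l
    proof (intro allI impI)
      fix g assume g: "\<forall>p<q. g p \<in> dual n (y p)"
      have prO: "(\<Prod>p<q. g p \<bullet> h p / fst (z p)) \<in> \<O>" using int[OF g] by (intro O_prod) auto
      show "tens n q g \<bullet> (inverse c \<cdot>\<^sub>v tens n q h) \<in> \<O> \<and>
        (w < card {p. p < q \<and> g p \<in> annihilator n (y p)} \<longrightarrow> tens n q g \<bullet> (inverse c \<cdot>\<^sub>v tens n q h) \<in> \<MM>)"
      proof (cases "?A / c \<in> \<MM>")
        case True
        then show ?thesis unfolding eq using prO M_mult M_O by blast
      next
        case False
        then have AO: "?A / c \<in> \<O>" and w: "(\<Sum>p<q. snd (z p)) \<le> w" using r by (auto simp: lev_def)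
        have "(\<Prod>p<q. g p \<bullet> h p / fst (z p)) \<in> \<MM>"
          if c: "w < card {p. p < q \<and> g p \<in> annihilator n (y p)}"
        proof -
          \<comment> \<open>There are more annihilator factors than bits equal to 1, so some factor
            lies in an annihilator while its bit is 0; this factor contributes an element of
            \<MM>.\<close>
          have "\<not> {p. p < q \<and> g p \<in> annihilator n (y p)} \<subseteq> {p. p < q \<and> snd (z p) = 1}"
            using card_mono[of "{p. p < q \<and> snd (z p) = 1}" "{p. p < q \<and> g p \<in> annihilator n (y p)}"]
              sum_card_bits[of q "\<lambda>p. snd (z p)"] bits w c by fastforce
          then obtain p where p: "p < q" "g p \<in> annihilator n (y p)" "snd (z p) \<noteq> 1" by blast
          then have "snd (z p) = 0" using bits[of p] by simp
          then have "g p \<bullet> h p / fst (z p) \<in> \<MM>" using val[OF p(1)] p(2) by (auto simp: is_value_def)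
          then show ?thesis using int[OF g] p(1) by (intro M_prod[of _ _ p]) auto
        qed
        then show ?thesis unfolding eq using AO prO O_mult M_mult' by blast
      qed
    qed
  qed
qed

lemma prod_list_nth: "prod_list xs = (\<Prod>i<length xs. xs ! i)" for xs :: "'b::comm_monoid_mult list"
proof (induction xs)
  case (Cons x xs)
  then show ?case by (simp add: prod.lessThan_Suc_shift del: prod.lessThan_Suc)
qed simp

lemma sum_list_nth_lessThan: "sum_list xs = (\<Sum>i<length xs. xs ! i)" for xs :: "'b::comm_monoid_add list"
  by (simp add: sum_list_sum_nth atLeast0LessThan)

lemma block_div_mod:
  fixes a d i :: nat
  assumes "i * d \<le> a" "a < i * d + d"
  shows "a div d = i" "a mod d = a - i * d"
proof -
  obtain j where "a = i * d + j" using le_Suc_ex[OF assms(1)] by blast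
  then show "a div d = i" "a mod d = a - i * d" using assms(2) by auto
qed

text \<open>Position \<open>p = i * d + j\<close> carries the pair \<open>ys ! i\<close> and the
  tensor factor \<open>gs ! j\<close>, so the double product over pairs and factors becomes a single
  one over positions.\<close>

lemma vprod_blocks:
  assumes "length ys = k" "length gs = d"
  shows "vprod (\<lambda>y. vprod (v y) gs) ys =
    (\<Prod>p<k * d. fst (v (ys ! (p div d)) (gs ! (p mod d))), \<Sum>p<k * d. snd (v (ys ! (p div d)) (gs ! (p mod d))))"
proof -
  have "(\<Prod>p<k * d. fst (v (ys ! (p div d)) (gs ! (p mod d)))) =
    (\<Prod>i<k. \<Prod>p\<in>{i * d..<i * d + d}. fst (v (ys ! (p div d)) (gs ! (p mod d))))"
    by (rule prod.nat_group[symmetric])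
  also have "\<dots> = (\<Prod>i<k. \<Prod>j<d. fst (v (ys ! i) (gs ! j)))"
  proof (rule prod.cong[OF refl])
    fix i
    show "(\<Prod>p\<in>{i * d..<i * d + d}. fst (v (ys ! (p div d)) (gs ! (p mod d)))) = (\<Prod>j<d. fst (v (ys ! i) (gs ! j)))"
      by (rule prod.reindex_bij_witness[of _ "\<lambda>j. i * d + j" "\<lambda>p. p - i * d"]) (auto simp: block_div_mod)
  qed
  finally have 1: "(\<Prod>p<k * d. fst (v (ys ! (p div d)) (gs ! (p mod d)))) = (\<Prod>i<k. \<Prod>j<d. fst (v (ys ! i) (gs ! j)))" .
  have "(\<Sum>p<k * d. snd (v (ys ! (p div d)) (gs ! (p mod d)))) =
    (\<Sum>i<k. \<Sum>p\<in>{i * d..<i * d + d}. snd (v (ys ! (p div d)) (gs ! (p mod d))))"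
    by (rule sum.nat_group[symmetric])
  also have "\<dots> = (\<Sum>i<k. \<Sum>j<d. snd (v (ys ! i) (gs ! j)))"
  proof (rule sum.cong[OF refl])
    fix i
    show "(\<Sum>p\<in>{i * d..<i * d + d}. snd (v (ys ! (p div d)) (gs ! (p mod d)))) = (\<Sum>j<d. snd (v (ys ! i) (gs ! j)))"
      by (rule sum.reindex_bij_witness[of _ "\<lambda>j. i * d + j" "\<lambda>p. p - i * d"]) (auto simp: block_div_mod)
  qed
  finally show ?thesis
    using assms 1 by (simp add: vprod_def prod_list_nth sum_list_nth_lessThan)
qed

text \<open>\<open>\<lambda>p. gs ! (p mod d)\<close> repeats the factors \<open>k\<close> times,
  giving the \<open>k\<close>-th power of one tensor of degree \<open>d\<close>. All choices
  \<open>ys\<close> are thus evaluated at the same tensor, each by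
  \<open>pure_tensor_iff\<close>.\<close>

lemma pure_tensor_sym_module_iff:
  assumes X: "\<And>x. x \<in># X \<Longrightarrow> x \<in> R_set \<O> n l"
    and gs: "\<And>h. h \<in> set gs \<Longrightarrow> h \<in> carrier_vec n \<and> h \<noteq> 0\<^sub>v n" and d: "length gs = d" and c: "c \<noteq> 0"
  shows "inverse c \<cdot>\<^sub>v tens n (k * d) (\<lambda>p. gs ! (p mod d)) \<in> sym_module n k d w X \<longleftrightarrow>
    (\<forall>ys. length ys = k \<longrightarrow> mset ys \<subseteq># X \<longrightarrow> lev (vprod (\<lambda>y. vprod (vvalue n y) gs) ys) (c, w))"
proof -
  let ?f = "inverse c \<cdot>\<^sub>v tens n (k * d) (\<lambda>p. gs ! (p mod d))"
  have "(\<forall>g. (\<forall>p<k * d. g p \<in> dual n (ys ! (p div d))) \<longrightarrow>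
      tens n (k * d) g \<bullet> ?f \<in> \<O> \<and>
      (w < card {p. p < k * d \<and> g p \<in> annihilator n (ys ! (p div d))} \<longrightarrow> tens n (k * d) g \<bullet> ?f \<in> \<MM>)) \<longleftrightarrow>
    lev (vprod (\<lambda>y. vprod (vvalue n y) gs) ys) (c, w)"
    if ys: "length ys = k" "mset ys \<subseteq># X" for ys
    unfolding vprod_blocks[OF ys(1) d]
  proof (rule pure_tensor_iff[OF _ _ c])
    fix p assume p: "p < k * d"
    then have "d > 0" by (cases d) auto
    then have h: "gs ! (p mod d) \<in> set gs" using d by simp
    have "p div d < k" using p by (simp add: less_mult_imp_div_less)
    then have "ys ! (p div d) \<in># X" using ys by (auto dest!: mset_subset_eqD)
    then show "is_value n (ys ! (p div d)) (gs ! (p mod d)) (vvalue n (ys ! (p div d)) (gs ! (p mod d)))"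
      using is_value_vvalue[OF X] gs[OF h] by blast
    show "gs ! (p mod d) \<in> carrier_vec n" using gs[OF h] by blast
  qed
  then show ?thesis unfolding sym_module_def mem_Collect_eq by simp
qed

text \<open>Testing with \<open>x\<close> and \<open>y\<close> themselves suffices, and their second
  entries are within the permitted range of \<open>w\<close>.\<close>

lemma eqv_of_bounds:
  assumes "fst x \<noteq> 0" "fst y \<noteq> 0" "snd x \<le> m" "snd y \<le> m"
    and "\<And>c w. c \<noteq> 0 \<Longrightarrow> w \<le> m \<Longrightarrow> lev x (c, w) \<longleftrightarrow> lev y (c, w)"
  shows "eqv x y"
  using assms(5)[of "fst x" "snd x"] assms(5)[of "fst y" "snd y"] assms(1-4) lev_refl[of x] lev_refl[of y]
  unfolding eqv_def by simp

text \<open>\<open>gs\<close> separates the pairs of \<open>X\<close> and \<open>Y\<close> together,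
  so a pair of \<open>X\<close> and a pair of \<open>Y\<close> with equivalent values coincide.
  Successive quotients of the products of the \<open>k\<close> largest values compare the two sorted
  lists entry by entry, multiplicities included.\<close>

theorem sym_module_determines:
  assumes X: "\<And>x. x \<in># X \<Longrightarrow> x \<in> R_set \<O> n l" and Y: "\<And>x. x \<in># Y \<Longrightarrow> x \<in> R_set \<O> n l"
    and size: "size X = N" "size Y = N"
    and eq: "\<And>k d w. k \<le> N \<Longrightarrow> d \<le> sep_bound (2 * N) \<Longrightarrow> w \<le> k * d \<Longrightarrow>
      sym_module n k d w X = sym_module n k d w Y"
  shows "X = Y"
proof -
  let ?J = "set_mset X \<union> set_mset Y"
  define H where "H = {h :: 'a vec. h \<in> carrier_vec n \<and> h \<noteq> 0\<^sub>v n}"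
  have R: "x \<in> R_set \<O> n l" if "x \<in> ?J" for x using that X Y by blast
  have val: "is_value n x h (vvalue n x h)" if "x \<in> ?J" "h \<in> H" for x h
    using is_value_vvalue[OF R[OF that(1)]] that(2) by (auto simp: H_def)
  have nz: "fst (vvalue n x h) \<noteq> 0" if "x \<in> ?J" "h \<in> H" for x h
    using val[OF that] by (simp add: is_value_def)
  have sep: "\<exists>h\<in>H. \<not> eqv (vvalue n x h) (vvalue n y h)" if "x \<in> ?J" "y \<in> ?J" "x \<noteq> y" for x y
    using lattice_subspace_eqI[OF R[OF that(1)] R[OF that(2)]] that(3) by (auto simp: H_def)
  obtain gs where gs: "set gs \<subseteq> H" "length gs \<le> sep_bound (card ?J)"
    "\<forall>x\<in>?J. \<forall>y\<in>?J. x \<noteq> y \<longrightarrow> \<not> eqv (vprod (vvalue n x) gs) (vprod (vvalue n y) gs)"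
    using separating_list[of ?J H "vvalue n"] nz sep by auto
  have cs: "card (set_mset Z) \<le> size Z" for Z :: "('a vec set \<times> 'a vec set set) multiset"
    using size_multiset_overloaded_eq[of Z] sum_mono[of "set_mset Z" "\<lambda>_. 1" "count Z"] by (simp add: Suc_leI)
  have "card ?J \<le> 2 * N"
    using card_Un_le[of "set_mset X" "set_mset Y"] size cs[of X] cs[of Y] by linarith
  define d where "d = length gs"
  have d: "d \<le> sep_bound (2 * N)"
    using gs(2) sep_bound_mono[OF \<open>card ?J \<le> 2 * N\<close>] by (simp add: d_def)
  define v where "v x = vprod (vvalue n x) gs" for x
  have v0: "fst (v x) \<noteq> 0" if "x \<in> ?J" for x
    unfolding v_def using nz[OF that] gs(1) by (intro fst_vprod) blast
  \<comment> \<open>Keeps the radii within \<open>w \<le> k * d\<close>, the range in which the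
    modules are assumed to agree.\<close>
  have vd: "snd (v x) \<le> d" if x: "x \<in> ?J" for x
  proof -
    have "snd (vprod (vvalue n x) hs) \<le> length hs" if "set hs \<subseteq> H" for hs
      using that
    proof (induction hs)
      case (Cons h hs)
      then show ?case using val[OF x, of h] by (auto simp: vmul_def is_value_def)
    qed simp
    then show ?thesis using gs(1) by (simp add: v_def d_def)
  qed
  obtain xs where xs: "mset xs = X" "sorted_wrt (\<lambda>x y. lev (v y) (v x)) xs"
    using ex_sorted_list[of X v] v0 by auto
  obtain ys where ys: "mset ys = Y" "sorted_wrt (\<lambda>x y. lev (v y) (v x)) ys"
    using ex_sorted_list[of Y v] v0 by auto
  have len: "length xs = N" "length ys = N" using size xs(1) ys(1) by auto
  have setJ: "set xs \<subseteq> ?J" "set ys \<subseteq> ?J" using xs(1) ys(1) by auto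
  have top: "inverse c \<cdot>\<^sub>v tens n (k * d) (\<lambda>p. gs ! (p mod d)) \<in> sym_module n k d w (mset zs) \<longleftrightarrow>
      lev (vprod v (take k zs)) (c, w)"
    if zs: "set zs \<subseteq> ?J" "sorted_wrt (\<lambda>x y. lev (v y) (v x)) zs" "length zs = N" and k: "k \<le> N" and c: "c \<noteq> 0"
    for zs c k w
  proof -
    have v0': "fst (v z) \<noteq> 0" if "z \<in> set zs" for z using v0 zs(1) that by blast
    have iff: "inverse c \<cdot>\<^sub>v tens n (k * d) (\<lambda>p. gs ! (p mod d)) \<in> sym_module n k d w (mset zs) \<longleftrightarrow>
      (\<forall>ys. length ys = k \<longrightarrow> mset ys \<subseteq># mset zs \<longrightarrow> lev (vprod v ys) (c, w))"
      unfolding v_def by (rule pure_tensor_sym_module_iff[OF R]) (use zs(1) gs(1) c in \<open>auto simp: H_def d_def\<close>)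
    have take: "length (take k zs) = k" "mset (take k zs) \<subseteq># mset zs"
      using k zs(3) by (simp, metis append_take_drop_id mset_append mset_subset_eq_add_left)
    have "lev (vprod v us) (c, w)"
      if us: "length us = k" "mset us \<subseteq># mset zs" and l: "lev (vprod v (take k zs)) (c, w)" for us
    proof (rule lev_trans[OF _ l])
      show "lev (vprod v us) (vprod v (take k zs))"
        using lev_vprod_take[OF v0' zs(2) us(2)] us(1) by simp
      show "fst (vprod v (take k zs)) \<noteq> 0" using v0' by (intro fst_vprod) (auto dest: in_set_takeD)
    qed
    then show ?thesis unfolding iff using take by blast
  qed
  have P: "eqv (vprod v (take k xs)) (vprod v (take k ys))" if k: "k \<le> N" for k
  proof (rule eqv_of_bounds)
    have "snd (vprod v (take k zs)) \<le> k * d \<and> fst (vprod v (take k zs)) \<noteq> 0" if "set zs \<subseteq> ?J" for zs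
    proof
      have "snd (vprod v us) \<le> length us * d" if "set us \<subseteq> ?J" for us
        using that
      proof (induction us)
        case (Cons u us)
        have "snd (v u) \<le> d" using Cons.prems by (intro vd) simp
        then show ?case using Cons by (simp add: vmul_def)
      qed simp
      then have "snd (vprod v (take k zs)) \<le> length (take k zs) * d"
        using that by (meson order_trans set_take_subset)
      also have "\<dots> \<le> k * d" by (intro mult_right_mono) auto
      finally show "snd (vprod v (take k zs)) \<le> k * d" .
      show "fst (vprod v (take k zs)) \<noteq> 0" using v0 that by (intro fst_vprod) (auto dest: in_set_takeD)
    qed
    from this[OF setJ(1)] this[OF setJ(2)]
    show "fst (vprod v (take k xs)) \<noteq> 0" "fst (vprod v (take k ys)) \<noteq> 0"
      "snd (vprod v (take k xs)) \<le> k * d" "snd (vprod v (take k ys)) \<le> k * d" by auto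
    show "lev (vprod v (take k xs)) (c, w) \<longleftrightarrow> lev (vprod v (take k ys)) (c, w)"
      if "c \<noteq> 0" "w \<le> k * d" for c w
      using top[OF setJ(1) xs(2) len(1) k that(1), of w] top[OF setJ(2) ys(2) len(2) k that(1), of w]
        eq[OF k d that(2)] unfolding xs(1) ys(1) by metis
  qed
  have "xs ! i = ys ! i" if i: "i < N" for i
  proof (rule ccontr)
    assume ne: "xs ! i \<noteq> ys ! i"
    have mem: "xs ! i \<in> ?J" "ys ! i \<in> ?J" using i len setJ by (metis nth_mem subsetD)+
    \<comment> \<open>The products of the \<open>i\<close> largest and of the \<open>i + 1\<close>
      largest values agree up to \<open>eqv\<close>; cancelling leaves the values at place
      \<open>i\<close>.\<close>
    have 1: "eqv (vprod v (take i xs)) (vprod v (take i ys))" using i by (intro P) simp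
    have 2: "eqv (vmul (vprod v (take i xs)) (v (xs ! i))) (vmul (vprod v (take i ys)) (v (ys ! i)))"
      using P[of "Suc i"] i len by (simp add: take_Suc_conv_app_nth vmul_def)
    have "fst (vprod v (take i zs)) \<noteq> 0" if "set zs \<subseteq> ?J" for zs
    proof (rule fst_vprod)
      fix z assume "z \<in> set (take i zs)"
      then have "z \<in> ?J" using that in_set_takeD by fast
      then show "fst (v z) \<noteq> 0" by (rule v0)
    qed
    then have t0: "fst (vprod v (take i xs)) \<noteq> 0" "fst (vprod v (take i ys)) \<noteq> 0"
      using setJ by blast+
    have 3: "eqv (vmul (vprod v (take i ys)) (v (ys ! i))) (vmul (vprod v (take i xs)) (v (ys ! i)))"
      using 1 v0[OF mem(2)] by (simp add: vmul_comm[of _ "v (ys ! i)"] eqv_cancel eqv_sym)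
    have "eqv (vmul (vprod v (take i xs)) (v (xs ! i))) (vmul (vprod v (take i xs)) (v (ys ! i)))"
      by (rule eqv_trans[OF 2 3]) (intro fst_vmul t0 v0 mem)
    then have "eqv (v (xs ! i)) (v (ys ! i))" using t0 by (simp add: eqv_cancel)
    then show False using gs(3) mem ne by (auto simp: v_def)
  qed
  then have "xs = ys" using len by (intro nth_equalityI) auto
  then show ?thesis using xs(1) ys(1) by simp
qed

end

section \<open>Automorphisms\<close>

lemma valued_automorphism_inv:
  fixes \<sigma> :: "'a::field \<Rightarrow> 'a"
  assumes \<sigma>: "valued_automorphism \<O> \<sigma>"
  shows "valued_automorphism \<O> (inv_into UNIV \<sigma>)"
proof -
  let ?\<tau> = "inv_into UNIV \<sigma>"
  note s = valued_automorphism_simps[OF \<sigma>]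
  have \<sigma>\<tau>: "\<sigma> (?\<tau> x) = x" and \<tau>\<sigma>: "?\<tau> (\<sigma> x) = x" for x
    using s(7) by (simp_all add: bij_is_surj surj_f_inv_f bij_is_inj)
  have "?\<tau> (x + y) = ?\<tau> x + ?\<tau> y" "?\<tau> (x * y) = ?\<tau> x * ?\<tau> y" for x y
    using s(1)[of "?\<tau> x" "?\<tau> y"] s(2)[of "?\<tau> x" "?\<tau> y"] \<sigma>\<tau> \<tau>\<sigma> by metis+
  moreover have "?\<tau> x \<in> \<O> \<longleftrightarrow> x \<in> \<O>" for x using s(6)[of "?\<tau> x"] \<sigma>\<tau> by simp
  moreover have "bij ?\<tau>" using s(7) by (rule bij_imp_bij_inv)
  ultimately show ?thesis by (simp add: valued_automorphism_def)
qed

locale valued_field_automorphism = valued_field +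
  fixes \<sigma> :: "'a \<Rightarrow> 'a"
  assumes automorphism: "valued_automorphism \<O> \<sigma>"
begin

abbreviation "\<sigma>v \<equiv> map_vec \<sigma>"

lemma \<sigma>_simps [simp]: "\<sigma> 0 = 0" "\<sigma> 1 = 1" "\<sigma> (x + y) = \<sigma> x + \<sigma> y" "\<sigma> (x * y) = \<sigma> x * \<sigma> y"
  "\<sigma> (- x) = - \<sigma> x" "\<sigma> x \<in> \<O> \<longleftrightarrow> x \<in> \<O>"
  using valued_automorphism_simps[OF automorphism] by auto

lemma \<sigma>_sum: "\<sigma> (sum f I) = (\<Sum>i\<in>I. \<sigma> (f i))"
  by (induction I rule: infinite_finite_induct) auto

lemma \<sigma>_prod: "\<sigma> (prod f I) = (\<Prod>i\<in>I. \<sigma> (f i))"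
  by (induction I rule: infinite_finite_induct) auto

lemma \<sigma>_inject [simp]: "\<sigma> x = \<sigma> y \<longleftrightarrow> x = y"
  using valued_automorphism_simps(7)[OF automorphism] by (auto dest: bij_is_inj injD)

lemma \<sigma>_M [simp]: "\<sigma> x \<in> \<MM> \<longleftrightarrow> x \<in> \<MM>"
proof -
  have "\<sigma> (inverse x) = inverse (\<sigma> x)"
  proof (cases "x = 0")
    case False
    then have "\<sigma> x * \<sigma> (inverse x) = 1" by (metis \<sigma>_simps(2,4) right_inverse)
    then show ?thesis by (metis inverse_unique)
  qed simp
  then have "inverse (\<sigma> x) \<in> \<O> \<longleftrightarrow> inverse x \<in> \<O>" by (metis \<sigma>_simps(6))
  moreover have "\<sigma> x = 0 \<longleftrightarrow> x = 0" using \<sigma>_inject[of x 0] by simp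
  ultimately show ?thesis by (simp add: mem_M)
qed

lemma \<sigma>v_add: "v \<in> carrier_vec n \<Longrightarrow> w \<in> carrier_vec n \<Longrightarrow> \<sigma>v (v + w) = \<sigma>v v + \<sigma>v w"
  by (intro eq_vecI) auto

lemma \<sigma>v_smult: "\<sigma>v (a \<cdot>\<^sub>v v) = \<sigma> a \<cdot>\<^sub>v \<sigma>v v"
  by (intro eq_vecI) auto

lemma \<sigma>v_zero [simp]: "\<sigma>v (0\<^sub>v n) = 0\<^sub>v n"
  by (intro eq_vecI) auto

lemma \<sigma>_scalar_prod: "dim_vec v = dim_vec w \<Longrightarrow> \<sigma> (v \<bullet> w) = \<sigma>v v \<bullet> \<sigma>v w"
  by (simp add: scalar_prod_def \<sigma>_sum)

lemma \<sigma>v_mult_mat_vec: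
  assumes "A \<in> carrier_mat n m" "v \<in> carrier_vec m"
  shows "\<sigma>v (A *\<^sub>v v) = map_mat \<sigma> A *\<^sub>v \<sigma>v v"
proof (rule eq_vecI)
  fix i assume "i < dim_vec (map_mat \<sigma> A *\<^sub>v \<sigma>v v)"
  then have i: "i < n" using assms by simp
  have "\<sigma> (row A i \<bullet> v) = \<sigma>v (row A i) \<bullet> \<sigma>v v" using assms i by (intro \<sigma>_scalar_prod) auto
  moreover have "\<sigma>v (row A i) = row (map_mat \<sigma> A) i" using assms i by (intro eq_vecI) auto
  ultimately show "\<sigma>v (A *\<^sub>v v) $ i = (map_mat \<sigma> A *\<^sub>v \<sigma>v v) $ i" using assms i by simp
qed (use assms in simp)

text \<open>Images under \<sigma> are handled by proving one inclusion and interpreting the locale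
  again for the inverse to obtain the other.\<close>

lemma inv_automorphism: "valued_field_automorphism \<O> (inv_into UNIV \<sigma>)"
  using automorphism by unfold_locales (rule valued_automorphism_inv)

lemma \<sigma>_inverse [simp]: "\<sigma> (inv_into UNIV \<sigma> x) = x" "inv_into UNIV \<sigma> (\<sigma> x) = x"
  using valued_automorphism_simps(7)[OF automorphism]
  by (simp_all add: bij_is_surj surj_f_inv_f bij_is_inj)

lemma \<sigma>v_inverse [simp]: "\<sigma>v (map_vec (inv_into UNIV \<sigma>) v) = v" "map_vec (inv_into UNIV \<sigma>) (\<sigma>v v) = v"
  by (intro eq_vecI; simp)+

lemma \<sigma>v_inj: "inj \<sigma>v"
  by (rule inj_on_inverseI[of _ "map_vec (inv_into UNIV \<sigma>)"]) simp

lemma image_\<sigma>v_eqI: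
  assumes "\<And>v. v \<in> X \<Longrightarrow> \<sigma>v v \<in> Y" "\<And>v. v \<in> Y \<Longrightarrow> map_vec (inv_into UNIV \<sigma>) v \<in> X"
  shows "\<sigma>v ` X = Y"
proof (intro equalityI subsetI)
  fix v assume "v \<in> Y"
  then have "v = \<sigma>v (map_vec (inv_into UNIV \<sigma>) v)" "map_vec (inv_into UNIV \<sigma>) v \<in> X" using assms(2) by auto
  then show "v \<in> \<sigma>v ` X" by blast
qed (use assms(1) in blast)

lemma image_box:
  assumes "X = \<O> \<or> X = \<MM>"
  shows "\<sigma>v ` box n X = box n X"
proof -
  interpret inv: valued_field_automorphism \<O> "inv_into UNIV \<sigma>" by (rule inv_automorphism)
  show ?thesis by (rule image_\<sigma>v_eqI) (use assms in \<open>auto simp: box_def\<close>)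
qed

lemma image_span_box:
  assumes B: "B \<in> carrier_mat n m" and X: "X = \<O> \<or> X = \<MM>"
  shows "\<sigma>v ` span_box X B = span_box X (map_mat \<sigma> B)"
proof -
  have "\<sigma>v ` span_box X B = (\<lambda>v. map_mat \<sigma> B *\<^sub>v \<sigma>v v) ` box m X"
    using B unfolding span_box_def image_image
    by (intro image_cong) (auto simp: \<sigma>v_mult_mat_vec[OF B] box_def)
  also have "\<dots> = (*\<^sub>v) (map_mat \<sigma> B) ` (\<sigma>v ` box m X)" by (simp add: image_image)
  also have "\<dots> = span_box X (map_mat \<sigma> B)" using B unfolding image_box[OF X] by (simp add: span_box_def)
  finally show ?thesis .
qed

lemma submodule_image:
  assumes "submodule \<O> n N"
  shows "submodule \<O> n (\<sigma>v ` N)"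
proof -
  have c: "N \<subseteq> carrier_vec n" using assms by (simp add: submodule_def)
  show ?thesis unfolding submodule_def
  proof (intro conjI ballI)
    show "\<sigma>v ` N \<subseteq> carrier_vec n" using c by auto
    have "0\<^sub>v n = \<sigma>v (0\<^sub>v n)" "0\<^sub>v n \<in> N" using assms by (auto simp: submodule_def)
    then show "0\<^sub>v n \<in> \<sigma>v ` N" by blast
  next
    fix v w assume "v \<in> \<sigma>v ` N" "w \<in> \<sigma>v ` N"
    then obtain v' w' where vw: "v = \<sigma>v v'" "w = \<sigma>v w'" "v' \<in> N" "w' \<in> N" by blast
    have "v + w = \<sigma>v (v' + w')" unfolding vw using vw(3,4) c by (intro \<sigma>v_add[symmetric]) auto
    then show "v + w \<in> \<sigma>v ` N" using assms vw(3,4) by (simp add: submodule_def)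
  next
    fix a v assume a: "a \<in> \<O>" "v \<in> \<sigma>v ` N"
    then obtain v' where v: "v = \<sigma>v v'" "v' \<in> N" by blast
    interpret inv: valued_field_automorphism \<O> "inv_into UNIV \<sigma>" by (rule inv_automorphism)
    have "a \<cdot>\<^sub>v v = \<sigma>v (inv_into UNIV \<sigma> a \<cdot>\<^sub>v v')" by (simp add: v \<sigma>v_smult)
    moreover have "inv_into UNIV \<sigma> a \<in> \<O>" using a(1) by simp
    ultimately show "a \<cdot>\<^sub>v v \<in> \<sigma>v ` N" using assms v(2) by (simp add: submodule_def)
  qed
qed

text \<open>\<open>max_mult\<close> is an intersection of submodules, so a competitor
  \<open>N\<close> for the image is pulled back along the inverse to one for \<Lambda>.\<close>

lemma max_mult_image_subset: "\<sigma>v ` max_mult \<O> n \<Lambda> \<subseteq> max_mult \<O> n (\<sigma>v ` \<Lambda>)"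
proof (intro image_subsetI)
  interpret inv: valued_field_automorphism \<O> "inv_into UNIV \<sigma>" by (rule inv_automorphism)
  fix v assume v: "v \<in> max_mult \<O> n \<Lambda>"
  have "\<sigma>v v \<in> N" if N: "submodule \<O> n N" "\<forall>a\<in>\<MM>. \<forall>v\<in>\<sigma>v ` \<Lambda>. a \<cdot>\<^sub>v v \<in> N" for N
  proof -
    have "a \<cdot>\<^sub>v u \<in> inv.\<sigma>v ` N" if "a \<in> \<MM>" "u \<in> \<Lambda>" for a u
    proof -
      have "\<sigma> a \<cdot>\<^sub>v \<sigma>v u \<in> N" using N(2) that by auto
      then have "inv.\<sigma>v (\<sigma> a \<cdot>\<^sub>v \<sigma>v u) \<in> inv.\<sigma>v ` N" by blast
      then show ?thesis by (simp add: inv.\<sigma>v_smult)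
    qed
    then have "v \<in> inv.\<sigma>v ` N" using v inv.submodule_image[OF N(1)] unfolding max_mult_def by blast
    then show ?thesis by auto
  qed
  then show "\<sigma>v v \<in> max_mult \<O> n (\<sigma>v ` \<Lambda>)" unfolding max_mult_def by blast
qed

lemma max_mult_image: "max_mult \<O> n (\<sigma>v ` \<Lambda>) = \<sigma>v ` max_mult \<O> n \<Lambda>"
proof (intro equalityI max_mult_image_subset)
  interpret inv: valued_field_automorphism \<O> "inv_into UNIV \<sigma>" by (rule inv_automorphism)
  have "inv.\<sigma>v ` max_mult \<O> n (\<sigma>v ` \<Lambda>) \<subseteq> max_mult \<O> n \<Lambda>"
    using inv.max_mult_image_subset[of n "\<sigma>v ` \<Lambda>"] by (simp add: image_image)
  then have "\<sigma>v ` inv.\<sigma>v ` max_mult \<O> n (\<sigma>v ` \<Lambda>) \<subseteq> \<sigma>v ` max_mult \<O> n \<Lambda>" by blast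
  then show "max_mult \<O> n (\<sigma>v ` \<Lambda>) \<subseteq> \<sigma>v ` max_mult \<O> n \<Lambda>" by (simp add: image_image)
qed

lemma max_mult_carrier: "\<Lambda> \<subseteq> carrier_vec n \<Longrightarrow> max_mult \<O> n \<Lambda> \<subseteq> carrier_vec n"
proof -
  assume "\<Lambda> \<subseteq> carrier_vec n"
  then have "\<forall>a\<in>\<MM>. \<forall>v\<in>\<Lambda>. a \<cdot>\<^sub>v v \<in> carrier_vec n" by auto
  moreover have "submodule \<O> n (carrier_vec n)" by (auto simp: submodule_def)
  ultimately show "max_mult \<O> n \<Lambda> \<subseteq> carrier_vec n" unfolding max_mult_def by (intro Inter_lower) simp
qed

lemma res_class_image:
  assumes "\<Lambda> \<subseteq> carrier_vec n" "v \<in> carrier_vec n"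
  shows "\<sigma>v ` res_class \<O> n \<Lambda> v = res_class \<O> n (\<sigma>v ` \<Lambda>) (\<sigma>v v)"
proof -
  have "\<sigma>v (v + w) = \<sigma>v v + \<sigma>v w" if "w \<in> max_mult \<O> n \<Lambda>" for w
    using assms max_mult_carrier that by (intro \<sigma>v_add[of _ n]) auto
  then have "(\<lambda>w. \<sigma>v (v + w)) ` max_mult \<O> n \<Lambda> = (\<lambda>w. \<sigma>v v + \<sigma>v w) ` max_mult \<O> n \<Lambda>"
    by (rule image_cong[OF refl])
  then show ?thesis by (simp add: res_class_def max_mult_image Setcompr_eq_image image_image)
qed

end

definition pair_act :: "('a \<Rightarrow> 'a) \<Rightarrow> 'a vec set \<times> 'a vec set set \<Rightarrow> 'a vec set \<times> 'a vec set set" where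
  "pair_act \<sigma> x = (map_vec \<sigma> ` fst x, (`) (map_vec \<sigma>) ` snd x)"

section \<open>Codes of pairs as pairs of matrices\<close>

context valued_field
begin

text \<open>The preimage in the lattice of the subspace spanned by the columns of \<open>U\<close>.
  It stands in for the subspace, because membership of a vector in it is first order, while the
  subspace itself is a set of classes.\<close>

definition coded_module :: "nat \<Rightarrow> nat \<Rightarrow> 'a mat \<Rightarrow> 'a mat \<Rightarrow> 'a vec set" where
  "coded_module n l B U = {U *\<^sub>v c + w |c w. c \<in> box l \<O> \<and> w \<in> span_box \<MM> B}"

definition valid_code :: "nat \<Rightarrow> nat \<Rightarrow> 'a mat \<Rightarrow> 'a mat \<Rightarrow> bool" where
  "valid_code n l B U \<longleftrightarrow> (\<exists>D. frame n B D) \<and> U \<in> carrier_mat n l \<and> set (cols U) \<subseteq> span_box \<O> B \<and>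
    (\<forall>c\<in>box l \<O>. U *\<^sub>v c \<in> span_box \<MM> B \<longrightarrow> c \<in> box l \<MM>)"

lemma coded_module_props:
  assumes "valid_code n l B U"
  shows "submodule \<O> n (coded_module n l B U)" "span_box \<MM> B \<subseteq> coded_module n l B U"
    "coded_module n l B U \<subseteq> span_box \<O> B"
    "res_class \<O> n (span_box \<O> B) ` coded_module n l B U = {res_class \<O> n (span_box \<O> B) (U *\<^sub>v c) |c. c \<in> box l \<O>}"
proof -
  obtain D where B: "frame n B D" and U: "U \<in> carrier_mat n l" and cols: "set (cols U) \<subseteq> span_box \<O> B"
    using assms by (auto simp: valid_code_def)
  have sO: "submodule \<O> n (span_box \<O> B)" and sM: "submodule \<O> n (span_box \<MM> B)"
    using submodule_span_box[OF B] by auto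
  have Mc: "w \<in> carrier_vec n" if "w \<in> span_box \<MM> B" for w using that by (simp add: span_box_frame[OF B])
  have Uc: "U *\<^sub>v c \<in> carrier_vec n" for c using U by (intro carrier_vecI) simp
  have MO: "span_box \<MM> B \<subseteq> span_box \<O> B"
    unfolding span_box_frame[OF B] subset_iff by (auto simp: box_def M_O)
  have UO: "U *\<^sub>v c \<in> span_box \<O> B" if c: "c \<in> box l \<O>" for c
  proof -
    have "c $ j \<cdot>\<^sub>v col U j \<in> span_box \<O> B" if "j < l" for j
    proof -
      have "col U j \<in> span_box \<O> B" using that cols U by (auto simp: cols_def)
      then show ?thesis using c that sO by (simp add: box_def submodule_def)
    qed
    then have "vec n (\<lambda>i. \<Sum>j<l. (c $ j \<cdot>\<^sub>v col U j) $ i) \<in> span_box \<O> B" by (rule submodule_sum[OF sO])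
    also have "vec n (\<lambda>i. \<Sum>j<l. (c $ j \<cdot>\<^sub>v col U j) $ i) = U *\<^sub>v c"
      using c U by (intro eq_vecI) (auto simp: box_def scalar_prod_sum[of c l] mult.commute intro!: sum.cong)
    finally show ?thesis .
  qed
  show "coded_module n l B U \<subseteq> span_box \<O> B"
    using UO MO sO unfolding coded_module_def submodule_def by blast
  have U0: "U *\<^sub>v 0\<^sub>v l = 0\<^sub>v n" using U by (intro eq_vecI) (auto simp: scalar_prod_def)
  have b0: "0\<^sub>v l \<in> box l \<O>" by (simp add: box_def)
  show MN: "span_box \<MM> B \<subseteq> coded_module n l B U"
  proof
    fix w assume w: "w \<in> span_box \<MM> B"
    have "w = U *\<^sub>v 0\<^sub>v l + w" using Mc[OF w] by (simp add: U0)
    then show "w \<in> coded_module n l B U" using w b0 unfolding coded_module_def by blast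
  qed
  show "submodule \<O> n (coded_module n l B U)"
    unfolding submodule_def
  proof (intro conjI ballI)
    show "coded_module n l B U \<subseteq> carrier_vec n" using Uc Mc by (auto simp: coded_module_def)
    show "0\<^sub>v n \<in> coded_module n l B U" using MN sM by (auto simp: submodule_def)
  next
    fix v v' assume "v \<in> coded_module n l B U" "v' \<in> coded_module n l B U"
    then obtain c w c' w' where *: "v = U *\<^sub>v c + w" "v' = U *\<^sub>v c' + w'" "c \<in> box l \<O>" "c' \<in> box l \<O>"
      "w \<in> span_box \<MM> B" "w' \<in> span_box \<MM> B" unfolding coded_module_def by blast
    have "U *\<^sub>v (c + c') = U *\<^sub>v c + U *\<^sub>v c'" using *(3,4) by (intro mult_add_distrib_mat_vec[OF U]) (auto simp: box_def)
    then have "v + v' = U *\<^sub>v (c + c') + (w + w')"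
      unfolding * using Uc[of c] Uc[of c'] Mc[OF *(5)] Mc[OF *(6)] by (intro eq_vecI) auto
    moreover have "c + c' \<in> box l \<O>" using *(3,4) submodule_box[of \<O> l] by (simp add: submodule_def)
    moreover have "w + w' \<in> span_box \<MM> B" using *(5,6) sM by (simp add: submodule_def)
    ultimately show "v + v' \<in> coded_module n l B U" unfolding coded_module_def by blast
  next
    fix a v assume a: "a \<in> \<O>" and "v \<in> coded_module n l B U"
    then obtain c w where *: "v = U *\<^sub>v c + w" "c \<in> box l \<O>" "w \<in> span_box \<MM> B"
      unfolding coded_module_def by blast
    have "U *\<^sub>v (a \<cdot>\<^sub>v c) = a \<cdot>\<^sub>v (U *\<^sub>v c)" using *(2) by (intro mult_mat_vec[OF U]) (auto simp: box_def)
    then have "a \<cdot>\<^sub>v v = U *\<^sub>v (a \<cdot>\<^sub>v c) + a \<cdot>\<^sub>v w"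
      unfolding *(1) smult_add_distrib_vec[OF Uc Mc[OF *(3)]] by simp
    moreover have "a \<cdot>\<^sub>v c \<in> box l \<O>" using *(2) a submodule_box[of \<O> l] by (simp add: submodule_def)
    moreover have "a \<cdot>\<^sub>v w \<in> span_box \<MM> B" using *(3) a sM by (simp add: submodule_def)
    ultimately show "a \<cdot>\<^sub>v v \<in> coded_module n l B U" unfolding coded_module_def by blast
  qed
  have "res_class \<O> n (span_box \<O> B) (U *\<^sub>v c + w) = res_class \<O> n (span_box \<O> B) (U *\<^sub>v c)"
    if w: "w \<in> span_box \<MM> B" for c w
  proof -
    have carr: "U *\<^sub>v c + w \<in> carrier_vec n" using Uc Mc[OF w] by simp
    have "D *\<^sub>v (U *\<^sub>v c + w) = D *\<^sub>v (U *\<^sub>v c) + D *\<^sub>v w"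
      by (rule mult_add_distrib_mat_vec[OF frameD(2)[OF B] Uc Mc[OF w]])
    then show ?thesis
      unfolding res_class_eq_iff[OF B carr Uc]
      using w frameD(2)[OF B] unfolding span_box_frame[OF B] by (auto simp: box_def)
  qed
  moreover have "0\<^sub>v n \<in> span_box \<MM> B" using sM by (simp add: submodule_def)
  ultimately show "res_class \<O> n (span_box \<O> B) ` coded_module n l B U =
      {res_class \<O> n (span_box \<O> B) (U *\<^sub>v c) |c. c \<in> box l \<O>}"
    unfolding coded_module_def by (auto simp: image_iff)
qed

text \<open>This separates the conditions on the matrices alone from the computation of the pair out
  of them, as both definability and equivariance of the sort require.\<close>

lemma code_iff:
  "(\<Lambda>, V) \<in> R_set \<O> n l \<and> lattice_basis \<O> n \<Lambda> B \<and> res_basis \<O> n l \<Lambda> V U \<longleftrightarrow>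
    valid_code n l B U \<and> \<Lambda> = span_box \<O> B \<and> V = res_class \<O> n (span_box \<O> B) ` coded_module n l B U"
  (is "?l \<longleftrightarrow> ?r")
proof -
  have indep: "(\<forall>c\<in>box l \<O>. res_class \<O> n (span_box \<O> B) (U *\<^sub>v c) = res_class \<O> n (span_box \<O> B) (0\<^sub>v n) \<longrightarrow>
      (\<forall>i<l. c $ i \<in> \<MM>)) \<longleftrightarrow> (\<forall>c\<in>box l \<O>. U *\<^sub>v c \<in> span_box \<MM> B \<longrightarrow> c \<in> box l \<MM>)"
    if B: "frame n B D" and U: "U \<in> carrier_mat n l" for D
  proof -
    have Uc: "U *\<^sub>v c \<in> carrier_vec n" for c using U by (intro carrier_vecI) simp
    have D0: "D *\<^sub>v 0\<^sub>v n = 0\<^sub>v n" using frameD(2)[OF B] by (intro eq_vecI) (auto simp: scalar_prod_def)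
    have "res_class \<O> n (span_box \<O> B) (U *\<^sub>v c) = res_class \<O> n (span_box \<O> B) (0\<^sub>v n) \<longleftrightarrow> U *\<^sub>v c \<in> span_box \<MM> B" for c
      unfolding res_class_eq_iff[OF B Uc zero_carrier_vec] span_box_frame[OF B] D0
      using Uc[of c] frameD(8)[OF B, of "U *\<^sub>v c"] by (simp add: box_def)
    then show ?thesis by (auto simp: box_def)
  qed
  show ?thesis
  proof
    assume l: ?l
    then obtain D where B: "frame n B D" and L: "\<Lambda> = span_box \<O> B" using frame_lattice_basis by blast
    have U: "U \<in> carrier_mat n l" using l by (simp add: res_basis_def)
    have v: "valid_code n l B U"
      using l B unfolding valid_code_def indep[OF B U, symmetric] L res_basis_def std_lattice_box by blast
    have "V = {res_class \<O> n \<Lambda> (U *\<^sub>v c) |c. c \<in> box l \<O>}"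
      using l by (auto simp: res_basis_def std_lattice_box)
    then show ?r using v L coded_module_props(4)[OF v] by simp
  next
    assume r: ?r
    then have v: "valid_code n l B U" by blast
    then obtain D where B: "frame n B D" and U: "U \<in> carrier_mat n l" by (auto simp: valid_code_def)
    note N = coded_module_props[OF v]
    have "res_basis \<O> n l \<Lambda> V U"
      using v r indep[OF B U] N(4) unfolding res_basis_def std_lattice_box valid_code_def by simp
    moreover have "lattice_basis \<O> n \<Lambda> B" using lattice_basis_frame[OF B] r by simp
    moreover have "is_lattice \<O> n \<Lambda>" using is_lattice_iff B r by blast
    moreover have "res_subspace \<O> n \<Lambda> V" using res_subspace_image[OF B N(1-3)] r by simp
    ultimately show ?l by (auto simp: R_set_def)
  qed
qed

lemma coded_module_eqI:
  assumes v: "valid_code n l B U" "valid_code n l B' U'" and L: "span_box \<O> B = span_box \<O> B'"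
    and V: "res_class \<O> n (span_box \<O> B) ` coded_module n l B U = res_class \<O> n (span_box \<O> B') ` coded_module n l B' U'"
  shows "coded_module n l B U = coded_module n l B' U'"
proof -
  obtain D D' where B: "frame n B D" "frame n B' D'" using v by (auto simp: valid_code_def)
  note N = coded_module_props[OF v(1)] and N' = coded_module_props[OF v(2)]
  have "coded_module n l B U \<subseteq> carrier_vec n" "coded_module n l B' U' \<subseteq> carrier_vec n"
    using N(1) N'(1) by (auto simp: submodule_def)
  moreover have "w \<in> coded_module n l B U \<longleftrightarrow> w \<in> coded_module n l B' U'" if "w \<in> carrier_vec n" for w
    using res_class_image_iff[OF B(1) N(1,2) that] res_class_image_iff[OF B(2) N'(1,2) that] L V by simp
  ultimately show ?thesis by blast
qed

lemma R_set_code: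
  assumes "x \<in> R_set \<O> n l"
  obtains B U where "valid_code n l B U" "x = (span_box \<O> B, res_class \<O> n (span_box \<O> B) ` coded_module n l B U)"
proof -
  obtain U where U: "res_basis \<O> n l (fst x) (snd x) U" and L: "is_lattice \<O> n (fst x)"
    using assms by (auto simp: R_set_def)
  obtain B D where "frame n B D" "fst x = span_box \<O> B" using L is_lattice_iff by blast
  then have "lattice_basis \<O> n (fst x) B" using lattice_basis_frame by simp
  then show ?thesis using code_iff[of "fst x" "snd x" n l B U] U assms that[of B U] by (simp add: prod_eq_iff)
qed

end

section \<open>Transport of pairs and symmetric modules along an automorphism\<close>

context valued_field_automorphism
begin

lemma inv_pair_act:
  "pair_act (inv_into UNIV \<sigma>) (pair_act \<sigma> x) = x"
  by (simp add: pair_act_def image_image)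

lemma pair_act_inv: "pair_act \<sigma> (pair_act (inv_into UNIV \<sigma>) x) = x"
  by (simp add: pair_act_def image_image)

text \<open>All conditions on codes are expressed through spans over \<O> and \<MM>, which \<sigma>
  maps to the spans of the image matrices.\<close>

lemma valid_code_image:
  assumes v: "valid_code n l B U"
  shows "valid_code n l (map_mat \<sigma> B) (map_mat \<sigma> U)"
    "pair_act \<sigma> (span_box \<O> B, res_class \<O> n (span_box \<O> B) ` coded_module n l B U) =
      (span_box \<O> (map_mat \<sigma> B), res_class \<O> n (span_box \<O> (map_mat \<sigma> B)) ` coded_module n l (map_mat \<sigma> B) (map_mat \<sigma> U))"
proof -
  obtain D where B: "frame n B D" and U: "U \<in> carrier_mat n l" and cols: "set (cols U) \<subseteq> span_box \<O> B"
    and ind: "\<And>c. c \<in> box l \<O> \<Longrightarrow> U *\<^sub>v c \<in> span_box \<MM> B \<Longrightarrow> c \<in> box l \<MM>"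
    using v by (auto simp: valid_code_def)
  note Bc = frameD(1)[OF B]
  have sB: "\<sigma>v ` span_box \<O> B = span_box \<O> (map_mat \<sigma> B)" "\<sigma>v ` span_box \<MM> B = span_box \<MM> (map_mat \<sigma> B)"
    using image_span_box[OF Bc] by auto
  have sub: "v \<in> X" if "\<sigma>v v \<in> \<sigma>v ` X" for v X using that inj_image_mem_iff[OF \<sigma>v_inj] by blast
  have "\<exists>D. frame n (map_mat \<sigma> B) D"
  proof (rule frame_ex)
    fix v assume v: "v \<in> carrier_vec n" "map_mat \<sigma> B *\<^sub>v v = 0\<^sub>v n"
    define w where "w = map_vec (inv_into UNIV \<sigma>) v"
    have w: "v = \<sigma>v w" "w \<in> carrier_vec n" using v by (auto simp: w_def)
    have "\<sigma>v (B *\<^sub>v w) = \<sigma>v (0\<^sub>v n)" using v(2) w \<sigma>v_mult_mat_vec[OF Bc w(2)] by simp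
    then have "B *\<^sub>v w = 0\<^sub>v n" by (rule injD[OF \<sigma>v_inj])
    then have "w = D *\<^sub>v 0\<^sub>v n" using frameD(5)[OF B w(2)] by simp
    also have "\<dots> = 0\<^sub>v n" using frameD(2)[OF B] by (intro eq_vecI) (auto simp: scalar_prod_def)
    finally show "v = 0\<^sub>v n" using w(1) by simp
  qed (use Bc in simp)
  moreover have "set (cols (map_mat \<sigma> U)) \<subseteq> span_box \<O> (map_mat \<sigma> B)"
  proof
    fix v assume "v \<in> set (cols (map_mat \<sigma> U))"
    then obtain j where j: "j < l" "v = col (map_mat \<sigma> U) j" using U by (auto simp: cols_def)
    then have "v = \<sigma>v (col U j)" using U by (intro eq_vecI) auto
    moreover have "col U j \<in> span_box \<O> B" using cols j U by (auto simp: cols_def)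
    ultimately show "v \<in> span_box \<O> (map_mat \<sigma> B)" using sB(1) by blast
  qed
  moreover have "c \<in> box l \<MM>" if c: "c \<in> box l \<O>" "map_mat \<sigma> U *\<^sub>v c \<in> span_box \<MM> (map_mat \<sigma> B)" for c
  proof -
    obtain c' where c': "c = \<sigma>v c'" "c' \<in> box l \<O>" using c(1) image_box[of \<O> l] by blast
    have "map_mat \<sigma> U *\<^sub>v c = \<sigma>v (U *\<^sub>v c')" using c' \<sigma>v_mult_mat_vec[OF U, of c'] by (simp add: box_def)
    then have "\<sigma>v (U *\<^sub>v c') \<in> \<sigma>v ` span_box \<MM> B" using c(2) unfolding sB(2) by metis
    then have "U *\<^sub>v c' \<in> span_box \<MM> B" by (rule sub)
    then show ?thesis using ind[OF c'(2)] c'(1) image_box[of \<MM> l] by blast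
  qed
  ultimately show valid: "valid_code n l (map_mat \<sigma> B) (map_mat \<sigma> U)" using U by (simp add: valid_code_def)
  have \<Lambda>c: "span_box \<O> B \<subseteq> carrier_vec n" by (auto simp: span_box_frame[OF B])
  have Uc: "U *\<^sub>v c \<in> carrier_vec n" for c using U by (intro carrier_vecI) simp
  have "(`) \<sigma>v ` (\<lambda>c. res_class \<O> n (span_box \<O> B) (U *\<^sub>v c)) ` box l \<O> =
    (\<lambda>c. res_class \<O> n (span_box \<O> (map_mat \<sigma> B)) (map_mat \<sigma> U *\<^sub>v c)) ` (\<sigma>v ` box l \<O>)"
    unfolding image_image
  proof (rule image_cong[OF refl])
    fix c assume "c \<in> box l \<O>"
    then have c: "c \<in> carrier_vec l" by (simp add: box_def)
    show "\<sigma>v ` res_class \<O> n (span_box \<O> B) (U *\<^sub>v c) =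
        res_class \<O> n (span_box \<O> (map_mat \<sigma> B)) (map_mat \<sigma> U *\<^sub>v \<sigma>v c)"
      unfolding res_class_image[OF \<Lambda>c Uc] sB(1) \<sigma>v_mult_mat_vec[OF U c] ..
  qed
  also have "\<sigma>v ` box l \<O> = box l \<O>" by (simp add: image_box)
  finally show "pair_act \<sigma> (span_box \<O> B, res_class \<O> n (span_box \<O> B) ` coded_module n l B U) =
      (span_box \<O> (map_mat \<sigma> B), res_class \<O> n (span_box \<O> (map_mat \<sigma> B)) ` coded_module n l (map_mat \<sigma> B) (map_mat \<sigma> U))"
    unfolding pair_act_def fst_conv snd_conv coded_module_props(4)[OF v] coded_module_props(4)[OF valid]
      Setcompr_eq_image sB(1) by simp
qed

lemma pair_act_R_set: "x \<in> R_set \<O> n l \<Longrightarrow> pair_act \<sigma> x \<in> R_set \<O> n l"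
  using valid_code_image code_iff by (metis R_set_code)

lemma dual_image_subset:
  assumes "x \<in> R_set \<O> n l" "g \<in> dual n x"
  shows "\<sigma>v g \<in> dual n (pair_act \<sigma> x)"
proof -
  have c: "fst x \<subseteq> carrier_vec n" using assms(1) by (auto simp: R_set_def is_lattice_def submodule_def)
  have "\<sigma>v g \<bullet> \<sigma>v v \<in> \<O>" if "v \<in> fst x" for v
  proof -
    have "dim_vec g = dim_vec v" using assms(2) that c by (auto simp: dual_def)
    then show ?thesis using assms(2) that \<sigma>_scalar_prod[of g v] \<sigma>_simps(6)[of "g \<bullet> v"] by (simp add: dual_def)
  qed
  then show ?thesis using assms(2) by (auto simp: dual_def pair_act_def)
qed

lemma annihilator_image_subset:
  assumes x: "x \<in> R_set \<O> n l" and g: "g \<in> annihilator n x"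
  shows "\<sigma>v g \<in> annihilator n (pair_act \<sigma> x)"
proof -
  have c: "fst x \<subseteq> carrier_vec n" using x by (auto simp: R_set_def is_lattice_def submodule_def)
  have "\<sigma>v g \<bullet> \<sigma>v v \<in> \<MM>"
    if v: "v \<in> fst x" "res_class \<O> n (\<sigma>v ` fst x) (\<sigma>v v) \<in> (`) \<sigma>v ` snd x" for v
  proof -
    have vc: "v \<in> carrier_vec n" using v(1) c by blast
    have "\<sigma>v ` res_class \<O> n (fst x) v \<in> (`) \<sigma>v ` snd x" using v(2) res_class_image[OF c vc] by simp
    then have "res_class \<O> n (fst x) v \<in> snd x" using inj_image_eq_iff[OF \<sigma>v_inj] by auto
    then have "g \<bullet> v \<in> \<MM>" using g v(1) by (simp add: annihilator_def)
    moreover have "dim_vec g = dim_vec v" using g v(1) c by (auto simp: annihilator_def dual_def)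
    ultimately show ?thesis using \<sigma>_scalar_prod[of g v] \<sigma>_M[of "g \<bullet> v"] by simp
  qed
  moreover have "\<sigma>v g \<in> dual n (pair_act \<sigma> x)"
    using dual_image_subset[OF x] g by (simp add: annihilator_def)
  ultimately show ?thesis by (auto simp: annihilator_def pair_act_def)
qed

lemma dual_image_iff:
  assumes x: "x \<in> R_set \<O> n l"
  shows "\<sigma>v g \<in> dual n (pair_act \<sigma> x) \<longleftrightarrow> g \<in> dual n x"
    "\<sigma>v g \<in> annihilator n (pair_act \<sigma> x) \<longleftrightarrow> g \<in> annihilator n x"
proof -
  interpret inv: valued_field_automorphism \<O> "inv_into UNIV \<sigma>" by (rule inv_automorphism)
  show "\<sigma>v g \<in> dual n (pair_act \<sigma> x) \<longleftrightarrow> g \<in> dual n x"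
    using dual_image_subset[OF x] inv.dual_image_subset[OF pair_act_R_set[OF x], of "\<sigma>v g"]
    by (auto simp: inv_pair_act)
  show "\<sigma>v g \<in> annihilator n (pair_act \<sigma> x) \<longleftrightarrow> g \<in> annihilator n x"
    using annihilator_image_subset[OF x] inv.annihilator_image_subset[OF pair_act_R_set[OF x], of "\<sigma>v g"]
    by (auto simp: inv_pair_act)
qed

lemma \<sigma>v_tens:
  assumes "\<And>p. p < q \<Longrightarrow> g p \<in> carrier_vec n"
  shows "\<sigma>v (tens n q g) = tens n q (\<lambda>p. \<sigma>v (g p))"
proof (rule eq_vecI)
  fix x assume "x < dim_vec (tens n q (\<lambda>p. \<sigma>v (g p)))"
  then have x: "x < n ^ q" by (simp add: tens_def)
  have "\<sigma> (g p $ (x div n ^ p mod n)) = \<sigma>v (g p) $ (x div n ^ p mod n)" if "p < q" for p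
    using assms[OF that] digit_less[OF x that] by simp
  then show "\<sigma>v (tens n q g) $ x = tens n q (\<lambda>p. \<sigma>v (g p)) $ x"
    using x by (auto simp: tens_def \<sigma>_prod intro!: prod.cong)
qed (simp add: tens_def)

text \<open>The definition uses no basis, only dual lattices and annihilators. Hence every test
  \<open>(ys, g)\<close> for the image multiset is the image of a test for \<open>X\<close>, namely
  of its pullback under the inverse.\<close>

lemma sym_module_image_subset:
  assumes X: "\<And>x. x \<in># X \<Longrightarrow> x \<in> R_set \<O> n l" and f: "f \<in> sym_module n k d w X"
  shows "\<sigma>v f \<in> sym_module n k d w (image_mset (pair_act \<sigma>) X)"
proof -
  interpret inv: valued_field_automorphism \<O> "inv_into UNIV \<sigma>" by (rule inv_automorphism)
  let ?q = "k * d" and ?\<tau> = "inv_into UNIV \<sigma>"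
  have fc: "f \<in> carrier_vec (n ^ ?q)" using f by (simp add: sym_module_def)
  have "tens n ?q g \<bullet> \<sigma>v f \<in> \<O> \<and>
      (w < card {p. p < ?q \<and> g p \<in> annihilator n (ys ! (p div d))} \<longrightarrow> tens n ?q g \<bullet> \<sigma>v f \<in> \<MM>)"
    if ys: "length ys = k" "mset ys \<subseteq># image_mset (pair_act \<sigma>) X"
      and g: "\<forall>p<?q. g p \<in> dual n (ys ! (p div d))" for ys g
  proof -
    define zs where "zs = map (pair_act ?\<tau>) ys"
    define h where "h p = map_vec ?\<tau> (g p)" for p
    have len: "length zs = k" using ys(1) by (simp add: zs_def)
    have "mset zs \<subseteq># image_mset (pair_act ?\<tau>) (image_mset (pair_act \<sigma>) X)"
      unfolding zs_def mset_map using ys(2) by (rule image_mset_subseteq_mono)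
    then have sub: "mset zs \<subseteq># X" by (simp add: image_mset.compositionality comp_def inv_pair_act)
    have z: "zs ! (p div d) \<in> R_set \<O> n l" "ys ! (p div d) = pair_act \<sigma> (zs ! (p div d))" if p: "p < ?q" for p
    proof -
      have "p div d < k" using p by (simp add: less_mult_imp_div_less)
      then have "zs ! (p div d) \<in># X" using sub len by (auto dest!: mset_subset_eqD)
      then show "zs ! (p div d) \<in> R_set \<O> n l" by (rule X)
      show "ys ! (p div d) = pair_act \<sigma> (zs ! (p div d))"
        using \<open>p div d < k\<close> ys(1) by (simp add: zs_def pair_act_inv)
    qed
    have gh: "g p = \<sigma>v (h p)" for p by (simp add: h_def)
    have h: "h p \<in> dual n (zs ! (p div d))" if "p < ?q" for p
      using g[rule_format, OF that] unfolding gh z(2)[OF that] dual_image_iff(1)[OF z(1)[OF that]] .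
    have ann: "{p. p < ?q \<and> g p \<in> annihilator n (ys ! (p div d))} = {p. p < ?q \<and> h p \<in> annihilator n (zs ! (p div d))}"
      using z dual_image_iff(2)[OF z(1)] by (auto simp: gh)
    have "h p \<in> carrier_vec n" if "p < ?q" for p using h[OF that] by (simp add: dual_def)
    then have "\<sigma>v (tens n ?q h) = tens n ?q g" by (simp add: \<sigma>v_tens gh[symmetric])
    moreover have "dim_vec (tens n ?q h) = dim_vec f" using fc by (simp add: tens_def)
    ultimately have eq: "tens n ?q g \<bullet> \<sigma>v f = \<sigma> (tens n ?q h \<bullet> f)" using \<sigma>_scalar_prod by metis
    show ?thesis
      unfolding eq ann using f len sub h by (auto simp: sym_module_def)
  qed
  then show ?thesis using fc by (simp add: sym_module_def)
qed

lemma sym_module_image: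
  assumes X: "\<And>x. x \<in># X \<Longrightarrow> x \<in> R_set \<O> n l"
  shows "\<sigma>v ` sym_module n k d w X = sym_module n k d w (image_mset (pair_act \<sigma>) X)"
proof (rule image_\<sigma>v_eqI)
  interpret inv: valued_field_automorphism \<O> "inv_into UNIV \<sigma>" by (rule inv_automorphism)
  fix v assume v: "v \<in> sym_module n k d w (image_mset (pair_act \<sigma>) X)"
  have "inv.\<sigma>v v \<in> sym_module n k d w (image_mset (pair_act (inv_into UNIV \<sigma>)) (image_mset (pair_act \<sigma>) X))"
    by (rule inv.sym_module_image_subset[where l = l, OF _ v]) (use X pair_act_R_set in \<open>force simp del: split_paired_All split_paired_Ex\<close>)
  then show "inv.\<sigma>v v \<in> sym_module n k d w X"
    by (simp add: image_mset.compositionality comp_def inv_pair_act)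
qed (rule sym_module_image_subset[OF X])

end

section \<open>The geometric sorts\<close>

text \<open>Formulas see the entries of a matrix as values of a function on indices, numbered here
  in the order of \<open>mat_to_list\<close>.\<close>

definition row_major :: "nat \<Rightarrow> nat \<Rightarrow> (nat \<Rightarrow> 'a) \<Rightarrow> 'a mat" where
  "row_major n m f = mat n m (\<lambda>(i, j). f (i * m + j))"

lemma row_major_carrier [simp]: "row_major n m f \<in> carrier_mat n m"
  by (simp add: row_major_def)

lemma concat_row_major: "concat (mat_to_list (row_major n m f)) = map f [0..<n * m]"
proof -
  have "concat (map (\<lambda>i. map (\<lambda>j. f (i * m + j)) [0..<m]) [0..<n]) = map f [0..<n * m]"
  proof (induction n)
    case (Suc n)
    have "map f [0..<Suc n * m] = map f [0..<n * m + m]" by (simp add: add.commute)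
    also have "\<dots> = map f [0..<n * m] @ map (\<lambda>j. f (n * m + j)) [0..<m]" by (rule map_upt_append)
    finally show ?case using Suc by simp
  qed simp
  moreover have "mat_to_list (row_major n m f) = map (\<lambda>i. map (\<lambda>j. f (i * m + j)) [0..<m]) [0..<n]"
    by (auto simp: mat_to_list_def row_major_def)
  ultimately show ?thesis by simp
qed

lemma row_major_surj:
  assumes "A \<in> carrier_mat n m"
  shows "row_major n m (\<lambda>k. A $$ (k div m, k mod m)) = A"
  using assms by (intro eq_matI) (auto simp: row_major_def)

lemma row_major_cong: "(\<And>k. k < n * m \<Longrightarrow> f k = g k) \<Longrightarrow> row_major n m f = row_major n m g"
proof -
  assume eq: "\<And>k. k < n * m \<Longrightarrow> f k = g k"
  have "i * m + j < n * m" if "i < n" "j < m" for i j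
  proof -
    have "i * m + j < Suc i * m" using that(2) by simp
    also have "\<dots> \<le> n * m" using that(1) by (intro mult_right_mono) auto
    finally show ?thesis .
  qed
  then show ?thesis using eq by (auto simp: row_major_def)
qed

lemma row_major_code_iff:
  assumes "B \<in> carrier_mat n n" "U \<in> carrier_mat n l"
  shows "map f [0..<n * n + n * l] = concat (mat_to_list B) @ concat (mat_to_list U) \<longleftrightarrow>
    B = row_major n n f \<and> U = row_major n l (\<lambda>k. f (n * n + k))"
proof
  assume eq: "map f [0..<n * n + n * l] = concat (mat_to_list B) @ concat (mat_to_list U)"
  define b where "b k = B $$ (k div n, k mod n)" for k
  define u where "u k = U $$ (k div l, k mod l)" for k
  have B: "B = row_major n n b" and U: "U = row_major n l u"
    using row_major_surj assms unfolding b_def u_def by metis+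
  have "map f [0..<n * n] = map b [0..<n * n]" "map (\<lambda>k. f (n * n + k)) [0..<n * l] = map u [0..<n * l]"
    using eq unfolding B U concat_row_major map_upt_append by auto
  then have "f k = b k" if "k < n * n" for k using that by simp
  moreover have "f (n * n + k) = u k" if "k < n * l" for k
    using \<open>map (\<lambda>k. f (n * n + k)) [0..<n * l] = map u [0..<n * l]\<close> that by simp
  ultimately show "B = row_major n n f \<and> U = row_major n l (\<lambda>k. f (n * n + k))"
    unfolding B U by (auto intro!: row_major_cong)
next
  assume "B = row_major n n f \<and> U = row_major n l (\<lambda>k. f (n * n + k))"
  then show "map f [0..<n * n + n * l] = concat (mat_to_list B) @ concat (mat_to_list U)"
    by (simp add: concat_row_major map_upt_append)
qed

fun geom_act :: "('a \<Rightarrow> 'a) \<Rightarrow> 'a geom \<Rightarrow> 'a geom" where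
  "geom_act \<sigma> (InK x) = InK (\<sigma> x)"
| "geom_act \<sigma> (InR \<Lambda> V) = InR (map_vec \<sigma> ` \<Lambda>) ((`) (map_vec \<sigma>) ` V)"

lemma tdef_subst:
  assumes "tdef f"
  shows "tdef (\<lambda>E. f (\<lambda>b. E (Suc b)))"
proof -
  obtain t where t: "\<And>E. f E = tval (flat E) t" using assms unfolding tdef_def by blast
  define \<rho> where "\<rho> = (\<lambda>v. case prod_decode v of (b, i) \<Rightarrow> prod_encode (Suc b, i))"
  have "flat E \<circ> \<rho> = flat (\<lambda>b. E (Suc b))" for E :: "nat \<Rightarrow> nat \<Rightarrow> 'a"
    by (auto simp: flat_def \<rho>_def split: prod.splits)
  then show ?thesis unfolding tdef_def by (intro exI[of _ "tren \<rho> t"]) (simp add: tval_tren t)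
qed

lemma fdef_max_ideal:
  assumes "tdef f"
  shows "fdef \<O> (\<lambda>E. f E \<in> max_ideal \<O>)"
proof -
  have "fdef \<O> (\<lambda>E. f E \<in> \<O> \<and> \<not> (\<exists>y. y (0::nat) \<in> \<O> \<and> f E * y 0 = 1))"
    by (intro fdef_intros fdef_ex_block assms tdef_subst)
  moreover have "(\<exists>y. y (0::nat) \<in> \<O> \<and> x * y 0 = 1) \<longleftrightarrow> (\<exists>y\<in>\<O>. x * y = 1)" for x
  proof
    assume "\<exists>y\<in>\<O>. x * y = 1"
    then obtain y where "y \<in> \<O>" "x * y = 1" by blast
    then show "\<exists>y. y (0::nat) \<in> \<O> \<and> x * y 0 = 1" by (intro exI[of _ "\<lambda>_. y"]) simp
  qed blast
  ultimately show ?thesis by (simp add: max_ideal_def)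
qed

section \<open>First-order description of the geometric sorts\<close>

context valued_field
begin

lemma span_box_row_major_carrier: "span_box X (row_major n m f) \<subseteq> carrier_vec n"
proof
  fix v assume "v \<in> span_box X (row_major n m f)"
  then obtain x where "v = row_major n m f *\<^sub>v x" by (auto simp: span_box_def)
  then have "dim_vec v = n" by (simp add: row_major_def)
  then show "v \<in> carrier_vec n" by (rule carrier_vecI)
qed

lemma mem_span_box_row_major:
  "vec n v \<in> span_box X (row_major n m f) \<longleftrightarrow>
    (\<exists>x. (\<forall>j<m. x j \<in> X) \<and> (\<forall>i<n. v i = (\<Sum>j<m. f (i * m + j) * x j)))" (is "?l \<longleftrightarrow> ?r")
proof
  assume ?l
  then obtain x where x: "x \<in> box m X" "vec n v = row_major n m f *\<^sub>v x"
    by (auto simp: span_box_def row_major_def)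
  then have xc: "x \<in> carrier_vec m" by (simp add: box_def)
  have "v i = (\<Sum>j<m. f (i * m + j) * x $ j)" if "i < n" for i
  proof -
    have "v i = (row_major n m f *\<^sub>v x) $ i" using x(2) that by (metis index_vec)
    then show ?thesis using mult_mat_vec_nth[OF row_major_carrier xc that, of f] that by (simp add: row_major_def)
  qed
  then show ?r using x(1) by (intro exI[of _ "\<lambda>j. x $ j"]) (auto simp: box_def)
next
  assume ?r
  then obtain x where x: "\<forall>j<m. x j \<in> X" "\<forall>i<n. v i = (\<Sum>j<m. f (i * m + j) * x j)" by blast
  have "vec n v = row_major n m f *\<^sub>v vec m x"
    using x(2) by (intro eq_vecI) (auto simp: row_major_def scalar_prod_sum[of "vec m x" m] intro!: sum.cong)
  moreover have "vec m x \<in> box m X" using x(1) by (simp add: box_def)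
  ultimately show ?l by (auto simp: span_box_def row_major_def)
qed

text \<open>The variants with suffix \<open>_fun\<close> speak about the entries \<open>f\<close> of a code \<open>(B, U)\<close>, so that they are
  visibly first order.\<close>

definition coded_module_fun where
  "coded_module_fun n l f v \<longleftrightarrow> (\<exists>c x. (\<forall>j<l. c j \<in> \<O>) \<and> (\<forall>j<n. x j \<in> \<MM>) \<and>
    (\<forall>i<n. v i = (\<Sum>j<l. f (n * n + (i * l + j)) * c j) + (\<Sum>j<n. f (i * n + j) * x j)))"

lemma mem_coded_module_row_major:
  "vec n v \<in> coded_module n l (row_major n n f) (row_major n l (\<lambda>k. f (n * n + k))) \<longleftrightarrow> coded_module_fun n l f v"
  (is "?l \<longleftrightarrow> ?r")
proof
  assume ?l
  then obtain c w where c: "c \<in> box l \<O>" "w \<in> span_box \<MM> (row_major n n f)"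
    "vec n v = row_major n l (\<lambda>k. f (n * n + k)) *\<^sub>v c + w" by (auto simp: coded_module_def)
  have wc: "w \<in> carrier_vec n" using c(2) span_box_row_major_carrier by blast
  have cc: "c \<in> carrier_vec l" using c(1) by (simp add: box_def)
  have "vec n (\<lambda>i. w $ i) = w" using wc by auto
  then obtain x where x: "\<forall>j<n. x j \<in> \<MM>" "\<forall>i<n. w $ i = (\<Sum>j<n. f (i * n + j) * x j)"
    using c(2) mem_span_box_row_major[of n "\<lambda>i. w $ i" \<MM> n f] by auto
  have "v i = (\<Sum>j<l. f (n * n + (i * l + j)) * c $ j) + (\<Sum>j<n. f (i * n + j) * x j)" if "i < n" for i
  proof -
    have "v i = (row_major n l (\<lambda>k. f (n * n + k)) *\<^sub>v c + w) $ i" using c(3) that by (metis index_vec)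
    also have "\<dots> = (row_major n l (\<lambda>k. f (n * n + k)) *\<^sub>v c) $ i + w $ i"
      using that wc by (intro index_add_vec(1)) simp
    also have "(row_major n l (\<lambda>k. f (n * n + k)) *\<^sub>v c) $ i = (\<Sum>j<l. f (n * n + (i * l + j)) * c $ j)"
      using mult_mat_vec_nth[OF row_major_carrier cc that, of "\<lambda>k. f (n * n + k)"] that by (simp add: row_major_def)
    finally show ?thesis using x(2) that by simp
  qed
  then show ?r unfolding coded_module_fun_def
    using x(1) c(1) by (intro exI[of _ "\<lambda>j. c $ j"] exI[of _ x]) (auto simp: box_def)
next
  assume ?r
  then obtain c x where cx: "\<forall>j<l. c j \<in> \<O>" "\<forall>j<n. x j \<in> \<MM>"
    "\<forall>i<n. v i = (\<Sum>j<l. f (n * n + (i * l + j)) * c j) + (\<Sum>j<n. f (i * n + j) * x j)"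
    unfolding coded_module_fun_def by blast
  have "vec n (\<lambda>i. \<Sum>j<n. f (i * n + j) * x j) \<in> span_box \<MM> (row_major n n f)"
    unfolding mem_span_box_row_major using cx(2) by blast
  moreover have "vec l c \<in> box l \<O>" using cx(1) by (simp add: box_def)
  moreover have "vec n v = row_major n l (\<lambda>k. f (n * n + k)) *\<^sub>v vec l c + vec n (\<lambda>i. \<Sum>j<n. f (i * n + j) * x j)"
    using cx(3) by (intro eq_vecI) (auto simp: row_major_def scalar_prod_sum[of "vec l c" l] intro!: sum.cong)
  ultimately show ?l unfolding coded_module_def by blast
qed

definition span_fun where
  "span_fun X n f v \<longleftrightarrow> (\<exists>x. (\<forall>j<n. x j \<in> X) \<and> (\<forall>i<n. v i = (\<Sum>j<n. f (i * n + j) * x j)))"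

definition valid_code_fun where
  "valid_code_fun n l f \<longleftrightarrow>
    (\<forall>x. (\<forall>i<n. (\<Sum>j<n. f (i * n + j) * x j) = 0) \<longrightarrow> (\<forall>j<n. x j = 0)) \<and>
    (\<forall>j<l. \<exists>x. (\<forall>j<n. x j \<in> \<O>) \<and> (\<forall>i<n. f (n * n + (i * l + j)) = (\<Sum>j<n. f (i * n + j) * x j))) \<and>
    (\<forall>c. (\<forall>j<l. c j \<in> \<O>) \<longrightarrow>
      (\<exists>x. (\<forall>j<n. x j \<in> \<MM>) \<and> (\<forall>i<n. (\<Sum>j<l. f (n * n + (i * l + j)) * c j) = (\<Sum>j<n. f (i * n + j) * x j))) \<longrightarrow>
      (\<forall>j<l. c j \<in> \<MM>))"

text \<open>Invertibility of \<open>B\<close> becomes triviality of its kernel, and membership in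
  the spans becomes solvability of explicit linear systems in the entries.\<close>

lemma valid_code_row_major:
  "valid_code n l (row_major n n f) (row_major n l (\<lambda>k. f (n * n + k))) \<longleftrightarrow> valid_code_fun n l f"
proof -
  let ?B = "row_major n n f" and ?U = "row_major n l (\<lambda>k. f (n * n + k))"
  have mult: "row_major n m g *\<^sub>v vec m x = vec n (\<lambda>i. \<Sum>j<m. g (i * m + j) * x j)" for m g x
    by (intro eq_vecI) (auto simp: row_major_def scalar_prod_sum[of "vec m x" m] intro!: sum.cong)
  have vecs: "(\<forall>c\<in>carrier_vec m. P c) \<longleftrightarrow> (\<forall>c. P (vec m c))" for m and P :: "'a vec \<Rightarrow> bool"
  proof
    assume "\<forall>c. P (vec m c)"
    moreover have "c = vec m (\<lambda>i. c $ i)" if "c \<in> carrier_vec m" for c using that by auto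
    ultimately show "\<forall>c\<in>carrier_vec m. P c" by metis
  qed auto
  have zero: "vec m x = 0\<^sub>v m \<longleftrightarrow> (\<forall>i<m. x i = 0)" for m and x :: "nat \<Rightarrow> 'a"
    by (auto simp: vec_eq_iff)
  have "(\<exists>D. frame n ?B D) \<longleftrightarrow> (\<forall>x\<in>carrier_vec n. ?B *\<^sub>v x = 0\<^sub>v n \<longrightarrow> x = 0\<^sub>v n)"
  proof
    assume "\<exists>D. frame n ?B D"
    then obtain D where D: "frame n ?B D" by blast
    have D0: "D *\<^sub>v 0\<^sub>v n = 0\<^sub>v n" using frameD(2)[OF D] by (intro eq_vecI) (auto simp: scalar_prod_def)
    show "\<forall>x\<in>carrier_vec n. ?B *\<^sub>v x = 0\<^sub>v n \<longrightarrow> x = 0\<^sub>v n"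
      using frameD(5)[OF D] D0 by metis
  qed (use frame_ex[of ?B n] in auto)
  also have "\<dots> \<longleftrightarrow> (\<forall>x. (\<forall>i<n. (\<Sum>j<n. f (i * n + j) * x j) = 0) \<longrightarrow> (\<forall>j<n. x j = 0))"
    unfolding vecs mult zero ..
  finally have 1: "(\<exists>D. frame n ?B D) \<longleftrightarrow>
    (\<forall>x. (\<forall>i<n. (\<Sum>j<n. f (i * n + j) * x j) = 0) \<longrightarrow> (\<forall>j<n. x j = 0))" .
  have "col ?U j = vec n (\<lambda>i. f (n * n + (i * l + j)))" if "j < l" for j
    using that by (intro eq_vecI) (auto simp: row_major_def)
  then have cols_eq: "set (cols ?U) = (\<lambda>j. vec n (\<lambda>i. f (n * n + (i * l + j)))) ` {..<l}"
    by (auto simp: cols_def row_major_def image_iff)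
  have inst: "vec n (\<lambda>i. f (n * n + (i * l + j))) \<in> span_box \<O> ?B \<longleftrightarrow>
      (\<exists>x. (\<forall>j<n. x j \<in> \<O>) \<and> (\<forall>i<n. f (n * n + (i * l + j)) = (\<Sum>j<n. f (i * n + j) * x j)))" for j
    by (rule mem_span_box_row_major)
  have 2: "set (cols ?U) \<subseteq> span_box \<O> ?B \<longleftrightarrow>
    (\<forall>j<l. \<exists>x. (\<forall>j<n. x j \<in> \<O>) \<and> (\<forall>i<n. f (n * n + (i * l + j)) = (\<Sum>j<n. f (i * n + j) * x j)))"
    unfolding cols_eq image_subset_iff inst[symmetric] by auto
  have "(\<forall>c\<in>box l \<O>. ?U *\<^sub>v c \<in> span_box \<MM> ?B \<longrightarrow> c \<in> box l \<MM>) \<longleftrightarrow>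
    (\<forall>c\<in>carrier_vec l. c \<in> box l \<O> \<longrightarrow> ?U *\<^sub>v c \<in> span_box \<MM> ?B \<longrightarrow> c \<in> box l \<MM>)"
    by (auto simp: box_def)
  also have "\<dots> \<longleftrightarrow> (\<forall>c. (\<forall>j<l. c j \<in> \<O>) \<longrightarrow>
      (\<exists>x. (\<forall>j<n. x j \<in> \<MM>) \<and> (\<forall>i<n. (\<Sum>j<l. f (n * n + (i * l + j)) * c j) = (\<Sum>j<n. f (i * n + j) * x j))) \<longrightarrow>
      (\<forall>j<l. c j \<in> \<MM>))"
    unfolding vecs mult mem_span_box_row_major by (simp add: box_def)
  finally show ?thesis unfolding valid_code_def valid_code_fun_def 1 2 by simp
qed

lemma geom_sort_codes:
  "g \<in> points (geom_sort \<O> (SortR n l)) \<and> map f [0..<n * n + n * l] \<in> codes (geom_sort \<O> (SortR n l)) g \<longleftrightarrow>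
    valid_code_fun n l f \<and> g = InR (span_box \<O> (row_major n n f))
      (res_class \<O> n (span_box \<O> (row_major n n f)) ` coded_module n l (row_major n n f) (row_major n l (\<lambda>k. f (n * n + k))))"
proof -
  let ?B = "row_major n n f" and ?U = "row_major n l (\<lambda>k. f (n * n + k))"
  have "g \<in> points (geom_sort \<O> (SortR n l)) \<and> map f [0..<n * n + n * l] \<in> codes (geom_sort \<O> (SortR n l)) g \<longleftrightarrow>
    (\<exists>B U \<Lambda> V. B = ?B \<and> U = ?U \<and> g = InR \<Lambda> V \<and> (\<Lambda>, V) \<in> R_set \<O> n l \<and> lattice_basis \<O> n \<Lambda> B \<and> res_basis \<O> n l \<Lambda> V U)"
    (is "?l \<longleftrightarrow> ?r")
  proof
    assume ?l
    then obtain B U \<Lambda> V where *: "map f [0..<n * n + n * l] = concat (mat_to_list B) @ concat (mat_to_list U)"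
      "g = InR \<Lambda> V" "lattice_basis \<O> n \<Lambda> B" "res_basis \<O> n l \<Lambda> V U" "(\<Lambda>, V) \<in> R_set \<O> n l" by auto
    have "B \<in> carrier_mat n n" "U \<in> carrier_mat n l" using *(3,4) by (auto simp: lattice_basis_def res_basis_def)
    then show ?r using * row_major_code_iff by metis
  next
    assume ?r
    then show ?l using row_major_code_iff[of ?B n ?U l f] by auto
  qed
  also have "\<dots> \<longleftrightarrow> (\<exists>\<Lambda> V. g = InR \<Lambda> V \<and> valid_code n l ?B ?U \<and> \<Lambda> = span_box \<O> ?B \<and>
      V = res_class \<O> n (span_box \<O> ?B) ` coded_module n l ?B ?U)"
    unfolding code_iff[symmetric] by blast
  finally show ?thesis unfolding valid_code_row_major by blast
qed

text \<open>Equality of lattices is agreement on all vectors. The same works for the subspaces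
  because \<open>coded_module_eqI\<close> replaces them by their preimages.\<close>

lemma same_code_geom_sort:
  "same_code (geom_sort \<O> (SortR n l)) (map f [0..<n * n + n * l]) (map g [0..<n * n + n * l]) \<longleftrightarrow>
    valid_code_fun n l f \<and> valid_code_fun n l g \<and>
    (\<forall>v. span_fun \<O> n f v \<longleftrightarrow> span_fun \<O> n g v) \<and> (\<forall>v. coded_module_fun n l f v \<longleftrightarrow> coded_module_fun n l g v)"
proof -
  let ?B = "\<lambda>f. row_major n n f" and ?U = "\<lambda>f. row_major n l (\<lambda>k. f (n * n + k))"
  have ext: "(\<forall>v. vec n v \<in> X \<longleftrightarrow> vec n v \<in> Y) \<longleftrightarrow> X = Y"
    if "X \<subseteq> carrier_vec n" "Y \<subseteq> carrier_vec n" for X Y :: "'a vec set"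
  proof
    assume *: "\<forall>v. vec n v \<in> X \<longleftrightarrow> vec n v \<in> Y"
    have "c = vec n (\<lambda>i. c $ i)" if "c \<in> carrier_vec n" for c :: "'a vec" using that by auto
    then show "X = Y" using * that by (metis subsetD subsetI subset_antisym)
  qed simp
  have span_c: "span_box \<O> (?B f) \<subseteq> carrier_vec n" for f by (rule span_box_row_major_carrier)
  have spans: "(\<forall>v. span_fun \<O> n f v \<longleftrightarrow> span_fun \<O> n g v) \<longleftrightarrow> span_box \<O> (?B f) = span_box \<O> (?B g)"
    unfolding span_fun_def mem_span_box_row_major[symmetric] by (rule ext[OF span_c span_c])
  have mod_c: "coded_module n l (?B f) (?U f) \<subseteq> carrier_vec n" for f
  proof
    fix v assume "v \<in> coded_module n l (?B f) (?U f)"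
    then obtain c w where "v = ?U f *\<^sub>v c + w" "w \<in> carrier_vec n"
      using span_box_row_major_carrier unfolding coded_module_def by blast
    then show "v \<in> carrier_vec n" by (intro carrier_vecI) simp
  qed
  have mods: "(\<forall>v. coded_module_fun n l f v \<longleftrightarrow> coded_module_fun n l g v) \<longleftrightarrow>
      coded_module n l (?B f) (?U f) = coded_module n l (?B g) (?U g)"
    unfolding mem_coded_module_row_major[symmetric] by (rule ext[OF mod_c mod_c])
  have "same_code (geom_sort \<O> (SortR n l)) (map f [0..<n * n + n * l]) (map g [0..<n * n + n * l]) \<longleftrightarrow>
    (\<exists>x. (x \<in> points (geom_sort \<O> (SortR n l)) \<and> map f [0..<n * n + n * l] \<in> codes (geom_sort \<O> (SortR n l)) x) \<and>
      (x \<in> points (geom_sort \<O> (SortR n l)) \<and> map g [0..<n * n + n * l] \<in> codes (geom_sort \<O> (SortR n l)) x))"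
    unfolding same_code_def by blast
  also have "\<dots> \<longleftrightarrow> valid_code_fun n l f \<and> valid_code_fun n l g \<and> span_box \<O> (?B f) = span_box \<O> (?B g) \<and>
      res_class \<O> n (span_box \<O> (?B f)) ` coded_module n l (?B f) (?U f) =
      res_class \<O> n (span_box \<O> (?B g)) ` coded_module n l (?B g) (?U g)"
    unfolding geom_sort_codes by auto
  also have "\<dots> \<longleftrightarrow> valid_code_fun n l f \<and> valid_code_fun n l g \<and>
      span_box \<O> (?B f) = span_box \<O> (?B g) \<and> coded_module n l (?B f) (?U f) = coded_module n l (?B g) (?U g)"
    using coded_module_eqI unfolding valid_code_row_major[symmetric] by metis
  finally show ?thesis unfolding spans mods .
qed

lemma proper_geom_sort: "proper_interp \<O> (geom_sort \<O> s)"
proof (cases s)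
  case SortK
  have "same_code (geom_sort \<O> SortK) (map f [0..<1]) (map g [0..<1]) \<longleftrightarrow> f 0 = g 0" for f g :: "nat \<Rightarrow> 'a"
    by (auto simp: same_code_def)
  moreover have "arity (geom_sort \<O> SortK) = 1" by simp
  moreover have "fdef \<O> (\<lambda>E. E 0 0 = E 1 0)" by (intro fdef_intros)
  ultimately show ?thesis unfolding SortK proper_interp_def by (simp del: upt_Suc)
next
  case (SortR n l)
  let ?S = "geom_sort \<O> (SortR n l)"
  have ar: "arity ?S = n * n + n * l" by simp
  have "fdef \<O> (\<lambda>E. same_code ?S (map (E 0) [0..<arity ?S]) (map (E 1) [0..<arity ?S]))"
    unfolding ar same_code_geom_sort valid_code_fun_def span_fun_def coded_module_fun_def
    by (intro fdef_intros fdef_ex_block fdef_all_block fdef_max_ideal)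
  moreover have len: "length c = n * n + n * l" if cg: "c \<in> codes ?S g" for c g
  proof -
    obtain B U where "c = concat (mat_to_list B) @ concat (mat_to_list U)" "B \<in> carrier_mat n n" "U \<in> carrier_mat n l"
      using cg by (auto simp: lattice_basis_def res_basis_def)
    moreover have "length (concat (mat_to_list A)) = i * j" if "A \<in> carrier_mat i j" for A :: "'a mat" and i j
      using concat_row_major[of i j "\<lambda>k. A $$ (k div j, k mod j)"] row_major_surj[OF that] by simp
    ultimately show ?thesis by simp
  qed
  moreover have "codes ?S g \<noteq> {}" if g: "g \<in> points ?S" for g
  proof -
    obtain \<Lambda> V where gV: "g = InR \<Lambda> V" "(\<Lambda>, V) \<in> R_set \<O> n l" using g by auto
    obtain B U where "valid_code n l B U" "(\<Lambda>, V) = (span_box \<O> B, res_class \<O> n (span_box \<O> B) ` coded_module n l B U)"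
      using R_set_code[OF gV(2)] by blast
    then have "lattice_basis \<O> n \<Lambda> B" "res_basis \<O> n l \<Lambda> V U" using code_iff[of \<Lambda> V n l B U] by auto
    then show ?thesis using gV by auto
  qed
  moreover have "x = y" if "x \<in> points ?S" "y \<in> points ?S" "c \<in> codes ?S x" "c \<in> codes ?S y" for x y c
  proof -
    have c: "map ((!) c) [0..<n * n + n * l] = c" using len[OF that(3)] by (metis map_nth)
    show ?thesis
      using that geom_sort_codes[of x n l "(!) c"] geom_sort_codes[of y n l "(!) c"] unfolding c by blast
  qed
  ultimately show ?thesis unfolding SortR proper_interp_def ar by blast
qed

lemma equivariant_geom_sort: "equivariant \<O> (geom_sort \<O> s) geom_act"
  unfolding equivariant_def
proof (intro allI impI ballI)
  fix \<sigma> x assume \<sigma>: "valued_automorphism \<O> \<sigma>" and x: "x \<in> points (geom_sort \<O> s)"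
  interpret valued_field_automorphism \<O> \<sigma> by unfold_locales (rule \<sigma>)
  show "geom_act \<sigma> x \<in> points (geom_sort \<O> s) \<and>
    (\<forall>c\<in>codes (geom_sort \<O> s) x. map \<sigma> c \<in> codes (geom_sort \<O> s) (geom_act \<sigma> x))"
  proof (cases s)
    case SortK
    then show ?thesis using x by auto
  next
    case (SortR n l)
    obtain \<Lambda> V where xV: "x = InR \<Lambda> V" "(\<Lambda>, V) \<in> R_set \<O> n l" using x SortR by auto
    have act: "geom_act \<sigma> x = InR (fst (pair_act \<sigma> (\<Lambda>, V))) (snd (pair_act \<sigma> (\<Lambda>, V)))"
      by (simp add: xV pair_act_def)
    have "map \<sigma> c \<in> codes (geom_sort \<O> s) (geom_act \<sigma> x)" if cx: "c \<in> codes (geom_sort \<O> s) x" for c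
    proof -
      obtain B U where c: "c = concat (mat_to_list B) @ concat (mat_to_list U)"
        "lattice_basis \<O> n \<Lambda> B" "res_basis \<O> n l \<Lambda> V U" using cx SortR xV by auto
      have v: "valid_code n l B U" "(\<Lambda>, V) = (span_box \<O> B, res_class \<O> n (span_box \<O> B) ` coded_module n l B U)"
        using c xV(2) code_iff[of \<Lambda> V n l B U] by auto
      have "lattice_basis \<O> n (fst (pair_act \<sigma> (\<Lambda>, V))) (map_mat \<sigma> B)"
        "res_basis \<O> n l (fst (pair_act \<sigma> (\<Lambda>, V))) (snd (pair_act \<sigma> (\<Lambda>, V))) (map_mat \<sigma> U)"
        using valid_code_image[OF v(1)] code_iff[of _ _ n l "map_mat \<sigma> B" "map_mat \<sigma> U"] unfolding v(2) by auto
      moreover have "map \<sigma> (concat (mat_to_list A)) = concat (mat_to_list (map_mat \<sigma> A))" for A :: "'a mat"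
        by (auto simp: mat_to_list_def map_concat comp_def intro!: arg_cong[of _ _ concat])
      ultimately show ?thesis unfolding act SortR by (auto simp: c(1))
    qed
    moreover have "geom_act \<sigma> x \<in> points (geom_sort \<O> s)"
      using pair_act_R_set[OF xV(2)] unfolding act SortR by simp
    ultimately show ?thesis by blast
  qed
qed

end

section \<open>Coding finite multisets\<close>

lemma proots_prod_linear:
  "proots (\<Prod>a\<leftarrow>as. [:- a, 1:]) = mset (as :: 'a::idom list)"
proof (induction as)
  case (Cons a as)
  have "(\<Prod>a\<leftarrow>as. [:- a, 1:]) \<noteq> (0 :: 'a poly)" by (auto simp: prod_list_zero_iff)
  then show ?case using Cons by (simp add: proots_mult del: mult_pCons_left)
qed simp

lemma prod_linear_monic:
  fixes as :: "'a::idom list"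
  shows "degree (\<Prod>a\<leftarrow>as. [:- a, 1:]) = length as" "coeff (\<Prod>a\<leftarrow>as. [:- a, 1:]) (length as) = 1"
proof -
  have "degree (\<Prod>a\<leftarrow>as. [:- a, 1:]) = length as \<and> lead_coeff (\<Prod>a\<leftarrow>as. [:- a, 1:]) = 1"
  proof (induction as)
    case (Cons a as)
    let ?p = "\<Prod>a\<leftarrow>as. [:- a, 1:]"
    have "?p \<noteq> 0" using Cons by auto
    then have "degree ([:- a, 1:] * ?p) = Suc (length as)" using Cons by (subst degree_mult_eq) auto
    moreover have "lead_coeff ([:- a, 1:] * ?p) = 1" using conjunct2[OF Cons] by (subst lead_coeff_mult) simp
    ultimately show ?case by simp
  qed simp
  then have deg: "degree (\<Prod>a\<leftarrow>as. [:- a, 1:]) = length as" and lc: "lead_coeff (\<Prod>a\<leftarrow>as. [:- a, 1:]) = 1"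
    by blast+
  show "degree (\<Prod>a\<leftarrow>as. [:- a, 1:]) = length as" by (rule deg)
  show "coeff (\<Prod>a\<leftarrow>as. [:- a, 1:]) (length as) = 1" using lc unfolding deg .
qed

context valued_field_automorphism
begin

lemma \<sigma>_diff: "\<sigma> (x - y) = \<sigma> x - \<sigma> y"
  using \<sigma>_simps(3)[of x "- y"] by simp

lemma \<sigma>_coeff_prod_linear:
  "\<sigma> (coeff (\<Prod>a\<leftarrow>as. [:- a, 1:]) i) = coeff (\<Prod>a\<leftarrow>map \<sigma> as. [:- a, 1:]) i"
proof (induction as arbitrary: i)
  case Nil
  then show ?case by (simp add: coeff_pCons split: nat.split)
next
  case (Cons a as)
  then show ?case by (simp add: coeff_pCons \<sigma>_diff comp_def split: nat.split)
qed

end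

text \<open>A monic polynomial is determined by its coefficients below the degree, and a multiset by
  the product of its linear factors; so \<open>n\<close> coefficients code \<open>n\<close> elements
  of \<open>K\<close>.\<close>

lemma mset_map_eq_iff_roots:
  fixes as bs :: "'a::idom list"
  assumes "length as = length bs"
  shows "mset as = mset bs \<longleftrightarrow>
    (\<forall>i<length as. coeff (\<Prod>a\<leftarrow>as. [:- a, 1:]) i = coeff (\<Prod>a\<leftarrow>bs. [:- a, 1:]) i)" (is "_ \<longleftrightarrow> ?r")
proof
  assume "mset as = mset bs"
  then have "(\<Prod>a\<leftarrow>as. [:- a, 1:]) = (\<Prod>a\<leftarrow>bs. [:- a, 1:])"
    by (metis mset_map prod_mset_prod_list)
  then show ?r by simp
next
  assume r: ?r
  have "(\<Prod>a\<leftarrow>as. [:- a, 1:]) = (\<Prod>a\<leftarrow>bs. [:- a, 1:])"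
  proof (rule poly_eqI)
    fix i
    show "coeff (\<Prod>a\<leftarrow>as. [:- a, 1:]) i = coeff (\<Prod>a\<leftarrow>bs. [:- a, 1:]) i"
      using r prod_linear_monic[of as] prod_linear_monic[of bs] assms
      by (cases i "length as" rule: linorder_cases) (simp_all add: coeff_eq_0)
  qed
  then show "mset as = mset bs" using proots_prod_linear by metis
qed

lemma image_perm_orbit_eq_iff: "map f ` perm_orbit xs = perm_orbit xs \<longleftrightarrow> image_mset f (mset xs) = mset xs"
proof -
  have "perm_orbit ys = perm_orbit xs \<longleftrightarrow> mset ys = mset xs" for ys by (auto simp: perm_orbit_eq)
  then show ?thesis by (simp add: image_map_perm_orbit)
qed

lemma points_prod_interp_map:
  assumes "\<And>i. i \<in> set is \<Longrightarrow> t i \<in> points (S i)"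
  shows "map t is \<in> points (prod_interp (map S is))"
  using assms by (auto simp: prod_interp_def list_all2_map1 list_all2_map2 intro!: list.rel_refl_strong)

context valued_field
begin

text \<open>Two multisets of size \<open>N\<close> involve at most \<open>2 * N\<close> different pairs, which bounds the degree of a
  separating tensor.\<close>

definition code_indices :: "nat \<Rightarrow> (nat \<times> nat \<times> nat) list" where
  "code_indices N = concat (map (\<lambda>k. concat (map (\<lambda>d. map (\<lambda>w. (k, d, w)) [0..<Suc (k * d)])
    [0..<Suc (sep_bound (2 * N))])) [0..<Suc N])"

lemma set_code_indices: "(k, d, w) \<in> set (code_indices N) \<longleftrightarrow> k \<le> N \<and> d \<le> sep_bound (2 * N) \<and> w \<le> k * d"
  unfolding code_indices_def by (auto simp: image_iff less_Suc_eq_le simp del: upt_Suc)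

text \<open>The ball of radius \<open>(1, k * d)\<close> serves as lattice, and the image of the
  ball of radius \<open>(1, w)\<close> in its reduction as subspace.\<close>

definition sym_pair :: "nat \<Rightarrow> ('a vec set \<times> 'a vec set set) multiset \<Rightarrow> nat \<times> nat \<times> nat \<Rightarrow> 'a vec set \<times> 'a vec set set" where
  "sym_pair n X = (\<lambda>(k, d, w). (sym_module n k d (k * d) X,
    res_class \<O> (n ^ (k * d)) (sym_module n k d (k * d) X) ` sym_module n k d w X))"

text \<open>The dimension comes from \<open>ex_res_basis\<close> and depends on the multiset, so the
  sorts of the code vary with the element that is coded.\<close>

lemma sym_pair_R_set:
  assumes X: "\<And>x. x \<in># X \<Longrightarrow> x \<in> R_set \<O> n l" and k: "k \<le> size X"
  shows "\<exists>l'. sym_pair n X (k, d, w) \<in> R_set \<O> (n ^ (k * d)) l'"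
proof -
  obtain B D where B: "frame (n ^ (k * d)) B D" "span_box \<O> B = sym_module n k d (k * d) X"
    using sym_module_lattice[OF X k] by blast
  show ?thesis
    using ex_res_basis[OF B(1) submodule_sym_module sym_module_bounds[OF B]] by (simp add: sym_pair_def B(2))
qed

text \<open>The first components supply a common lattice. Both balls contain its \<MM>-multiple, so
  \<open>res_class_image_iff\<close> recovers them from their images in the reduction.\<close>

lemma sym_pair_eqD:
  assumes X: "\<And>x. x \<in># X \<Longrightarrow> x \<in> R_set \<O> n l" and Y: "\<And>x. x \<in># Y \<Longrightarrow> x \<in> R_set \<O> n l"
    and k: "k \<le> size X" "k \<le> size Y" and eq: "sym_pair n X (k, d, w) = sym_pair n Y (k, d, w)"
  shows "sym_module n k d w X = sym_module n k d w Y"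
proof -
  obtain B D where B: "frame (n ^ (k * d)) B D" "span_box \<O> B = sym_module n k d (k * d) X"
    using sym_module_lattice[OF X k(1)] by blast
  have eqs: "sym_module n k d (k * d) X = sym_module n k d (k * d) Y"
    "res_class \<O> (n ^ (k * d)) (span_box \<O> B) ` sym_module n k d w X =
     res_class \<O> (n ^ (k * d)) (span_box \<O> B) ` sym_module n k d w Y"
    using eq unfolding sym_pair_def B(2) by (simp, metis (no_types, lifting) case_prod_conv prod.inject)
  have B': "span_box \<O> B = sym_module n k d (k * d) Y" using B(2) eqs(1) by simp
  have "v \<in> sym_module n k d w X \<longleftrightarrow> v \<in> sym_module n k d w Y" if "v \<in> carrier_vec (n ^ (k * d))" for v
    using res_class_image_iff[OF B(1) submodule_sym_module sym_module_bounds(1)[OF B] that, of w]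
      res_class_image_iff[OF B(1) submodule_sym_module sym_module_bounds(1)[OF B(1) B'] that, of w] eqs(2) by simp
  then show ?thesis by (auto simp: sym_module_def)
qed

end

context valued_field_automorphism
begin

lemma pair_act_sym_pair:
  assumes X: "\<And>x. x \<in># X \<Longrightarrow> x \<in> R_set \<O> n l"
  shows "pair_act \<sigma> (sym_pair n X i) = sym_pair n (image_mset (pair_act \<sigma>) X) i"
proof -
  obtain k d w where i: "i = (k, d, w)" by (cases i)
  have sub: "sym_module n k d w' X \<subseteq> carrier_vec (n ^ (k * d))" for w' by (auto simp: sym_module_def)
  have "(`) \<sigma>v ` res_class \<O> (n ^ (k * d)) (sym_module n k d (k * d) X) ` sym_module n k d w X =
    res_class \<O> (n ^ (k * d)) (\<sigma>v ` sym_module n k d (k * d) X) ` \<sigma>v ` sym_module n k d w X"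
    unfolding image_image using sub by (intro image_cong refl res_class_image) auto
  then show ?thesis
    by (simp add: i sym_pair_def pair_act_def sym_module_image[OF X])
qed

text \<open>Forming the balls commutes with \<sigma>. So if all these pairs are fixed,
  \<open>X\<close> and its image have the same balls, and \<open>sym_module_determines\<close>
  applies.\<close>

lemma sym_pair_fixed_iff:
  assumes X: "\<And>x. x \<in># X \<Longrightarrow> x \<in> R_set \<O> n l"
  shows "(\<forall>i\<in>set (code_indices (size X)). pair_act \<sigma> (sym_pair n X i) = sym_pair n X i) \<longleftrightarrow>
    image_mset (pair_act \<sigma>) X = X"
proof
  let ?Y = "image_mset (pair_act \<sigma>) X"
  have Y: "y \<in> R_set \<O> n l" if "y \<in># ?Y" for y using that X pair_act_R_set by auto
  assume fixed: "\<forall>i\<in>set (code_indices (size X)). pair_act \<sigma> (sym_pair n X i) = sym_pair n X i"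
  show "?Y = X"
  proof (rule sym_module_determines[where N = "size X" and n = n and l = l])
    fix k d w assume kdw: "k \<le> size X" "d \<le> sep_bound (2 * size X)" "w \<le> k * d"
    then have "(k, d, w) \<in> set (code_indices (size X))" by (simp add: set_code_indices)
    then have "sym_pair n ?Y (k, d, w) = sym_pair n X (k, d, w)"
      using fixed pair_act_sym_pair[OF X] by metis
    moreover have "k \<le> size ?Y" using kdw(1) by simp
    ultimately show "sym_module n k d w ?Y = sym_module n k d w X"
      using kdw(1) by (intro sym_pair_eqD[where X = ?Y and Y = X and l = l, OF Y X]) assumption+
  qed (use X Y in auto)
next
  assume "image_mset (pair_act \<sigma>) X = X"
  then show "\<forall>i\<in>set (code_indices (size X)). pair_act \<sigma> (sym_pair n X i) = sym_pair n X i"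
    using pair_act_sym_pair[OF X] by simp
qed

end

theorem theorem4p12:
  fixes \<O> :: "'a::alg_closed_field set" and \<kappa> :: "'k rel"
    and s :: sort_name and n :: nat and e :: "'a geom list set"
  assumes "monster_model \<kappa> \<O>"
    and "e \<in> Sym n (points (geom_sort \<O> s))"
  shows "\<exists>ss t. t \<in> points (prod_interp (map (geom_sort \<O>) ss)) \<and>
    interdefinable \<O> (Sym_interp n (geom_sort \<O> s)) e (prod_interp (map (geom_sort \<O>) ss)) t"
proof -
  interpret valued_field \<O>
    using assms(1) by unfold_locales (simp add: monster_model_def ACVF_def)
  obtain xs where xs: "e = perm_orbit xs" "length xs = n" "set xs \<subseteq> points (geom_sort \<O> s)"
    using assms(2) by (auto simp: Sym_def)
  \<comment> \<open>By \<open>interdefinableI\<close> only the stabilisers matter, and an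
    automorphism fixes the orbit \<open>e\<close> exactly when it fixes the multiset of
    \<open>xs\<close>.\<close>
  have reduce: ?thesis
    if t: "t \<in> points (prod_interp (map (geom_sort \<O>) ss))"
      and fixed: "\<And>\<sigma>. valued_field_automorphism \<O> \<sigma> \<Longrightarrow>
        image_mset (geom_act \<sigma>) (mset xs) = mset xs \<longleftrightarrow> map (geom_act \<sigma>) t = t" for ss t
  proof (intro exI conjI interdefinableI[OF assms(1)])
    show "t \<in> points (prod_interp (map (geom_sort \<O>) ss))"
      "t \<in> points (prod_interp (map (geom_sort \<O>) ss))" by (fact t)+
    show "e \<in> points (Sym_interp n (geom_sort \<O> s))" using assms(2) by (simp add: Sym_interp_def)
    show "proper_interp \<O> (Sym_interp n (geom_sort \<O> s))"
      by (intro proper_Sym_interp proper_geom_sort)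
    show "proper_interp \<O> (prod_interp (map (geom_sort \<O>) ss))"
      by (rule proper_prod_interp) (auto simp: proper_geom_sort)
    show "equivariant \<O> (Sym_interp n (geom_sort \<O> s)) (\<lambda>\<sigma> q. map (geom_act \<sigma>) ` q)"
      by (intro equivariant_Sym_interp equivariant_geom_sort)
    show "equivariant \<O> (prod_interp (map (geom_sort \<O>) ss)) (\<lambda>\<sigma>. map (geom_act \<sigma>))"
      by (rule equivariant_prod_interp) (auto simp: equivariant_geom_sort)
    fix \<sigma> assume "valued_automorphism \<O> \<sigma>"
    then have "valued_field_automorphism \<O> \<sigma>" by unfold_locales
    then show "map (geom_act \<sigma>) ` e = e \<longleftrightarrow> map (geom_act \<sigma>) t = t"
      using fixed by (simp add: xs(1) image_perm_orbit_eq_iff)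
  qed
  show ?thesis
  proof (cases s)
    case SortK
    have inj: "image_mset InK A = image_mset InK B \<longleftrightarrow> A = B" for A B :: "'a multiset"
      by (intro inj_eq multiset.inj_map) (simp add: inj_def)
    have "\<exists>as. xs = map InK as"
      using xs(3) SortK by (intro ex_map_conv[THEN iffD2]) auto
    then obtain as where as: "xs = map InK as" by blast
    define c where "c bs i = coeff (\<Prod>a\<leftarrow>bs. [:- a, 1:]) i" for bs :: "'a list" and i
    show ?thesis
    proof (rule reduce)
      show "map (\<lambda>i. InK (c as i)) [0..<n] \<in> points (prod_interp (map (geom_sort \<O>) (map (\<lambda>_. SortK) [0..<n])))"
        unfolding map_map by (rule points_prod_interp_map) simp
      fix \<sigma> assume "valued_field_automorphism \<O> \<sigma>"
      then interpret valued_field_automorphism \<O> \<sigma> .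
      have "image_mset (geom_act \<sigma>) (mset xs) = mset xs \<longleftrightarrow> image_mset InK (mset (map \<sigma> as)) = image_mset InK (mset as)"
        by (simp add: as image_mset.compositionality comp_def)
      also have "\<dots> \<longleftrightarrow> (\<forall>i<n. c (map \<sigma> as) i = c as i)"
        unfolding inj c_def using mset_map_eq_iff_roots[of "map \<sigma> as" as] xs(2) by (simp add: as)
      also have "\<dots> \<longleftrightarrow> map (geom_act \<sigma>) (map (\<lambda>i. InK (c as i)) [0..<n]) = map (\<lambda>i. InK (c as i)) [0..<n]"
        by (auto simp: c_def \<sigma>_coeff_prod_linear)
      finally show "image_mset (geom_act \<sigma>) (mset xs) = mset xs \<longleftrightarrow>
        map (geom_act \<sigma>) (map (\<lambda>i. InK (c as i)) [0..<n]) = map (\<lambda>i. InK (c as i)) [0..<n]" .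
    qed
  next
    case (SortR m l)
    define inR :: "'a vec set \<times> 'a vec set set \<Rightarrow> 'a geom" where "inR x = InR (fst x) (snd x)" for x
    have act: "geom_act \<sigma> (inR x) = inR (pair_act \<sigma> x)" for \<sigma> x by (simp add: inR_def pair_act_def)
    have inj: "inj inR" by (auto simp: inj_def inR_def prod_eq_iff)
    have "\<exists>zs. xs = map inR zs"
      using xs(3) SortR by (intro ex_map_conv[THEN iffD2]) (force simp: inR_def)
    then obtain zs where zs: "xs = map inR zs" by blast
    have Z: "x \<in> R_set \<O> m l" if "x \<in># mset zs" for x
    proof -
      have "inR x \<in> points (geom_sort \<O> (SortR m l))" using xs(3) that by (auto simp: zs SortR)
      then show ?thesis by (auto simp: inR_def)
    qed
    have size: "size (mset zs) = n" using xs(2) by (simp add: zs)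
    have "\<exists>l'. sym_pair m (mset zs) i \<in> R_set \<O> (m ^ (fst i * fst (snd i))) l'"
      if "i \<in> set (code_indices n)" for i
    proof -
      obtain k d w where i: "i = (k, d, w)" by (cases i)
      then have "k \<le> size (mset zs)" using that size by (simp add: set_code_indices)
      then show ?thesis using sym_pair_R_set[OF Z] unfolding i fst_conv snd_conv by blast
    qed
    then obtain ll where ll: "\<And>i. i \<in> set (code_indices n) \<Longrightarrow>
        sym_pair m (mset zs) i \<in> R_set \<O> (m ^ (fst i * fst (snd i))) (ll i)"
      by metis
    show ?thesis
    proof (rule reduce)
      show "map (\<lambda>i. inR (sym_pair m (mset zs) i)) (code_indices n) \<in> points (prod_interp (map (geom_sort \<O>)
          (map (\<lambda>i. SortR (m ^ (fst i * fst (snd i))) (ll i)) (code_indices n))))"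
        unfolding map_map by (rule points_prod_interp_map) (use ll in \<open>auto simp: inR_def\<close>)
      fix \<sigma> assume "valued_field_automorphism \<O> \<sigma>"
      then interpret valued_field_automorphism \<O> \<sigma> .
      have "image_mset (geom_act \<sigma>) (mset xs) = mset xs \<longleftrightarrow>
          image_mset inR (image_mset (pair_act \<sigma>) (mset zs)) = image_mset inR (mset zs)"
        by (simp add: zs image_mset.compositionality comp_def act)
      also have "\<dots> \<longleftrightarrow> image_mset (pair_act \<sigma>) (mset zs) = mset zs"
        by (intro inj_eq multiset.inj_map inj)
      also have "\<dots> \<longleftrightarrow> (\<forall>i\<in>set (code_indices n). pair_act \<sigma> (sym_pair m (mset zs) i) = sym_pair m (mset zs) i)"
        using sym_pair_fixed_iff[where X = "mset zs", OF Z] unfolding size by blast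
      also have "\<dots> \<longleftrightarrow> map (geom_act \<sigma>) (map (\<lambda>i. inR (sym_pair m (mset zs) i)) (code_indices n)) =
          map (\<lambda>i. inR (sym_pair m (mset zs) i)) (code_indices n)"
        using inj by (simp add: act inj_eq)
      finally show "image_mset (geom_act \<sigma>) (mset xs) = mset xs \<longleftrightarrow>
          map (geom_act \<sigma>) (map (\<lambda>i. inR (sym_pair m (mset zs) i)) (code_indices n)) =
          map (\<lambda>i. inR (sym_pair m (mset zs) i)) (code_indices n)" .
    qed
  qed
qed

end
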